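(* Let $P\subset\mathbb{R}^n$ be a smooth lattice polytope of dimension $n$, and let $X_P\subset\mathbb{P}^r$ be the associated projective toric variety, where $r=|P\cap\mathbb{Z}^n|-1$. Then $\operatorname{Sec}X_P$ has the expected dimension $\min\{r,2n+1\}$ unless $P$ is $AGL_n(\mathbb{Z})$-equivalent to one of $$2\Delta_n\ (n\ge2),\qquad (2\Delta_n)_k\ (0\le k\le n-3),\qquad \Delta_\ell\times\Delta_{n-\ell}\ (2\le\ell\le n-2).$$
   Context: All varieties are over $\mathbb{C}$. For a reduced irreducible variety $X\subseteq\mathbb{P}^r$, $\operatorname{Sec}X$ is the closure of the union of all lines in $\mathbb{P}^r$ meeting $X$ in at least $2$ points. A lattice polytope $P$ is smooth if it is simple (each vertex lies on exactly $\dim P$ edges) and the first lattice vectors along the edges incident at any vertex form part of a $\mathbb{Z}$-basis of $\mathbb{Z}^n$. For $P\subset\mathbb{R}^n$ smooth of dimension $n$ with $P\cap\mathbb{Z}^n=\{u_0,\dots,u_r\}$, $X_P\subset\mathbb{P}^r$ is the image of the abstract toric variety of the inner normal fan of $P$ under the embedding given by $x\mapsto[\chi^{u_0}(x):\cdots:\chi^{u_r}(x)]$, with $\chi^{u_i}$ the characters of $(\mathbb{C}^* )^n$; equivalently it is the closure of the image of $(\mathbb{C}^* )^n$ under this map. $AGL_n(\mathbb{Z})$ is the group of affine linear isomorphisms of $\mathbb{Z}^n$. $\Delta_n=\{p\in\mathbb{R}^n_{\ge0}\mid p_1+\cdots+p_n\le1\}$, $2\Delta_n=\{p\in\mathbb{R}^n_{\ge0}\mid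 p_1+\cdots+p_n\le2\}$, and $(2\Delta_n)_k$ is the convex hull of the lattice points of $2\Delta_n\setminus F$, where $F$ is a $k$-dimensional face of $2\Delta_n$. *)

theory Defs
  imports "HOL-Analysis.Analysis"
begin

section \<open>Lattice polytopes in \<open>real ^ 'n\<close>\<close>

definition int_lattice :: "(real ^ 'n) set" where
  "int_lattice = {x. \<forall>i. x $ i \<in> \<int>}"

definition lattice_polytope :: "(real ^ 'n) set \<Rightarrow> bool" where
  "lattice_polytope P \<longleftrightarrow> (\<exists>S. finite S \<and> S \<subseteq> int_lattice \<and> P = convex hull S)"

definition lattice_basis :: "(real ^ 'n) set \<Rightarrow> bool" where
  "lattice_basis B \<longleftrightarrow> finite B \<and> B \<subseteq> int_lattice \<and>
     (\<forall>v\<in>int_lattice. \<exists>!c :: real ^ 'n \<Rightarrow> int.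
        (\<forall>b. b \<notin> B \<longrightarrow> c b = 0) \<and> v = (\<Sum>b\<in>B. of_int (c b) *\<^sub>R b))"

text \<open>The first lattice vector along an edge \<open>e\<close> at the vertex \<open>v\<close> is the vector from \<open>v\<close> to the
  lattice point of \<open>e - {v}\<close> closest to \<open>v\<close>.\<close>

definition first_lattice_vectors :: "(real ^ 'n) set \<Rightarrow> real ^ 'n \<Rightarrow> (real ^ 'n) set" where
  "first_lattice_vectors P v =
     {w. \<exists>e. e edge_of P \<and> v \<in> e \<and> w \<noteq> 0 \<and> v + w \<in> e \<inter> int_lattice \<and>
         open_segment v (v + w) \<inter> int_lattice = {}}"

definition smooth_polytope :: "(real ^ 'n) set \<Rightarrow> bool" where
  "smooth_polytope P \<longleftrightarrow> lattice_polytope P \<and>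
     (\<forall>v. v extreme_point_of P \<longrightarrow>
        int (card {e. e edge_of P \<and> v \<in> e}) = aff_dim P \<and>
        (\<exists>B. lattice_basis B \<and> first_lattice_vectors P v \<subseteq> B))"

text \<open>Elements of \<open>AGL\<^sub>n(\<int>)\<close> are represented by their affine extensions to \<open>real ^ 'n\<close>.\<close>

definition AGL :: "(real ^ 'n \<Rightarrow> real ^ 'n) set" where
  "AGL = {\<phi>. (\<exists>A b. \<phi> = (\<lambda>x. A *v x + b)) \<and> bij_betw \<phi> int_lattice int_lattice}"

definition AGL_equivalent :: "(real ^ 'n) set \<Rightarrow> (real ^ 'n) set \<Rightarrow> bool" where
  "AGL_equivalent P Q \<longleftrightarrow> (\<exists>\<phi>\<in>AGL. \<phi> ` P = Q)"

definition two_simplex :: "(real ^ 'n) set" where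
  "two_simplex = {p. (\<forall>i. 0 \<le> p $ i) \<and> (\<Sum>i\<in>UNIV. p $ i) \<le> 2}"

text \<open>The polytopes \<open>(2\<Delta>\<^sub>n)\<^sub>k\<close>, one for each choice of the \<open>k\<close>-dimensional face.\<close>

definition is_truncated_two_simplex :: "nat \<Rightarrow> (real ^ 'n) set \<Rightarrow> bool" where
  "is_truncated_two_simplex k Q \<longleftrightarrow>
     (\<exists>F. F face_of two_simplex \<and> aff_dim F = int k \<and>
          Q = convex hull ((two_simplex - F) \<inter> int_lattice))"

text \<open>\<open>\<Delta>\<^sub>l \<times> \<Delta>\<^sub>n\<^sub>-\<^sub>l\<close> inside \<open>real ^ 'n\<close>: the set \<open>I\<close> of cardinality \<open>l\<close> singles out the
  coordinates of the first factor. Different choices of \<open>I\<close> differ by a permutation of coordinates.\<close>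

definition simplex_product :: "'n set \<Rightarrow> (real ^ 'n) set" where
  "simplex_product I =
     {p. (\<forall>i. 0 \<le> p $ i) \<and> (\<Sum>i\<in>I. p $ i) \<le> 1 \<and> (\<Sum>i\<in>-I. p $ i) \<le> 1}"


section \<open>Complex projective space with its Zariski topology\<close>

text \<open>Homogeneous coordinates \<open>(x\<^sub>0, \<dots>, x\<^sub>r)\<close> are functions on \<open>nat\<close> vanishing beyond \<open>r\<close>; a point
  of projective space is the set of all its homogeneous coordinate vectors.\<close>

definition hom_coords :: "nat \<Rightarrow> (nat \<Rightarrow> complex) set" where
  "hom_coords r = {x. (\<forall>i>r. x i = 0) \<and> (\<exists>i. x i \<noteq> 0)}"

definition proj_pt :: "(nat \<Rightarrow> complex) \<Rightarrow> (nat \<Rightarrow> complex) set" where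
  "proj_pt x = {(\<lambda>i. c * x i) | c. c \<noteq> 0}"

definition proj_space :: "nat \<Rightarrow> (nat \<Rightarrow> complex) set set" where
  "proj_space r = proj_pt ` hom_coords r"

text \<open>Homogeneous polynomials of degree \<open>d\<close> in the variables \<open>x\<^sub>0, \<dots>, x\<^sub>r\<close>, as functions; \<open>M\<close> is a
  set of exponent vectors and \<open>a\<close> the family of coefficients.\<close>

definition form :: "nat \<Rightarrow> nat \<Rightarrow> ((nat \<Rightarrow> complex) \<Rightarrow> complex) \<Rightarrow> bool" where
  "form r d f \<longleftrightarrow>
     (\<exists>M (a :: (nat \<Rightarrow> nat) \<Rightarrow> complex). finite M \<and> (\<forall>m\<in>M. (\<Sum>i\<le>r. m i) = d) \<and>
        f = (\<lambda>x. \<Sum>m\<in>M. a m * (\<Prod>i\<le>r. x i ^ m i)))"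

definition zero_locus ::
    "nat \<Rightarrow> ((nat \<Rightarrow> complex) \<Rightarrow> complex) set \<Rightarrow> (nat \<Rightarrow> complex) set set" where
  "zero_locus r S = {p \<in> proj_space r. \<forall>f\<in>S. \<forall>x\<in>p. f x = 0}"

definition zariski :: "nat \<Rightarrow> (nat \<Rightarrow> complex) set topology" where
  "zariski r =
     topology (\<lambda>U. \<exists>S. (\<forall>f\<in>S. \<exists>d. form r d f) \<and> U = proj_space r - zero_locus r S)"

lemma form_scale:
  assumes "form r d f"
  shows "f (\<lambda>i. c * x i) = c ^ d * f x"
proof -
  obtain M a where M: "finite M" "\<And>m. m \<in> M \<Longrightarrow> (\<Sum>i\<le>r. m i) = d"
    and f: "f = (\<lambda>x. \<Sum>m\<in>M. a m * (\<Prod>i\<le>r. x i ^ m i))"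
    using assms unfolding form_def by blast
  have "a m * (\<Prod>i\<le>r. (c * x i) ^ m i) = c ^ d * (a m * (\<Prod>i\<le>r. x i ^ m i))"
    if "m \<in> M" for m
    using M(2)[OF that] by (simp add: power_mult_distrib prod.distrib flip: power_sum)
  then show ?thesis
    unfolding f sum_distrib_left by (intro sum.cong) auto
qed

lemma form_mult:
  assumes "form r d f" "form r e g"
  shows "form r (d + e) (\<lambda>x. f x * g x)"
proof -
  obtain M a where M: "finite M" "\<And>m. m \<in> M \<Longrightarrow> (\<Sum>i\<le>r. m i) = d"
    and f: "f = (\<lambda>x. \<Sum>m\<in>M. a m * (\<Prod>i\<le>r. x i ^ m i))"
    using assms(1) unfolding form_def by blast
  obtain N b where N: "finite N" "\<And>m. m \<in> N \<Longrightarrow> (\<Sum>i\<le>r. m i) = e"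
    and g: "g = (\<lambda>x. \<Sum>m\<in>N. b m * (\<Prod>i\<le>r. x i ^ m i))"
    using assms(2) unfolding form_def by blast
  define h :: "(nat \<Rightarrow> nat) \<times> (nat \<Rightarrow> nat) \<Rightarrow> nat \<Rightarrow> nat"
    where "h = (\<lambda>(m, n) i. m i + n i)"
  define c where "c = (\<lambda>k. \<Sum>(m, n) \<in> {p \<in> M \<times> N. h p = k}. a m * b n)"
  have "f x * g x = (\<Sum>k\<in>h ` (M \<times> N). c k * (\<Prod>i\<le>r. x i ^ k i))" for x
  proof -
    have "f x * g x = (\<Sum>p\<in>M \<times> N. a (fst p) * b (snd p) * (\<Prod>i\<le>r. x i ^ h p i))"
      unfolding f g sum_product sum.cartesian_product h_def
      by (intro sum.cong) (auto simp: power_add prod.distrib)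
    also have "\<dots> = (\<Sum>k\<in>h ` (M \<times> N). \<Sum>p\<in>{p \<in> M \<times> N. h p = k}.
        a (fst p) * b (snd p) * (\<Prod>i\<le>r. x i ^ h p i))"
      using M(1) N(1) by (intro sum.image_gen) auto
    also have "\<dots> = (\<Sum>k\<in>h ` (M \<times> N). c k * (\<Prod>i\<le>r. x i ^ k i))"
      unfolding c_def sum_distrib_right by (intro sum.cong) (auto simp: case_prod_beta)
    finally show ?thesis .
  qed
  moreover have "\<forall>k\<in>h ` (M \<times> N). (\<Sum>i\<le>r. k i) = d + e"
    using M(2) N(2) by (auto simp: h_def sum.distrib)
  ultimately show ?thesis
    unfolding form_def using M(1) N(1) by (intro exI[of _ "h ` (M \<times> N)"] exI[of _ c]) auto
qed

lemma zero_locusD: "p \<in> zero_locus r S \<Longrightarrow> f \<in> S \<Longrightarrow> x \<in> p \<Longrightarrow> f x = 0"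
  unfolding zero_locus_def by simp

lemma zero_locus_Un:
  assumes S: "\<forall>f\<in>S. \<exists>d. form r d f" and T: "\<forall>g\<in>T. \<exists>d. form r d g"
  shows "zero_locus r S \<union> zero_locus r T = zero_locus r {(\<lambda>x. f x * g x) | f g. f \<in> S \<and> g \<in> T}"
    (is "_ = zero_locus r ?ST")
proof -
  have "p \<in> zero_locus r T" if p: "p \<in> zero_locus r ?ST" and "p \<notin> zero_locus r S" for p
  proof -
    from that obtain f x where f: "f \<in> S" "x \<in> p" "f x \<noteq> 0"
      unfolding zero_locus_def by blast
    from p obtain z where z: "p = proj_pt z" "p \<in> proj_space r"
      unfolding zero_locus_def proj_space_def by blast
    from f z obtain c where c: "x = (\<lambda>i. c * z i)" "c \<noteq> 0"
      unfolding proj_pt_def by blast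
    have "g y = 0" if gy: "g \<in> T" "y \<in> p" for g y
    proof -
      have "(\<lambda>x. f x * g x) \<in> ?ST"
        using f(1) gy(1) by (intro CollectI exI[of _ f] exI[of _ g] conjI refl)
      from zero_locusD[OF p this f(2)] have "f x * g x = 0" .
      then have "g x = 0" using f by simp
      from bspec[OF T gy(1)] obtain e where e: "form r e g" ..
      have "c ^ e * g z = 0"
        using \<open>g x = 0\<close> unfolding c(1) form_scale[OF e] .
      then have "g z = 0" using c(2) by simp
      obtain c' where y: "y = (\<lambda>i. c' * z i)"
        using gy(2) unfolding z(1) proj_pt_def by blast
      show ?thesis
        unfolding y form_scale[OF e] \<open>g z = 0\<close> by simp
    qed
    then show ?thesis using z unfolding zero_locus_def by blast
  qed
  moreover have "zero_locus r S \<union> zero_locus r T \<subseteq> zero_locus r ?ST"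
    unfolding zero_locus_def by fastforce
  ultimately show ?thesis by blast
qed

lemma openin_zariski:
  "openin (zariski r) U \<longleftrightarrow>
     (\<exists>S. (\<forall>f\<in>S. \<exists>d. form r d f) \<and> U = proj_space r - zero_locus r S)"
proof -
  let ?op = "\<lambda>U. \<exists>S. (\<forall>f\<in>S. \<exists>d. form r d f) \<and> U = proj_space r - zero_locus r S"
  have "?op (U \<inter> V)" if "?op U" "?op V" for U V
  proof -
    from that obtain S T where S: "\<forall>f\<in>S. \<exists>d. form r d f" "U = proj_space r - zero_locus r S"
      and T: "\<forall>f\<in>T. \<exists>d. form r d f" "V = proj_space r - zero_locus r T"
      by blast
    let ?ST = "{(\<lambda>x. f x * g x) | f g. f \<in> S \<and> g \<in> T}"
    have "U \<inter> V = proj_space r - zero_locus r ?ST"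
      unfolding zero_locus_Un[OF S(1) T(1), symmetric] S(2) T(2) by blast
    moreover have "\<forall>f\<in>?ST. \<exists>d. form r d f"
      using S(1) T(1) form_mult by blast
    ultimately show ?thesis by blast
  qed
  moreover have "?op (\<Union>\<K>)" if "\<forall>K\<in>\<K>. ?op K" for \<K>
  proof -
    have "\<forall>K\<in>\<K>. \<exists>S. (\<forall>f\<in>S. \<exists>d. form r d f) \<and> K = proj_space r - zero_locus r S"
      using that by blast
    from bchoice[OF this] obtain S where S: "\<forall>K\<in>\<K>.
        (\<forall>f\<in>S K. \<exists>d. form r d f) \<and> K = proj_space r - zero_locus r (S K)" ..
    have "\<Union>\<K> = (\<Union>K\<in>\<K>. proj_space r - zero_locus r (S K))"
      using S by auto
    also have "\<dots> = proj_space r - zero_locus r (\<Union>K\<in>\<K>. S K)"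
      unfolding zero_locus_def by auto
    finally have "\<Union>\<K> = proj_space r - zero_locus r (\<Union>K\<in>\<K>. S K)" .
    moreover have "\<forall>f\<in>(\<Union>K\<in>\<K>. S K). \<exists>d. form r d f"
      using S by blast
    ultimately show ?thesis by blast
  qed
  ultimately have "istopology ?op"
    unfolding istopology_def by auto
  then show ?thesis
    unfolding zariski_def by (simp add: topology_inverse')
qed

lemma topspace_zariski: "topspace (zariski r) = proj_space r"
proof
  show "topspace (zariski r) \<subseteq> proj_space r"
    using openin_topspace[of "zariski r"] unfolding openin_zariski by blast
  have "form r 0 (\<lambda>x. 1)"
    unfolding form_def by (rule exI[of _ "{\<lambda>_. 0}"], rule exI[of _ "\<lambda>_. 1"]) auto
  moreover have "zero_locus r {\<lambda>x. 1} = {}"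
    unfolding zero_locus_def proj_space_def proj_pt_def by (auto intro: exI[of _ 1])
  ultimately have "openin (zariski r) (proj_space r)"
    unfolding openin_zariski by (intro exI[of _ "{\<lambda>x. 1}"]) auto
  then show "proj_space r \<subseteq> topspace (zariski r)"
    by (rule openin_subset)
qed

lemma closedin_zariski:
  "closedin (zariski r) Z \<longleftrightarrow> (\<exists>S. (\<forall>f\<in>S. \<exists>d. form r d f) \<and> Z = zero_locus r S)"
proof -
  have "zero_locus r S \<subseteq> proj_space r" for S
    unfolding zero_locus_def by blast
  then show ?thesis
    unfolding closedin_def topspace_zariski openin_zariski by (metis Diff_Diff_Int inf.absorb_iff2)
qed

definition irreducible_in :: "'a topology \<Rightarrow> 'a set \<Rightarrow> bool" where
  "irreducible_in X Z \<longleftrightarrow> Z \<noteq> {} \<and> Z \<subseteq> topspace X \<and>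
     (\<forall>A B. closedin X A \<and> closedin X B \<and> Z \<subseteq> A \<union> B \<longrightarrow> Z \<subseteq> A \<or> Z \<subseteq> B)"

text \<open>Dimension of a topological space: the supremum of the lengths \<open>d\<close> of chains
  \<open>Z\<^sub>0 \<subset> \<dots> \<subset> Z\<^sub>d\<close> of irreducible closed subsets. The empty space gets dimension \<open>0\<close> here.\<close>

definition krull_dim :: "'a topology \<Rightarrow> enat" where
  "krull_dim X = Sup {enat d | d. \<exists>Z :: nat \<Rightarrow> 'a set.
     (\<forall>i\<le>d. closedin X (Z i) \<and> irreducible_in X (Z i)) \<and> (\<forall>i<d. Z i \<subset> Z (Suc i))}"

definition proj_line :: "nat \<Rightarrow> (nat \<Rightarrow> complex) set set \<Rightarrow> bool" where
  "proj_line r L \<longleftrightarrow> (\<exists>x\<in>hom_coords r. \<exists>y\<in>hom_coords r. proj_pt x \<noteq> proj_pt y \<and>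
     L = {proj_pt (\<lambda>i. s * x i + t * y i) | s t. (s, t) \<noteq> (0, 0)})"

definition secant_variety :: "nat \<Rightarrow> (nat \<Rightarrow> complex) set set \<Rightarrow> (nat \<Rightarrow> complex) set set" where
  "secant_variety r X =
     zariski r closure_of (\<Union>{L. proj_line r L \<and> (\<exists>p\<in>L \<inter> X. \<exists>q\<in>L \<inter> X. p \<noteq> q)})"


section \<open>The projective toric variety of a list of lattice points\<close>

definition torus :: "(complex ^ 'n) set" where
  "torus = {t. \<forall>i. t $ i \<noteq> 0}"

text \<open>The character \<open>\<chi>\<^sup>m\<close> of the torus, for \<open>m \<in> int_lattice\<close> (so that the floor is exact).\<close>

definition character :: "real ^ 'n \<Rightarrow> complex ^ 'n \<Rightarrow> complex" where
  "character m t = (\<Prod>i\<in>UNIV. (t $ i) powi \<lfloor>m $ i\<rfloor>)"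

definition toric_variety :: "nat \<Rightarrow> (nat \<Rightarrow> real ^ 'n) \<Rightarrow> (nat \<Rightarrow> complex) set set" where
  "toric_variety r u =
     zariski r closure_of
       ((\<lambda>t. proj_pt (\<lambda>i. if i \<le> r then character (u i) t else 0)) ` torus)"

end

theory Submission
  imports Defs "HOL-Complex_Analysis.Conformal_Mappings"
begin

text \<open>At a vertex of \<open>P\<close> the edges give lattice coordinates in which \<open>P\<close> lies in the positive orthant
  and contains \<open>0\<close> and the unit vectors. Deform a secant point \<open>a \<chi>(t) + b \<chi>(t')\<close> so that the
  coordinates of degree at most \<open>1\<close> are dominated by the first summand and those of degree at least
  \<open>2\<close> by the second one (Draisma's tropical lower bound). If the lattice points of degree at least \<open>2\<close>
  span the space affinely, \<open>2 n + 2\<close> coordinates become algebraically independent; if these points are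
  affinely independent, all \<open>r + 1\<close> coordinates do. Comparing the corners at the two ends of an edge
  shows that some vertex falls under one of these two cases unless \<open>P\<close> is on the list of exceptions.
  Krull dimension is bounded above by the growth of the Hilbert function, and below by a chain of
  closures of subfamilies of secants, whose strictness again follows by counting monomials.\<close>

text \<open>Krull dimension is read off from chains of closed sets, so every dimension statement is
  reduced to comparing numbers of monomials. The weights of the deformation come from one
  inequality: scaling the first torus point by \<open>s^2\<close> gives its monomial of degree
  \<open>k\<close> the weight \<open>2 k\<close>, and the second summand carries the constant weight
  3, strictly between 2 and 4. The obstacle is that at a corner the exponents of degree at least 2
  may be neither affinely spanning nor affinely independent. This is what happens in the three
  exceptional families: there all these exponents lie on the hyperplane of degree 2, but there are
  too many of them to be independent. One lattice point of higher degree is often enough to leave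
  that hyperplane. Only one good corner is needed. It is taken at an edge of lattice length at least
  2 if such an edge exists; otherwise all edges at all corners have length 1, and this rigidity
  suffices to recover the polytope.\<close>

lemma homogeneous_system_nontrivial:
  fixes a :: "'i \<Rightarrow> 'k \<Rightarrow> 'f::field"
  assumes "finite K" "finite I" "card K < card I"
  shows "\<exists>c. (\<exists>i\<in>I. c i \<noteq> 0) \<and> (\<forall>k\<in>K. (\<Sum>i\<in>I. c i * a i k) = 0)"
  using assms
proof (induction K arbitrary: I a rule: finite_induct)
  case empty
  then have "I \<noteq> {}" by auto
  then show ?case by (intro exI[of _ "\<lambda>_. 1"]) auto
next
  case (insert k K)
  show ?case
  proof (cases "\<forall>i\<in>I. a i k = 0")
    case True
    have "card K < card I" using insert by auto
    from insert.IH[OF insert.prems(1) this, of a] True show ?thesis by auto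
  next
    case False
    then obtain i0 where i0: "i0 \<in> I" "a i0 k \<noteq> 0" by blast
    let ?I = "I - {i0}"
    \<comment> \<open>Equation \<open>k\<close> is solved for the unknown \<open>i0\<close> and the
      result is substituted into the remaining equations.\<close>
    define a' where "a' = (\<lambda>i k'. a i k' - a i k / a i0 k * a i0 k')"
    have "card K < card ?I" using insert i0 by auto
    from insert.IH[OF _ this, of a'] insert.prems(1)
    obtain c where c: "\<exists>i\<in>?I. c i \<noteq> 0" "\<forall>k'\<in>K. (\<Sum>i\<in>?I. c i * a' i k') = 0" by auto
    define c' where "c' = c(i0 := - (\<Sum>i\<in>?I. c i * a i k / a i0 k))"
    have split: "(\<Sum>i\<in>I. c' i * a i k') = c' i0 * a i0 k' + (\<Sum>i\<in>?I. c i * a i k')" for k'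
    proof -
      have "(\<Sum>i\<in>I. c' i * a i k') = c' i0 * a i0 k' + (\<Sum>i\<in>?I. c' i * a i k')"
        using insert.prems(1) i0(1) by (rule sum.remove)
      then show ?thesis by (simp add: c'_def)
    qed
    have a': "(\<Sum>i\<in>?I. c i * a' i k') = (\<Sum>i\<in>I. c' i * a i k')" for k'
      unfolding split a'_def
      by (simp add: c'_def algebra_simps sum_subtractf sum_distrib_left sum_distrib_right)
    have "(\<Sum>i\<in>I. c' i * a i k) = 0"
      unfolding split using i0(2) by (simp add: c'_def sum_distrib_right)
    moreover have "\<forall>k'\<in>K. (\<Sum>i\<in>I. c' i * a i k') = 0" using c(2) a' by auto
    moreover have "\<exists>i\<in>I. c' i \<noteq> 0" using c(1) by (auto simp: c'_def)
    ultimately show ?thesis by blast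
  qed
qed

subsection \<open>Forms\<close>

lemma form_monom:
  assumes "(\<Sum>i\<le>r. m i) = d"
  shows "form r d (\<lambda>x. \<Prod>i\<le>r. x i ^ m i)"
  unfolding form_def using assms by (intro exI[of _ "{m}"] exI[of _ "\<lambda>_. 1"]) auto

lemma form_zero: "form r d (\<lambda>x. 0)"
  unfolding form_def by (rule exI[of _ "{}"]) auto

lemma form_cmult:
  assumes "form r d f"
  shows "form r d (\<lambda>x. c * f x)"
proof -
  obtain M a where M: "finite M" "\<forall>m\<in>M. (\<Sum>i\<le>r. m i) = d"
    and f: "f = (\<lambda>x. \<Sum>m\<in>M. a m * (\<Prod>i\<le>r. x i ^ m i))"
    using assms unfolding form_def by blast
  show ?thesis
    unfolding form_def f sum_distrib_left using M
    by (intro exI[of _ M] exI[of _ "\<lambda>m. c * a m"]) (auto simp: mult.assoc)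
qed

lemma form_add:
  assumes "form r d f" "form r d g"
  shows "form r d (\<lambda>x. f x + g x)"
proof -
  obtain M a where M: "finite M" "\<forall>m\<in>M. (\<Sum>i\<le>r. m i) = d"
    and f: "f = (\<lambda>x. \<Sum>m\<in>M. a m * (\<Prod>i\<le>r. x i ^ m i))"
    using assms(1) unfolding form_def by blast
  obtain N b where N: "finite N" "\<forall>m\<in>N. (\<Sum>i\<le>r. m i) = d"
    and g: "g = (\<lambda>x. \<Sum>m\<in>N. b m * (\<Prod>i\<le>r. x i ^ m i))"
    using assms(2) unfolding form_def by blast
  define c where "c m = (if m \<in> M then a m else 0) + (if m \<in> N then b m else 0)" for m
  have "f x + g x = (\<Sum>m\<in>M \<union> N. c m * (\<Prod>i\<le>r. x i ^ m i))" for x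
  proof -
    have "f x = (\<Sum>m\<in>M \<union> N. (if m \<in> M then a m else 0) * (\<Prod>i\<le>r. x i ^ m i))"
      unfolding f using M(1) N(1) by (intro sum.mono_neutral_cong_left) auto
    moreover have "g x = (\<Sum>m\<in>M \<union> N. (if m \<in> N then b m else 0) * (\<Prod>i\<le>r. x i ^ m i))"
      unfolding g using M(1) N(1) by (intro sum.mono_neutral_cong_left) auto
    ultimately show ?thesis by (simp add: c_def sum.distrib distrib_right)
  qed
  then show ?thesis
    unfolding form_def using M N by (intro exI[of _ "M \<union> N"] exI[of _ c]) auto
qed

lemma form_sum:
  assumes "\<And>i. i \<in> I \<Longrightarrow> form r d (f i)"
  shows "form r d (\<lambda>x. \<Sum>i\<in>I. f i x)"
  using assms by (induction I rule: infinite_finite_induct) (auto intro: form_zero form_add)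

lemma form_const: "form r 0 (\<lambda>x. c)"
  using form_cmult[OF form_monom[of "\<lambda>_. 0" r 0], of c] by simp

lemma form_power:
  assumes "form r d f"
  shows "form r (d * k) (\<lambda>x. f x ^ k)"
proof (induction k)
  case 0
  then show ?case using form_const[of r 1] by simp
next
  case (Suc k)
  from form_mult[OF assms Suc] show ?case by simp
qed

lemma form_prod:
  assumes "finite I" "\<And>i. i \<in> I \<Longrightarrow> form r (d i) (f i)"
  shows "form r (\<Sum>i\<in>I. d i) (\<lambda>x. \<Prod>i\<in>I. f i x)"
  using assms
proof (induction I rule: finite_induct)
  case empty
  then show ?case using form_const[of r 1] by simp
next
  case (insert i I)
  then have "form r (d i + sum d I) (\<lambda>x. f i x * (\<Prod>i\<in>I. f i x))"
    by (intro form_mult) auto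
  then show ?case using insert by simp
qed

lemma form_coord:
  assumes "i \<le> r"
  shows "form r 1 (\<lambda>x. x i)"
proof -
  have "form r 1 (\<lambda>x. \<Prod>j\<le>r. x j ^ (if j = i then 1 else 0))"
    using assms by (intro form_monom) simp
  moreover have "(\<Prod>j\<le>r. x j ^ (if j = i then 1 else 0)) = x i" for x :: "nat \<Rightarrow> complex"
  proof -
    have "(\<Prod>j\<le>r. x j ^ (if j = i then 1 else 0)) = (\<Prod>j\<le>r. if j = i then x j else 1)"
      by (intro prod.cong) auto
    then show ?thesis using assms by simp
  qed
  ultimately show ?thesis by simp
qed

text \<open>A form of degree 0 is constant, so its value at the origin has to be inferred from a
  zero elsewhere; scaling by 0 treats all degrees at once.\<close>

lemma form_zero_at_0:
  assumes "form r d f" "f x = 0"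
  shows "f (\<lambda>_. 0) = 0"
  using form_scale[OF assms(1), of 0 x] assms(2) by simp

lemma form_cong:
  assumes "form r d f" "\<And>i. i \<le> r \<Longrightarrow> x i = y i"
  shows "f x = f y"
  using assms unfolding form_def by (auto intro!: sum.cong prod.cong)

lemma form_holomorphic:
  assumes "form r d f" "\<And>i. i \<le> r \<Longrightarrow> (\<lambda>s. \<gamma> s i) holomorphic_on S"
  shows "(\<lambda>s. f (\<gamma> s)) holomorphic_on S"
  using assms unfolding form_def by (auto intro!: holomorphic_intros)

subsection \<open>The closed set of forms vanishing on a cone\<close>

definition forms_vanish :: "nat \<Rightarrow> (nat \<Rightarrow> complex) set \<Rightarrow> ((nat \<Rightarrow> complex) \<Rightarrow> complex) set" where
  "forms_vanish r C = {f. (\<exists>d. form r d f) \<and> (\<forall>x\<in>C. f x = 0)}"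

text \<open>The closure is attached to a set of coordinate vectors rather than of points, so that
  the image of a parametrisation can be used as it is, even when it contains the zero
  vector.\<close>

definition proj_closure :: "nat \<Rightarrow> (nat \<Rightarrow> complex) set \<Rightarrow> (nat \<Rightarrow> complex) set set" where
  "proj_closure r C = zero_locus r (forms_vanish r C)"

lemma closedin_proj_closure: "closedin (zariski r) (proj_closure r C)"
  unfolding closedin_zariski proj_closure_def
  by (rule exI[of _ "forms_vanish r C"]) (simp add: forms_vanish_def)

lemma proj_pt_self: "x \<in> proj_pt x"
  unfolding proj_pt_def by (auto intro: exI[of _ 1])

lemma proj_spaceE:
  assumes "p \<in> proj_space r" "x \<in> p"
  shows "x \<in> hom_coords r" "p = proj_pt x"
proof -
  obtain y where y: "p = proj_pt y" "y \<in> hom_coords r" using assms unfolding proj_space_def by blast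
  then obtain c where c: "x = (\<lambda>i. c * y i)" "c \<noteq> 0" using assms unfolding proj_pt_def by blast
  show "x \<in> hom_coords r" using y c unfolding hom_coords_def by auto
  have "(\<lambda>i. c' * y i) \<in> proj_pt x" if "c' \<noteq> 0" for c'
    unfolding proj_pt_def using c that by (intro CollectI exI[of _ "c' / c"]) auto
  moreover have "(\<lambda>i. c' * x i) \<in> proj_pt y" if "c' \<noteq> 0" for c'
    unfolding proj_pt_def using c that by (intro CollectI exI[of _ "c' * c"]) auto
  ultimately show "p = proj_pt x"
    unfolding y(1) by (auto simp: proj_pt_def[of y] proj_pt_def[of x])
qed

lemma proj_pt_eq_iff:
  assumes "x \<in> hom_coords r"
  shows "proj_pt y = proj_pt x \<longleftrightarrow> (\<exists>c. c \<noteq> 0 \<and> y = (\<lambda>i. c * x i))"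
proof
  assume "proj_pt y = proj_pt x"
  then have "y \<in> proj_pt x" using proj_pt_self by blast
  then show "\<exists>c. c \<noteq> 0 \<and> y = (\<lambda>i. c * x i)" unfolding proj_pt_def by auto
next
  assume "\<exists>c. c \<noteq> 0 \<and> y = (\<lambda>i. c * x i)"
  then have "y \<in> proj_pt x" unfolding proj_pt_def by auto
  from proj_spaceE(2)[OF _ this] assms show "proj_pt y = proj_pt x"
    unfolding proj_space_def by auto
qed

lemma form_zero_proj_pt:
  assumes "form r d f" "f x = 0" "y \<in> proj_pt x"
  shows "f y = 0"
  using assms form_scale[OF assms(1)] unfolding proj_pt_def by auto

lemma proj_pt_in_zero_locus:
  assumes "x \<in> hom_coords r" "\<forall>f\<in>S. \<exists>d. form r d f"
  shows "proj_pt x \<in> zero_locus r S \<longleftrightarrow> (\<forall>f\<in>S. f x = 0)"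
  using assms form_zero_proj_pt proj_pt_self unfolding zero_locus_def proj_space_def by blast

lemma proj_pt_in_closure:
  assumes "x \<in> hom_coords r" "x \<in> C"
  shows "proj_pt x \<in> proj_closure r C"
  unfolding proj_closure_def
  by (subst proj_pt_in_zero_locus) (use assms in \<open>auto simp: forms_vanish_def\<close>)

lemma vanish_proj_closure:
  assumes "form r d f" "\<forall>x\<in>C. f x = 0" "x \<in> \<Union>(proj_closure r C)"
  shows "f x = 0"
  using assms unfolding proj_closure_def zero_locus_def forms_vanish_def by blast

text \<open>The zero vector may belong to \<open>C\<close> but yields no point of the closure. A
  nonzero vector of \<open>C\<close> at which \<open>f\<close> vanishes forces \<open>f\<close> to
  vanish at the origin too.\<close>

lemma vanish_proj_closure_iff:
  assumes f: "form r d f" and supp: "\<forall>x\<in>C. \<forall>i>r. x i = 0"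
    and ne: "\<exists>x\<in>C. x \<in> hom_coords r"
  shows "(\<forall>x\<in>\<Union>(proj_closure r C). f x = 0) \<longleftrightarrow> (\<forall>x\<in>C. f x = 0)"
proof
  assume *: "\<forall>x\<in>\<Union>(proj_closure r C). f x = 0"
  have nz: "f x = 0" if "x \<in> C" "x \<in> hom_coords r" for x
    using * proj_pt_in_closure[OF that(2,1)] proj_pt_self by blast
  show "\<forall>x\<in>C. f x = 0"
  proof
    fix x assume x: "x \<in> C"
    show "f x = 0"
    proof (cases "x \<in> hom_coords r")
      case False
      then have "x i = 0" for i using supp x unfolding hom_coords_def by (cases "i > r") auto
      then have "x = (\<lambda>_. 0)" by blast
      then show ?thesis using ne nz form_zero_at_0[OF f] by blast
    qed (use nz x in blast)
  qed
qed (use vanish_proj_closure[OF f] in blast)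

lemma closed_eq_proj_closure:
  assumes "closedin (zariski r) Z"
  shows "proj_closure r (\<Union>Z) = Z"
proof
  obtain S where S: "\<forall>f\<in>S. \<exists>d. form r d f" "Z = zero_locus r S"
    using assms unfolding closedin_zariski by blast
  have "S \<subseteq> forms_vanish r (\<Union>Z)" using S unfolding forms_vanish_def zero_locus_def by auto
  then show "proj_closure r (\<Union>Z) \<subseteq> Z" unfolding proj_closure_def S(2) zero_locus_def by blast
  show "Z \<subseteq> proj_closure r (\<Union>Z)"
    unfolding proj_closure_def using S(2) unfolding zero_locus_def forms_vanish_def by blast
qed

text \<open>The hypothesis speaks of vanishing forms instead of inclusion, so that the lemma also
  covers density arguments.\<close>

lemma proj_closure_mono:
  assumes "\<And>f d. form r d f \<Longrightarrow> \<forall>x\<in>D. f x = 0 \<Longrightarrow> \<forall>x\<in>C. f x = 0"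
  shows "proj_closure r C \<subseteq> proj_closure r D"
proof -
  have "forms_vanish r D \<subseteq> forms_vanish r C" using assms unfolding forms_vanish_def by blast
  then show ?thesis unfolding proj_closure_def zero_locus_def by blast
qed

lemma zariski_closure_of:
  assumes "S \<subseteq> proj_space r"
  shows "zariski r closure_of S = proj_closure r (\<Union>S)"
proof
  have "S \<subseteq> proj_closure r (\<Union>S)"
    using assms unfolding proj_closure_def zero_locus_def forms_vanish_def by blast
  then show "zariski r closure_of S \<subseteq> proj_closure r (\<Union>S)"
    by (intro closure_of_minimal closedin_proj_closure)
  let ?Z = "zariski r closure_of S"
  have "S \<subseteq> ?Z" using assms by (intro closure_of_subset) (simp add: topspace_zariski)
  then have "proj_closure r (\<Union>S) \<subseteq> proj_closure r (\<Union>?Z)" by (intro proj_closure_mono) blast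
  then show "proj_closure r (\<Union>S) \<subseteq> ?Z" by (simp add: closed_eq_proj_closure)
qed

section \<open>Irreducibility and products of forms\<close>

lemma irreducible_formsD:
  assumes "irreducible_in (zariski r) Z" "form r d f" "form r e g"
    and "\<And>x. x \<in> \<Union>Z \<Longrightarrow> f x * g x = 0"
  shows "(\<forall>x\<in>\<Union>Z. f x = 0) \<or> (\<forall>x\<in>\<Union>Z. g x = 0)"
proof -
  have Z: "Z \<subseteq> proj_space r" using assms(1) unfolding irreducible_in_def topspace_zariski by blast
  have cl: "closedin (zariski r) (zero_locus r {f})" "closedin (zariski r) (zero_locus r {g})"
    unfolding closedin_zariski using assms(2,3) by (intro exI[of _ "{f}"] exI[of _ "{g}"], auto)+
  have "Z \<subseteq> zero_locus r {f} \<union> zero_locus r {g}"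
  proof
    fix p assume p: "p \<in> Z"
    then obtain x where x: "p = proj_pt x" "x \<in> hom_coords r" using Z unfolding proj_space_def by blast
    have "x \<in> \<Union>Z" using p x proj_pt_self by blast
    then have "f x = 0 \<or> g x = 0" using assms(4) by auto
    then show "p \<in> zero_locus r {f} \<union> zero_locus r {g}"
      using x assms(2,3) proj_pt_in_zero_locus[of x r "{f}"] proj_pt_in_zero_locus[of x r "{g}"] by blast
  qed
  then have "Z \<subseteq> zero_locus r {f} \<or> Z \<subseteq> zero_locus r {g}"
    using assms(1) cl unfolding irreducible_in_def by blast
  then show ?thesis unfolding zero_locus_def by blast
qed

text \<open>Entire functions form a domain: \<open>g\<close> vanishes on the nonempty open set where
  \<open>f\<close> does not, hence everywhere by the identity theorem. All later cancellations of a
  power of the deformation parameter rest on this.\<close>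

lemma entire_product_zero:
  assumes "f holomorphic_on UNIV" "g holomorphic_on UNIV" "\<And>z. f z * g z = 0" "f a \<noteq> 0"
  shows "g b = (0::complex)"
proof -
  have "continuous_on UNIV f" using assms(1) by (rule holomorphic_on_imp_continuous_on)
  then have "open (f -` (- {0}))" by (intro open_vimage) auto
  then show ?thesis
  proof (rule analytic_continuation_open[where f = g and g = "\<lambda>_. 0" and s' = UNIV])
    show "f -` (- {0}) \<noteq> {}" using assms(4) by auto
    show "g z = 0" if "z \<in> f -` (- {0})" for z
    proof -
      have "f z \<noteq> 0" using that by simp
      then show ?thesis using assms(3)[of z] by simp
    qed
  qed (simp_all add: assms(2) convex_connected)
qed

text \<open>If the closure were covered by two closed sets without lying in one of them, there would
  be forms \<open>f\<close> and \<open>g\<close> with \<open>f * g\<close> zero on \<open>C\<close>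
  and points of \<open>C\<close> where \<open>f\<close>, respectively \<open>g\<close>, is nonzero.
  Along an entire curve through both points this contradicts
  \<open>entire_product_zero\<close>.\<close>

lemma irreducible_proj_closure:
  assumes supp: "\<forall>x\<in>C. \<forall>i>r. x i = 0"
    and ne: "\<exists>x\<in>C. x \<in> hom_coords r"
    and curve: "\<And>x y. x \<in> C \<Longrightarrow> y \<in> C \<Longrightarrow>
        \<exists>\<gamma> a b. (\<forall>i\<le>r. (\<lambda>s. \<gamma> s i) holomorphic_on UNIV) \<and> (\<forall>s. \<gamma> s \<in> C) \<and> \<gamma> a = x \<and> \<gamma> b = y"
  shows "irreducible_in (zariski r) (proj_closure r C)"
proof -
  have sub: "C' \<subseteq> zero_locus r S" if "\<And>x. x \<in> \<Union>C' \<Longrightarrow> \<forall>f\<in>S. f x = 0" "C' \<subseteq> proj_space r" for C' S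
    using that unfolding zero_locus_def by blast
  have ps: "proj_closure r C \<subseteq> proj_space r" unfolding proj_closure_def zero_locus_def by blast
  obtain x0 where x0: "x0 \<in> C" "x0 \<in> hom_coords r" using ne by (rule bexE)
  have nonempty: "proj_closure r C \<noteq> {}" using proj_pt_in_closure[OF x0(2,1)] by (metis equals0D)
  have witness: "\<exists>f d x. f \<in> S \<and> form r d f \<and> x \<in> C \<and> f x \<noteq> 0"
    if neg: "\<not> proj_closure r C \<subseteq> zero_locus r S" and S: "\<forall>f\<in>S. \<exists>d. form r d f" for S
  proof -
    obtain f where f: "f \<in> S" "\<not> (\<forall>x\<in>\<Union>(proj_closure r C). f x = 0)"
      using neg sub[OF _ ps, of S] by (metis (no_types))
    obtain d where d: "form r d f" using S f(1) by blast
    have "\<not> (\<forall>x\<in>C. f x = 0)" using vanish_proj_closure_iff[OF d supp ne] f(2) by simp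
    then show ?thesis using f(1) d by blast
  qed
  have "proj_closure r C \<subseteq> A \<or> proj_closure r C \<subseteq> B"
    if A: "closedin (zariski r) A" and B: "closedin (zariski r) B"
      and AB: "proj_closure r C \<subseteq> A \<union> B" for A B
  proof (rule ccontr)
    assume neg: "\<not> (proj_closure r C \<subseteq> A \<or> proj_closure r C \<subseteq> B)"
    obtain S where S: "\<forall>f\<in>S. \<exists>d. form r d f" "A = zero_locus r S"
      using A unfolding closedin_zariski by (elim exE conjE)
    obtain T where T: "\<forall>f\<in>T. \<exists>d. form r d f" "B = zero_locus r T"
      using B unfolding closedin_zariski by (elim exE conjE)
    obtain f d x where f: "f \<in> S" "form r d f" "x \<in> C" "f x \<noteq> 0"
      using witness[OF _ S(1)] neg S(2) by (metis (no_types))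
    obtain g e y where g: "g \<in> T" "form r e g" "y \<in> C" "g y \<noteq> 0"
      using witness[OF _ T(1)] neg T(2) by (metis (no_types))
    have "f x * g x = 0" if "x \<in> \<Union>(proj_closure r C)" for x
    proof -
      from that obtain p where "p \<in> proj_closure r C" "x \<in> p" by (rule UnionE)
      then have "p \<in> A \<or> p \<in> B" "x \<in> p" using AB by auto
      then show ?thesis using zero_locusD[of p r S f x] zero_locusD[of p r T g x] f(1) g(1) S(2) T(2) by auto
    qed
    then have fg: "\<forall>x\<in>C. f x * g x = 0"
      using vanish_proj_closure_iff[OF form_mult[OF f(2) g(2)] supp ne] by simp
    obtain \<gamma> a b where \<gamma>: "\<forall>i\<le>r. (\<lambda>s. \<gamma> s i) holomorphic_on UNIV" "\<forall>s. \<gamma> s \<in> C" "\<gamma> a = x" "\<gamma> b = y"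
      using curve[OF f(3) g(3)] by (elim exE conjE)
    have "(\<lambda>s. f (\<gamma> s)) holomorphic_on UNIV" "(\<lambda>s. g (\<gamma> s)) holomorphic_on UNIV"
      using form_holomorphic[OF f(2), of \<gamma>] form_holomorphic[OF g(2), of \<gamma>] \<gamma>(1) by simp_all
    moreover have "f (\<gamma> s) * g (\<gamma> s) = 0" for s using fg \<gamma>(2) by simp
    moreover have "f (\<gamma> a) \<noteq> 0" using f(4) \<gamma>(3) by simp
    ultimately have "g (\<gamma> b) = 0" by (rule entire_product_zero)
    then show False using \<gamma>(4) g(4) by simp
  qed
  then show ?thesis unfolding irreducible_in_def topspace_zariski using ps nonempty by simp
qed

subsection \<open>Hilbert functions and Krull dimension\<close>

text \<open>The largest size of an independent family is the value at \<open>d\<close> of the Hilbert function of \<open>C\<close>.\<close>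

definition indep_forms ::
    "nat \<Rightarrow> nat \<Rightarrow> (nat \<Rightarrow> complex) set \<Rightarrow> 'i set \<Rightarrow> ('i \<Rightarrow> (nat \<Rightarrow> complex) \<Rightarrow> complex) \<Rightarrow> bool" where
  "indep_forms r d C I g \<longleftrightarrow> (\<forall>i\<in>I. form r d (g i)) \<and>
     (\<forall>c. (\<forall>x\<in>C. (\<Sum>i\<in>I. c i * g i x) = 0) \<longrightarrow> (\<forall>i\<in>I. c i = 0))"

definition hilbert_bound :: "nat \<Rightarrow> (nat \<Rightarrow> complex) set \<Rightarrow> nat \<Rightarrow> bool" where
  "hilbert_bound r C q \<longleftrightarrow>
     (\<exists>K. \<forall>d\<ge>1. \<forall>(I :: nat set) g. finite I \<longrightarrow> indep_forms r d C I g \<longrightarrow> card I \<le> K * d ^ q)"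

lemma indep_forms_reindex:
  assumes "bij_betw h J I" "indep_forms r d C I g"
  shows "indep_forms r d C J (\<lambda>j. g (h j))"
proof -
  have hI: "h j \<in> I" if "j \<in> J" for j using assms(1) that by (auto simp: bij_betw_def)
  have "\<forall>j\<in>J. c j = 0" if "\<forall>x\<in>C. (\<Sum>j\<in>J. c j * g (h j) x) = 0" for c
  proof -
    have inv: "inv_into J h (h j) = j" if "j \<in> J" for j
      using assms(1) that by (simp add: bij_betw_def)
    have "(\<Sum>j\<in>J. c j * g (h j) x) = (\<Sum>i\<in>I. c (inv_into J h i) * g i x)" for x
    proof -
      have "(\<Sum>j\<in>J. c j * g (h j) x) = (\<Sum>j\<in>J. c (inv_into J h (h j)) * g (h j) x)"
        by (intro sum.cong) (auto simp: inv)
      also have "\<dots> = (\<Sum>i\<in>I. c (inv_into J h i) * g i x)"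
        by (rule sum.reindex_bij_betw[OF assms(1)])
      finally show ?thesis .
    qed
    then have "\<forall>x\<in>C. (\<Sum>i\<in>I. c (inv_into J h i) * g i x) = 0" using that by simp
    then have "\<forall>i\<in>I. c (inv_into J h i) = 0"
      using assms(2) unfolding indep_forms_def
      by (elim conjE) (erule allE[of _ "\<lambda>i. c (inv_into J h i)"], simp)
    then show ?thesis using hI inv by metis
  qed
  then show ?thesis using assms(2) hI unfolding indep_forms_def by blast
qed

text \<open>The definition of the bound fixes the index type \<open>nat\<close>; renumbering a
  finite index set transfers it to any type, in particular to the pairs used in
  \<open>indep_forms_extend\<close>.\<close>

lemma hilbert_boundD:
  assumes "hilbert_bound r C q"
  obtains K where "\<And>d I g. d \<ge> 1 \<Longrightarrow> finite (I :: 'i set) \<Longrightarrow> indep_forms r d C I g \<Longrightarrow> card I \<le> K * d ^ q"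
proof -
  obtain K where K: "\<forall>d\<ge>1. \<forall>(I :: nat set) g. finite I \<longrightarrow> indep_forms r d C I g \<longrightarrow> card I \<le> K * d ^ q"
    using assms unfolding hilbert_bound_def by blast
  have *: "card I \<le> K * d ^ q"
    if d: "d \<ge> 1" and fin: "finite I" and ind: "indep_forms r d C I g" for d g and I :: "'i set"
  proof -
    obtain h where h: "bij_betw h {0..<card I} I" using ex_bij_betw_nat_finite[OF fin] by blast
    have "card {0..<card I} \<le> K * d ^ q"
      using K d indep_forms_reindex[OF h ind] by (metis (no_types) finite_atLeastLessThan)
    then show ?thesis by simp
  qed
  show ?thesis by (rule that[OF *])
qed

lemma hilbert_bound_mono:
  assumes "hilbert_bound r C q" "D \<subseteq> C"
  shows "hilbert_bound r D q"
proof -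
  have "indep_forms r d C I g" if "indep_forms r d D I g" for d g and I :: "nat set"
    using that assms(2) unfolding indep_forms_def by blast
  then show ?thesis using assms(1) unfolding hilbert_bound_def by meson
qed

lemma irreducible_linear_form:
  assumes "irreducible_in (zariski r) Z"
  obtains i x where "i \<le> r" "x \<in> \<Union>Z" "x i \<noteq> 0"
proof -
  have "Z \<noteq> {}" "Z \<subseteq> proj_space r"
    using assms unfolding irreducible_in_def topspace_zariski by auto
  then obtain p where p: "p \<in> Z" "p \<in> proj_space r" by blast
  then obtain x where x: "p = proj_pt x" "x \<in> hom_coords r" unfolding proj_space_def by blast
  obtain i where i: "x i \<noteq> 0" using x(2) unfolding hom_coords_def by blast
  have "\<forall>i>r. x i = 0" using x(2) unfolding hom_coords_def by blast
  then have "i \<le> r" using i not_le by blast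
  moreover have "x \<in> \<Union>Z" using p(1) x(1) proj_pt_self[of x] by (intro UnionI[of p]) simp_all
  ultimately show ?thesis using that i by simp
qed

lemma irreducible_cancel_power:
  assumes Z: "irreducible_in (zariski r) Z" and l: "form r e l" and nz: "\<exists>x\<in>\<Union>Z. l x \<noteq> 0"
    and h: "form r d h" and zero: "\<And>x. x \<in> \<Union>Z \<Longrightarrow> l x ^ k * h x = 0"
  shows "\<forall>x\<in>\<Union>Z. h x = 0"
proof (cases k)
  case 0
  then show ?thesis using zero by simp
next
  case (Suc k')
  from irreducible_formsD[OF Z form_power[OF l, of k] h zero] Suc nz show ?thesis by auto
qed

text \<open>The \<open>d + 1\<close> blocks indexed by the power of \<open>F\<close> are why the growth exponent of the Hilbert function
  drops on a proper closed subset.\<close>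

lemma indep_forms_extend:
  assumes Z: "irreducible_in (zariski r) Z" and Y: "irreducible_in (zariski r) Y" and "Y \<subseteq> Z"
    and F: "form r e F" "\<forall>x\<in>\<Union>Y. F x = 0" "\<exists>x\<in>\<Union>Z. F x \<noteq> 0"
    and l: "form r 1 l" "\<exists>x\<in>\<Union>Y. l x \<noteq> 0"
    and g: "indep_forms r d (\<Union>Y) I g" and "finite I"
  shows "indep_forms r (e * d + d) (\<Union>Z) ({..d} \<times> I)
           (\<lambda>p x. F x ^ fst p * (l x ^ (e * (d - fst p)) * g (snd p) x))"
proof -
  have form_g: "form r d (g i)" if "i \<in> I" for i using g that unfolding indep_forms_def by blast
  have form_lg: "form r (e * n + d) (\<lambda>x. l x ^ (e * n) * g i x)" if "i \<in> I" for i n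
    using form_mult[OF form_power[OF l(1), of "e * n"] form_g[OF that]] by simp
  \<comment> \<open>The powers of \<open>l\<close> compensate for the missing powers of
    \<open>F\<close>, so that all blocks have the same degree.\<close>
  have forms: "form r (e * d + d) (\<lambda>x. F x ^ j * (l x ^ (e * (d - j)) * g i x))"
    if "j \<le> d" "i \<in> I" for j i
  proof -
    have "e * j + (e * (d - j) + d) = e * d + d"
      using that(1) by (simp flip: distrib_left add: add.assoc[symmetric])
    with form_mult[OF form_power[OF F(1), of j] form_lg[OF that(2), of "d - j"]] show ?thesis by metis
  qed
  have indep: "\<forall>p\<in>{..d} \<times> I. c p = 0"
    if c: "\<And>x. x \<in> \<Union>Z \<Longrightarrow> (\<Sum>p\<in>{..d} \<times> I. c p * (F x ^ fst p * (l x ^ (e * (d - fst p)) * g (snd p) x))) = 0"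
    for c
  proof -
    define G where "G j x = (\<Sum>i\<in>I. c (j, i) * (l x ^ (e * (d - j)) * g i x))" for j x
    have sum0: "(\<Sum>j\<le>d. F x ^ j * G j x) = 0" if "x \<in> \<Union>Z" for x
    proof -
      have "(\<Sum>j\<le>d. F x ^ j * G j x) =
          (\<Sum>j\<le>d. \<Sum>i\<in>I. c (j, i) * (F x ^ j * (l x ^ (e * (d - j)) * g i x)))"
        unfolding G_def sum_distrib_left by (intro sum.cong) (auto simp: algebra_simps)
      also have "\<dots> = 0"
        using c[OF that] by (simp add: sum.cartesian_product case_prod_beta)
      finally show ?thesis .
    qed
    \<comment> \<open>Strong induction on the power of \<open>F\<close>. The lower blocks are
      already zero, so \<open>F ^ j\<close> can be cancelled on \<open>Z\<close>; restricted to
      \<open>Y\<close>, where \<open>F\<close> vanishes, only block \<open>j\<close> survives, and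
      cancelling the power of \<open>l\<close> leaves a relation among the
      \<open>g i\<close>.\<close>
    have "c (j, i) = 0" if "j \<le> d" "i \<in> I" for j i
      using that
    proof (induction j arbitrary: i rule: less_induct)
      case (less j)
      have G0: "G k x = 0" if "k < j" for k x
        unfolding G_def using less.IH[OF that] that less.prems(1) by (intro sum.neutral) auto
      define H where "H x = (\<Sum>k=j..d. F x ^ (k - j) * G k x)" for x
      have "F x ^ j * H x = 0" if "x \<in> \<Union>Z" for x
      proof -
        have "0 = (\<Sum>k\<le>d. F x ^ k * G k x)" using sum0[OF that] by simp
        also have "\<dots> = (\<Sum>k=j..d. F x ^ k * G k x)"
          by (rule sum.mono_neutral_right) (auto simp: G0 not_le)
        also have "\<dots> = F x ^ j * H x"
          unfolding H_def sum_distrib_left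
          by (intro sum.cong) (auto simp: algebra_simps simp flip: power_add)
        finally show ?thesis by simp
      qed
      moreover have "form r (e * (d - j) + d) H"
        unfolding H_def
      proof (rule form_sum)
        fix k assume k: "k \<in> {j..d}"
        have "form r (e * (d - k) + d) (G k)"
          unfolding G_def by (intro form_sum form_cmult form_lg)
        then have "form r (e * (k - j) + (e * (d - k) + d)) (\<lambda>x. F x ^ (k - j) * G k x)"
          by (intro form_mult form_power F(1))
        moreover have "e * (k - j) + (e * (d - k) + d) = e * (d - j) + d"
          using k by (simp flip: distrib_left add: add.assoc[symmetric])
        ultimately show "form r (e * (d - j) + d) (\<lambda>x. F x ^ (k - j) * G k x)" by metis
      qed
      ultimately have H0: "\<forall>x\<in>\<Union>Z. H x = 0"
        using irreducible_cancel_power[OF Z F(1,3)] by blast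
      have "l x ^ (e * (d - j)) * (\<Sum>i\<in>I. c (j, i) * g i x) = 0" if x: "x \<in> \<Union>Y" for x
      proof -
        have "H x = (\<Sum>k\<in>{j}. F x ^ (k - j) * G k x)"
          unfolding H_def using less.prems(1) F(2) x by (intro sum.mono_neutral_right) auto
        also have "\<dots> = l x ^ (e * (d - j)) * (\<Sum>i\<in>I. c (j, i) * g i x)"
          by (simp add: G_def sum_distrib_left mult.left_commute)
        finally show ?thesis using H0 x \<open>Y \<subseteq> Z\<close> by (metis Union_mono in_mono)
      qed
      moreover have "form r d (\<lambda>x. \<Sum>i\<in>I. c (j, i) * g i x)"
        by (intro form_sum form_cmult form_g)
      ultimately have "\<forall>x\<in>\<Union>Y. (\<Sum>i\<in>I. c (j, i) * g i x) = 0"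
        using irreducible_cancel_power[OF Y l] by blast
      then have "\<forall>i\<in>I. c (j, i) = 0"
        using g unfolding indep_forms_def by (elim conjE) (erule allE[of _ "\<lambda>i. c (j, i)"], simp)
      then show ?case using less.prems(2) by blast
    qed
    then show ?thesis by auto
  qed
  show ?thesis
    unfolding indep_forms_def
  proof (intro conjI allI impI)
    show "\<forall>p\<in>{..d} \<times> I. form r (e * d + d) (\<lambda>x. F x ^ fst p * (l x ^ (e * (d - fst p)) * g (snd p) x))"
      using forms by auto
    fix c :: "nat \<times> 'a \<Rightarrow> complex"
    assume "\<forall>x\<in>\<Union>Z. (\<Sum>p\<in>{..d} \<times> I. c p * (F x ^ fst p * (l x ^ (e * (d - fst p)) * g (snd p) x))) = 0"
    then show "\<forall>p\<in>{..d} \<times> I. c p = 0" by - (rule indep[of c], erule (1) bspec)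
  qed
qed

lemma proper_closed_form:
  assumes "closedin (zariski r) Y" "irreducible_in (zariski r) Y" "closedin (zariski r) Z" "Y \<subset> Z"
  obtains e F where "e \<ge> 1" "form r e F" "\<forall>x\<in>\<Union>Y. F x = 0" "\<exists>x\<in>\<Union>Z. F x \<noteq> 0"
proof -
  obtain S where S: "\<forall>f\<in>S. \<exists>d. form r d f" "Y = zero_locus r S"
    using assms(1) unfolding closedin_zariski by (elim exE conjE)
  have "Z \<subseteq> proj_space r" using closedin_subset[OF assms(3)] unfolding topspace_zariski .
  then have "\<exists>f\<in>S. \<exists>x\<in>\<Union>Z. f x \<noteq> 0" using assms(4) unfolding S(2) zero_locus_def by blast
  then obtain F e x where F: "F \<in> S" "form r e F" "x \<in> \<Union>Z" "F x \<noteq> 0" using S(1) by blast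
  have F0: "\<forall>x\<in>\<Union>Y. F x = 0" using F(1) S(2) zero_locusD by blast
  obtain i :: nat and y where y: "y \<in> \<Union>Y" by (rule irreducible_linear_form[OF assms(2)])
  have "e \<noteq> 0"
  proof
    assume "e = 0"
    then have "F (\<lambda>i. 0 * y i) = F y" "F (\<lambda>i. 0 * x i) = F x"
      using form_scale[OF F(2), of 0 y] form_scale[OF F(2), of 0 x] by simp_all
    then show False using bspec[OF F0 y] F(4) by simp
  qed
  then show ?thesis using that[of e F] F F0 by auto
qed

text \<open>Independent forms of degree \<open>d\<close> on \<open>Y\<close> yield
  \<open>d + 1\<close> times as many of degree \<open>(e + 1) * d\<close> on \<open>Z\<close>.
  Dividing the bound for \<open>Z\<close> by \<open>d\<close> lowers the exponent by one.\<close>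

lemma hilbert_bound_drop:
  assumes Z: "closedin (zariski r) Z" "irreducible_in (zariski r) Z"
    and Y: "closedin (zariski r) Y" "irreducible_in (zariski r) Y" and "Y \<subset> Z"
    and bound: "hilbert_bound r (\<Union>Z) q"
  obtains q' where "q = Suc q'" "hilbert_bound r (\<Union>Y) q'"
proof -
  obtain e F where F: "e \<ge> 1" "form r e F" "\<forall>x\<in>\<Union>Y. F x = 0" "\<exists>x\<in>\<Union>Z. F x \<noteq> 0"
    by (rule proper_closed_form[OF Y Z(1) \<open>Y \<subset> Z\<close>])
  obtain i0 x0 where i0: "i0 \<le> r" "x0 \<in> \<Union>Y" "x0 i0 \<noteq> 0"
    by (rule irreducible_linear_form[OF Y(2)])
  define l where "l = (\<lambda>x :: nat \<Rightarrow> complex. x i0)"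
  have l: "form r 1 l" "\<exists>x\<in>\<Union>Y. l x \<noteq> 0" using form_coord[OF i0(1)] i0 by (auto simp: l_def)
  obtain K where K: "\<And>d I g. d \<ge> 1 \<Longrightarrow> finite (I :: (nat \<times> nat) set) \<Longrightarrow>
      indep_forms r d (\<Union>Z) I g \<Longrightarrow> card I \<le> K * d ^ q"
    by (rule hilbert_boundD[OF bound, where 'i = "nat \<times> nat"]) blast
  have ineq: "(d + 1) * card I \<le> K * (e * d + d) ^ q"
    if "d \<ge> 1" "finite I" "indep_forms r d (\<Union>Y) I g" for d g and I :: "nat set"
  proof -
    have "card ({..d} \<times> I) \<le> K * (e * d + d) ^ q"
      by (rule K[OF _ _ indep_forms_extend[OF Z(2) Y(2) _ F(2,3,4) l that(3,2)]])
        (use that \<open>Y \<subset> Z\<close> in auto)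
    then show ?thesis by (simp add: card_cartesian_product)
  qed
  show ?thesis
  proof (cases q)
    \<comment> \<open>The single form \<open>l ^ d\<close> is independent on \<open>Y\<close>, so
      exponent 0 would give \<open>d + 1 \<le> K\<close> for every \<open>d \<ge> 1\<close>;
      \<open>d = K + 1\<close> refutes this.\<close>
    case 0
    have "indep_forms r d (\<Union>Y) {0 :: nat} (\<lambda>_ x. l x ^ d)" for d
      using form_power[OF l(1), of d] i0 unfolding indep_forms_def l_def by auto
    from ineq[OF _ _ this, of "K + 1"] 0 show ?thesis by auto
  next
    case (Suc q')
    have "card I \<le> (K * (e + 1) ^ q) * d ^ q'"
      if "d \<ge> 1" "finite I" "indep_forms r d (\<Union>Y) I g" for d g and I :: "nat set"
    proof -
      have "d * card I \<le> (d + 1) * card I" by simp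
      also have "\<dots> \<le> K * (e * d + d) ^ q" using ineq[OF that] .
      also have "e * d + d = (e + 1) * d" by simp
      also have "K * ((e + 1) * d) ^ q = d * ((K * (e + 1) ^ q) * d ^ q')"
        unfolding power_mult_distrib Suc by (simp add: algebra_simps)
      finally show ?thesis using that(1) by simp
    qed
    then show ?thesis using that[OF Suc] unfolding hilbert_bound_def by blast
  qed
qed

text \<open>Each step down the chain costs one unit of the growth exponent, and with exponent 0 no
  further step is possible.\<close>

lemma chain_length_le:
  assumes "\<And>i. i \<le> m \<Longrightarrow> closedin (zariski r) (Z i) \<and> irreducible_in (zariski r) (Z i)"
    and "\<And>i. i < m \<Longrightarrow> Z i \<subset> Z (Suc i)" and "hilbert_bound r (\<Union>(Z m)) q"
  shows "m \<le> q"
  using assms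
proof (induction m arbitrary: q)
  case 0
  then show ?case by simp
next
  case (Suc m)
  obtain q' where q': "q = Suc q'" "hilbert_bound r (\<Union>(Z m)) q'"
    by (rule hilbert_bound_drop[of r "Z (Suc m)" "Z m" q]) (use Suc.prems in auto)
  have "m \<le> q'" by (rule Suc.IH[OF _ _ q'(2)]) (use Suc.prems in auto)
  then show ?case using q'(1) by simp
qed

lemma irreducible_in_subtopology:
  assumes "closedin X Y" "Z \<subseteq> Y"
  shows "irreducible_in (subtopology X Y) Z \<longleftrightarrow> irreducible_in X Z"
proof
  assume *: "irreducible_in (subtopology X Y) Z"
  have "Z \<subseteq> A \<or> Z \<subseteq> B" if "closedin X A" "closedin X B" "Z \<subseteq> A \<union> B" for A B
  proof -
    have "closedin (subtopology X Y) (A \<inter> Y)" "closedin (subtopology X Y) (B \<inter> Y)"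
      using that unfolding closedin_subtopology by auto
    moreover have "Z \<subseteq> (A \<inter> Y) \<union> (B \<inter> Y)" using that assms(2) by auto
    ultimately have "Z \<subseteq> A \<inter> Y \<or> Z \<subseteq> B \<inter> Y" using * unfolding irreducible_in_def by blast
    then show ?thesis by blast
  qed
  then show "irreducible_in X Z" using * unfolding irreducible_in_def topspace_subtopology by simp
next
  assume *: "irreducible_in X Z"
  have "Z \<subseteq> A \<or> Z \<subseteq> B"
    if "closedin (subtopology X Y) A" "closedin (subtopology X Y) B" "Z \<subseteq> A \<union> B" for A B
    using * that closedin_closed_subtopology[OF assms(1)] unfolding irreducible_in_def by blast
  then show "irreducible_in (subtopology X Y) Z"
    using * assms(2) unfolding irreducible_in_def topspace_subtopology by simp
qed

lemma krull_dim_eq: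
  assumes Y: "closedin (zariski r) Y" and bound: "hilbert_bound r (\<Union>Y) D"
    and chain: "\<And>i. i \<le> D \<Longrightarrow> closedin (zariski r) (Z i) \<and> irreducible_in (zariski r) (Z i) \<and> Z i \<subseteq> Y"
      "\<And>i. i < D \<Longrightarrow> Z i \<subset> Z (Suc i)"
  shows "krull_dim (subtopology (zariski r) Y) = enat D"
proof -
  let ?X = "subtopology (zariski r) Y"
  have cl: "closedin ?X W \<longleftrightarrow> closedin (zariski r) W \<and> W \<subseteq> Y" for W
    by (rule closedin_closed_subtopology[OF Y])
  have "closedin ?X (Z i) \<and> irreducible_in ?X (Z i)" if "i \<le> D" for i
    using chain(1)[OF that] irreducible_in_subtopology[OF Y, of "Z i"] cl[of "Z i"] by simp
  then have "enat D \<le> krull_dim ?X"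
    unfolding krull_dim_def using chain(2)
    by (intro Sup_upper CollectI exI[of _ D] conjI exI[of _ Z]) simp_all
  moreover have "krull_dim ?X \<le> enat D"
    unfolding krull_dim_def
  proof (rule Sup_least, elim CollectE exE conjE)
    fix x d and W :: "nat \<Rightarrow> (nat \<Rightarrow> complex) set set"
    assume x: "x = enat d" and W: "\<forall>i\<le>d. closedin ?X (W i) \<and> irreducible_in ?X (W i)" "\<forall>i<d. W i \<subset> W (Suc i)"
    have W': "closedin (zariski r) (W i) \<and> irreducible_in (zariski r) (W i) \<and> W i \<subseteq> Y" if "i \<le> d" for i
      using W(1) that cl[of "W i"] irreducible_in_subtopology[OF Y, of "W i"] by simp
    have "\<Union>(W d) \<subseteq> \<Union>Y" using W'[of d] by (intro Union_mono) simp
    then have "hilbert_bound r (\<Union>(W d)) D" by (rule hilbert_bound_mono[OF bound])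
    then have "d \<le> D" by (intro chain_length_le[of d r W D]) (use W' W(2) in simp_all)
    then show "x \<le> enat D" using x by simp
  qed
  ultimately show ?thesis by simp
qed

subsection \<open>Monomials and polynomials in a box\<close>

text \<open>Monomials are eigenvectors of the coordinate scalings, and distinct exponents are told
  apart by scaling one coordinate by 2. Testing at points without zero coordinates suffices, as
  these scalings preserve them.\<close>

lemma monomials_independent:
  fixes ex :: "'e \<Rightarrow> 'b \<Rightarrow> nat" and c :: "'e \<Rightarrow> complex"
  assumes "finite E" "finite B"
    and "\<And>e e'. e \<in> E \<Longrightarrow> e' \<in> E \<Longrightarrow> e \<noteq> e' \<Longrightarrow> \<exists>i\<in>B. ex e i \<noteq> ex e' i"
    and "\<And>y. (\<And>i. y i \<noteq> 0) \<Longrightarrow> (\<Sum>e\<in>E. c e * (\<Prod>i\<in>B. y i ^ ex e i)) = 0"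
  shows "\<forall>e\<in>E. c e = 0"
  using assms(1,3,4)
proof (induction E arbitrary: c rule: finite_induct)
  case empty
  then show ?case by simp
next
  case (insert e0 E)
  let ?m = "\<lambda>y e. \<Prod>i\<in>B. y i ^ ex e i"
  have sum0: "c e0 * ?m y e0 + (\<Sum>e\<in>E. c e * ?m y e) = 0" if "\<And>i. y i \<noteq> 0" for y
    using insert.prems(2)[of y] that insert.hyps by simp
  have zero: "c e = 0" if e: "e \<in> E" for e
  proof -
    from e insert.hyps(2) have "e \<noteq> e0" by auto
    with insert.prems(1)[of e e0] e obtain i where i: "i \<in> B" "ex e i \<noteq> ex e0 i" by auto
    \<comment> \<open>Scaling by \<open>z\<close> multiplies the monomial of \<open>e'\<close> by
      \<open>2 ^ ex e' i\<close>. Subtracting \<open>2 ^ ex e0 i\<close> times the original relation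
      removes \<open>e0\<close> and keeps a nonzero multiple of \<open>c e\<close>.\<close>
    define z :: "'b \<Rightarrow> complex" where "z = (\<lambda>_. 1)(i := 2)"
    have z: "?m z e' = 2 ^ ex e' i" for e'
    proof -
      have "?m z e' = (\<Prod>k\<in>B. if k = i then 2 ^ ex e' i else 1)"
        by (intro prod.cong) (auto simp: z_def)
      then show ?thesis using i(1) assms(2) by simp
    qed
    have "(\<Sum>e'\<in>E. (c e' * (2 ^ ex e' i - 2 ^ ex e0 i)) * ?m y e') = 0" if y: "\<And>i. y i \<noteq> 0" for y
    proof -
      have "?m (\<lambda>k. z k * y k) e' = 2 ^ ex e' i * ?m y e'" for e'
        by (simp add: power_mult_distrib prod.distrib z)
      moreover have "z k * y k \<noteq> 0" for k using y by (simp add: z_def)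
      ultimately have "c e0 * (2 ^ ex e0 i * ?m y e0) + (\<Sum>e'\<in>E. c e' * (2 ^ ex e' i * ?m y e')) = 0"
        using sum0[of "\<lambda>k. z k * y k"] by simp
      moreover have "c e0 * (2 ^ ex e0 i * ?m y e0) + (\<Sum>e'\<in>E. c e' * (2 ^ ex e0 i * ?m y e')) =
          2 ^ ex e0 i * (c e0 * ?m y e0 + (\<Sum>e\<in>E. c e * ?m y e))"
        unfolding distrib_left sum_distrib_left by (intro arg_cong2[of _ _ _ _ "(+)"] sum.cong) simp_all
      moreover have "c e0 * ?m y e0 + (\<Sum>e\<in>E. c e * ?m y e) = 0" by (rule sum0[OF y])
      moreover have "s1 - s2 = 0" if "a + s1 = 0" "a + s2 = k * z" "z = 0" for a s1 s2 k z :: complex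
      proof -
        have "s1 - s2 = (a + s1) - (a + s2)" by simp
        then show ?thesis using that by simp
      qed
      ultimately have "(\<Sum>e'\<in>E. c e' * (2 ^ ex e' i * ?m y e')) - (\<Sum>e'\<in>E. c e' * (2 ^ ex e0 i * ?m y e')) = 0"
        by blast
      then show ?thesis by (simp add: algebra_simps flip: sum_subtractf)
    qed
    from insert.IH[OF _ this] insert.prems(1) have "c e * (2 ^ ex e i - 2 ^ ex e0 i) = 0" using e by blast
    moreover have "(2 ^ ex e i :: complex) \<noteq> 2 ^ ex e0 i"
    proof
      assume "(2 ^ ex e i :: complex) = 2 ^ ex e0 i"
      then have "norm (2 ^ ex e i :: complex) = norm (2 ^ ex e0 i :: complex)" by simp
      then have "(2 ^ ex e i :: real) = 2 ^ ex e0 i" by (simp add: norm_power)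
      then show False using i(2) by simp
    qed
    ultimately show ?thesis by simp
  qed
  then have "c e0 = 0" using sum0[of "\<lambda>_. 1"] by simp
  with zero show ?case by auto
qed

text \<open>Bounding every exponent separately, instead of the total degree, makes the number of
  monomials exactly \<open>(D + 1) ^ card Q\<close> and lets the bounds add up under
  multiplication.\<close>

definition boxpoly :: "'q set \<Rightarrow> nat \<Rightarrow> (('q \<Rightarrow> complex) \<Rightarrow> complex) \<Rightarrow> bool" where
  "boxpoly Q D h \<longleftrightarrow> (\<exists>a. h = (\<lambda>p. \<Sum>e\<in>PiE Q (\<lambda>_. {..D}). a e * (\<Prod>q\<in>Q. p q ^ e q)))"

lemma boxpoly_zero: "boxpoly Q D (\<lambda>_. 0)"
  unfolding boxpoly_def by (rule exI[of _ "\<lambda>_. 0"]) simp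

lemma boxpoly_add: "boxpoly Q D f \<Longrightarrow> boxpoly Q D g \<Longrightarrow> boxpoly Q D (\<lambda>p. f p + g p)"
  unfolding boxpoly_def
  by (elim exE, rule_tac x = "\<lambda>e. a e + aa e" in exI) (simp add: sum.distrib distrib_right)

lemma boxpoly_cmult: "boxpoly Q D f \<Longrightarrow> boxpoly Q D (\<lambda>p. c * f p)"
  unfolding boxpoly_def
  by (elim exE, rule_tac x = "\<lambda>e. c * a e" in exI) (simp add: sum_distrib_left mult.assoc)

lemma boxpoly_sum: "(\<And>i. i \<in> I \<Longrightarrow> boxpoly Q D (f i)) \<Longrightarrow> boxpoly Q D (\<lambda>p. \<Sum>i\<in>I. f i p)"
  by (induction I rule: infinite_finite_induct) (auto intro: boxpoly_zero boxpoly_add)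

lemma boxpoly_monom:
  assumes "finite Q" "\<And>q. q \<in> Q \<Longrightarrow> e q \<le> D"
  shows "boxpoly Q D (\<lambda>p. \<Prod>q\<in>Q. p q ^ e q)"
proof -
  have e: "restrict e Q \<in> PiE Q (\<lambda>_. {..D})" using assms(2) by auto
  have fin: "finite (PiE Q (\<lambda>_. {..D}))" using assms(1) by (intro finite_PiE) auto
  have "(\<Sum>e'\<in>PiE Q (\<lambda>_. {..D}). (if e' = restrict e Q then 1 else 0) * (\<Prod>q\<in>Q. p q ^ e' q))
      = (\<Sum>e'\<in>PiE Q (\<lambda>_. {..D}). if e' = restrict e Q then (\<Prod>q\<in>Q. p q ^ e' q) else 0)"
    for p :: "'a \<Rightarrow> complex"
    by (intro sum.cong) auto
  also have "\<dots> p = (\<Prod>q\<in>Q. p q ^ e q)" for p :: "'a \<Rightarrow> complex"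
    using e by (simp add: sum.delta[OF fin])
  finally show ?thesis unfolding boxpoly_def
    by (intro exI[of _ "\<lambda>e'. if e' = restrict e Q then 1 else 0"] ext) simp
qed

lemma boxpoly_mult:
  assumes "finite Q" "boxpoly Q D f" "boxpoly Q D' g"
  shows "boxpoly Q (D + D') (\<lambda>p. f p * g p)"
proof -
  obtain a where f: "f = (\<lambda>p. \<Sum>e\<in>PiE Q (\<lambda>_. {..D}). a e * (\<Prod>q\<in>Q. p q ^ e q))"
    using assms(2) unfolding boxpoly_def by blast
  obtain b where g: "g = (\<lambda>p. \<Sum>e\<in>PiE Q (\<lambda>_. {..D'}). b e * (\<Prod>q\<in>Q. p q ^ e q))"
    using assms(3) unfolding boxpoly_def by blast
  have "f p * g p = (\<Sum>e\<in>PiE Q (\<lambda>_. {..D}). \<Sum>e'\<in>PiE Q (\<lambda>_. {..D'}).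
      (a e * b e') * (\<Prod>q\<in>Q. p q ^ (e q + e' q)))" for p
    unfolding f g sum_product by (intro sum.cong) (auto simp: power_add prod.distrib)
  moreover have "boxpoly Q (D + D') (\<lambda>p. \<Sum>e\<in>PiE Q (\<lambda>_. {..D}). \<Sum>e'\<in>PiE Q (\<lambda>_. {..D'}).
      (a e * b e') * (\<Prod>q\<in>Q. p q ^ (e q + e' q)))"
    by (intro boxpoly_sum boxpoly_cmult boxpoly_monom assms(1))
      (auto intro!: add_mono dest!: PiE_mem)
  ultimately show ?thesis by simp
qed

lemma boxpoly_mono:
  assumes "finite Q" "boxpoly Q D f" "D \<le> D'"
  shows "boxpoly Q D' f"
proof -
  obtain a where f: "f = (\<lambda>p. \<Sum>e\<in>PiE Q (\<lambda>_. {..D}). a e * (\<Prod>q\<in>Q. p q ^ e q))"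
    using assms(2) unfolding boxpoly_def by blast
  show ?thesis unfolding f
    by (intro boxpoly_sum boxpoly_cmult boxpoly_monom assms(1)) (use assms(3) in \<open>auto dest!: PiE_mem\<close>)
qed

lemma boxpoly_one: "finite Q \<Longrightarrow> boxpoly Q 0 (\<lambda>_. 1)"
  using boxpoly_monom[of Q "\<lambda>_. 0" 0] by simp

lemma boxpoly_var:
  assumes "finite Q" "q \<in> Q"
  shows "boxpoly Q 1 (\<lambda>p. p q)"
proof -
  have "(\<Prod>q'\<in>Q. p q' ^ (if q' = q then 1 else 0)) = p q" for p :: "'a \<Rightarrow> complex"
  proof -
    have "(\<Prod>q'\<in>Q. p q' ^ (if q' = q then 1 else 0)) = (\<Prod>q'\<in>Q. if q' = q then p q' else 1)"
      by (intro prod.cong) auto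
    then show ?thesis using assms by simp
  qed
  with boxpoly_monom[OF assms(1), of "\<lambda>q'. if q' = q then 1 else 0" 1] show ?thesis by simp
qed

lemma boxpoly_power:
  assumes "finite Q" "boxpoly Q D f"
  shows "boxpoly Q (D * k) (\<lambda>p. f p ^ k)"
proof (induction k)
  case 0
  then show ?case using boxpoly_one[OF assms(1)] by simp
next
  case (Suc k)
  from boxpoly_mult[OF assms Suc] show ?case by simp
qed

lemma boxpoly_prod:
  assumes "finite Q" "\<And>i. i \<in> I \<Longrightarrow> boxpoly Q (D i) (f i)"
  shows "boxpoly Q (\<Sum>i\<in>I. D i) (\<lambda>p. \<Prod>i\<in>I. f i p)"
  using assms(2)
proof (induction I rule: infinite_finite_induct)
  case (insert i I)
  then have "boxpoly Q (D i + sum D I) (\<lambda>p. f i p * (\<Prod>i\<in>I. f i p))"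
    by (intro boxpoly_mult[OF assms(1)]) auto
  then show ?case using insert by simp
qed (use boxpoly_one[OF assms(1)] in auto)

lemma form_boxpoly:
  assumes "finite Q" "form r d f" "\<And>i. i \<le> r \<Longrightarrow> boxpoly Q K (\<lambda>p. \<phi> p i)"
  shows "boxpoly Q (K * d) (\<lambda>p. f (\<phi> p))"
proof -
  obtain M a where M: "finite M" "\<forall>m\<in>M. (\<Sum>i\<le>r. m i) = d"
    and f: "f = (\<lambda>x. \<Sum>m\<in>M. a m * (\<Prod>i\<le>r. x i ^ m i))"
    using assms(2) unfolding form_def by blast
  show ?thesis unfolding f
  proof (intro boxpoly_sum boxpoly_cmult)
    fix m assume "m \<in> M"
    then have "K * d = (\<Sum>i\<le>r. K * m i)" using M(2) by (simp flip: sum_distrib_left)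
    moreover have "boxpoly Q (\<Sum>i\<le>r. K * m i) (\<lambda>p. \<Prod>i\<le>r. \<phi> p i ^ m i)"
      by (intro boxpoly_prod boxpoly_power assms) auto
    ultimately show "boxpoly Q (K * d) (\<lambda>p. \<Prod>i\<le>r. \<phi> p i ^ m i)" by simp
  qed
qed

text \<open>Pulled back to the parameters, forms of degree \<open>d\<close> lie in the span of
  \<open>(K * d + 1) ^ card Q\<close> monomials. The factor \<open>c\<close> is not counted as a
  parameter: by homogeneity it only multiplies each form by \<open>c ^ d\<close>.\<close>

lemma forms_dependent_on_parametrised:
  assumes Q: "finite Q" and \<phi>: "\<And>i. i \<le> r \<Longrightarrow> boxpoly Q K (\<lambda>p. \<phi> p i)"
    and C: "\<And>x. x \<in> C \<Longrightarrow> \<exists>c p. \<forall>i\<le>r. x i = c * \<phi> p i"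
    and I: "finite I" "\<And>i. i \<in> I \<Longrightarrow> form r d (g i)" "card I > (K * d + 1) ^ card Q"
  shows "\<exists>c. (\<exists>i\<in>I. c i \<noteq> 0) \<and> (\<forall>x\<in>C. (\<Sum>i\<in>I. c i * g i x) = 0)"
proof -
  let ?E = "PiE Q (\<lambda>_. {..K * d})"
  have "\<exists>a. \<forall>p. g i (\<phi> p) = (\<Sum>e\<in>?E. a e * (\<Prod>q\<in>Q. p q ^ e q))" if "i \<in> I" for i
  proof -
    have "boxpoly Q (K * d) (\<lambda>p. g i (\<phi> p))" by (rule form_boxpoly[OF Q I(2)[OF that] \<phi>])
    then obtain a where a: "(\<lambda>p. g i (\<phi> p)) = (\<lambda>p. \<Sum>e\<in>?E. a e * (\<Prod>q\<in>Q. p q ^ e q))"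
      unfolding boxpoly_def by (elim exE)
    show ?thesis by (intro exI[of _ a] allI) (rule fun_cong[OF a])
  qed
  then have "\<forall>i\<in>I. \<exists>a. \<forall>p. g i (\<phi> p) = (\<Sum>e\<in>?E. a e * (\<Prod>q\<in>Q. p q ^ e q))" by blast
  from bchoice[OF this] obtain a
    where a': "\<forall>i\<in>I. \<forall>p. g i (\<phi> p) = (\<Sum>e\<in>?E. a i e * (\<Prod>q\<in>Q. p q ^ e q))" ..
  have a: "g i (\<phi> p) = (\<Sum>e\<in>?E. a i e * (\<Prod>q\<in>Q. p q ^ e q))" if "i \<in> I" for i p
    using a' that by simp
  have "finite ?E" using Q by (intro finite_PiE) auto
  moreover have "card ?E = (K * d + 1) ^ card Q" using Q by (simp add: card_PiE)
  ultimately obtain c where c: "\<exists>i\<in>I. c i \<noteq> 0" "\<forall>e\<in>?E. (\<Sum>i\<in>I. c i * a i e) = 0"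
    using homogeneous_system_nontrivial[of ?E I a] I(1,3) by auto
  have "(\<Sum>i\<in>I. c i * g i x) = 0" if xC: "x \<in> C" for x
  proof -
    obtain l p where x: "\<forall>i\<le>r. x i = l * \<phi> p i" using C[OF xC] by (elim exE)
    have "g i x = l ^ d * g i (\<phi> p)" if "i \<in> I" for i
      using form_cong[OF I(2)[OF that], of x "\<lambda>i. l * \<phi> p i"] form_scale[OF I(2)[OF that], of l "\<phi> p"] x by simp
    then have "(\<Sum>i\<in>I. c i * g i x) = (\<Sum>i\<in>I. \<Sum>e\<in>?E. l ^ d * (\<Prod>q\<in>Q. p q ^ e q) * (c i * a i e))"
      by (intro sum.cong) (auto simp: a sum_distrib_left algebra_simps)
    also have "\<dots> = (\<Sum>e\<in>?E. l ^ d * (\<Prod>q\<in>Q. p q ^ e q) * (\<Sum>i\<in>I. c i * a i e))"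
      unfolding sum_distrib_left by (rule sum.swap)
    also have "\<dots> = 0" using c(2) by simp
    finally show ?thesis .
  qed
  then show ?thesis using c(1) by blast
qed

lemma hilbert_bound_parametrised:
  assumes Q: "finite Q" and \<phi>: "\<And>i. i \<le> r \<Longrightarrow> boxpoly Q K (\<lambda>p. \<phi> p i)"
    and C: "\<And>x. x \<in> C \<Longrightarrow> \<exists>c p. \<forall>i\<le>r. x i = c * \<phi> p i"
  shows "hilbert_bound r C (card Q)"
proof -
  have "card I \<le> (K + 1) ^ card Q * d ^ card Q"
    if "d \<ge> 1" "finite I" "indep_forms r d C I g" for d g and I :: "nat set"
  proof -
    have "card I \<le> (K * d + 1) ^ card Q"
    proof (rule ccontr)
      assume "\<not> ?thesis"
      then have "(K * d + 1) ^ card Q < card I" by simp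
      moreover have "form r d (g i)" if "i \<in> I" for i
        using \<open>indep_forms r d C I g\<close> that unfolding indep_forms_def by simp
      ultimately have "\<exists>c. (\<exists>i\<in>I. c i \<noteq> 0) \<and> (\<forall>x\<in>C. (\<Sum>i\<in>I. c i * g i x) = 0)"
        by (intro forms_dependent_on_parametrised[OF Q \<phi> C that(2)])
      then show False using that(3) unfolding indep_forms_def by blast
    qed
    also have "\<dots> \<le> ((K + 1) * d) ^ card Q" using that(1) by (intro power_mono) auto
    finally show ?thesis unfolding power_mult_distrib .
  qed
  then show ?thesis unfolding hilbert_bound_def by (intro exI[of _ "(K + 1) ^ card Q"]) simp
qed

lemma hilbert_bound_closure:
  assumes "hilbert_bound r C q"
  shows "hilbert_bound r (\<Union>(proj_closure r C)) q"
proof -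
  have "indep_forms r d C I g" if ind: "indep_forms r d (\<Union>(proj_closure r C)) I g" for d g and I :: "nat set"
  proof -
    have g: "form r d (g i)" if "i \<in> I" for i
      using ind that unfolding indep_forms_def by blast
    have "\<forall>i\<in>I. c i = 0" if "\<forall>x\<in>C. (\<Sum>i\<in>I. c i * g i x) = 0" for c
    proof -
      have "form r d (\<lambda>x. \<Sum>i\<in>I. c i * g i x)" by (intro form_sum form_cmult g)
      then have "\<forall>x\<in>\<Union>(proj_closure r C). (\<Sum>i\<in>I. c i * g i x) = 0"
        using vanish_proj_closure that by blast
      then show ?thesis
        using ind unfolding indep_forms_def
        by (elim conjE) (erule allE[of _ c], simp)
    qed
    then show ?thesis unfolding indep_forms_def using g by blast
  qed
  then show ?thesis using assms unfolding hilbert_bound_def by meson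
qed

text \<open>Nonemptiness of \<open>C\<close> makes \<open>f\<close> vanish at the origin; therefore
  the witness \<open>x\<close> is a nonzero vector and defines a point.\<close>

lemma proj_closure_strict:
  assumes "C \<subseteq> D" and f: "form r d f" "\<forall>x\<in>C. f x = 0" and "C \<noteq> {}"
    and x: "x \<in> D" "f x \<noteq> 0" and supp: "\<forall>x\<in>D. \<forall>i>r. x i = 0"
  shows "proj_closure r C \<subset> proj_closure r D"
proof -
  have "x \<in> hom_coords r"
  proof (rule ccontr)
    assume "x \<notin> hom_coords r"
    then have "x = (\<lambda>_. 0)" using supp x(1) unfolding hom_coords_def by auto
    moreover obtain y where "y \<in> C" using \<open>C \<noteq> {}\<close> by blast
    ultimately show False using form_zero_at_0[OF f(1), of y] f(2) x(2) by simp
  qed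
  then have "proj_pt x \<in> proj_closure r D" using x(1) by (rule proj_pt_in_closure)
  moreover have "proj_pt x \<notin> proj_closure r C"
    using vanish_proj_closure[OF f, of x] x(2) proj_pt_self by blast
  moreover have "proj_closure r C \<subseteq> proj_closure r D"
    using \<open>C \<subseteq> D\<close> by (intro proj_closure_mono) blast
  ultimately show ?thesis by blast
qed

subsection \<open>Projective space\<close>

definition coord_space :: "nat \<Rightarrow> (nat \<Rightarrow> complex) set" where
  "coord_space k = {x. \<forall>i>k. x i = 0}"

text \<open>To have \<open>r\<close> parameters and not \<open>r + 1\<close>, only the affine chart
  \<open>x 0 \<noteq> 0\<close> is parametrised. A form vanishing on this chart vanishes everywhere,
  so the bound carries over.\<close>

lemma hilbert_bound_coord_space: "hilbert_bound r (coord_space r) r"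
proof -
  define C where "C = {x \<in> coord_space r. x 0 \<noteq> 0}"
  have "hilbert_bound r C (card {1..r})"
  proof (rule hilbert_bound_parametrised[where K = 1 and \<phi> = "\<lambda>p i. if i = 0 then 1 else p i"])
    fix i assume "i \<le> r"
    then show "boxpoly {1..r} 1 (\<lambda>p. if i = 0 then 1 else p i)"
      using boxpoly_mono[OF _ boxpoly_one[of "{1..r}"], of 1] boxpoly_var[of "{1..r}" i]
      by (cases "i = 0") auto
  next
    fix x assume "x \<in> C"
    then show "\<exists>c p. \<forall>i\<le>r. x i = c * (if i = 0 then 1 else p i)"
      unfolding C_def by (intro exI[of _ "x 0"] exI[of _ "\<lambda>i. x i / x 0"]) auto
  qed simp
  then have bound: "hilbert_bound r C r" by simp
  have vanish: "f x = 0" if f: "form r d f" "\<forall>x\<in>C. f x = 0" and x: "x \<in> coord_space r" for f d x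
  proof -
    \<comment> \<open>The curve moves only coordinate 0 and leaves the chart just at
      \<open>s = - x 0\<close>; the factor \<open>x 0 + s\<close> absorbs that value.\<close>
    define \<gamma> where "\<gamma> s = x(0 := x 0 + s)" for s
    have zero: "(x 0 + s) * f (\<gamma> s) = 0" for s
    proof (cases "x 0 + s = 0")
      case False
      then have "\<gamma> s \<in> C" using x unfolding \<gamma>_def C_def coord_space_def by auto
      then show ?thesis using f(2) by simp
    qed simp
    have holo: "(\<lambda>s. f (\<gamma> s)) holomorphic_on UNIV"
    proof (rule form_holomorphic[OF f(1)])
      fix i show "(\<lambda>s. \<gamma> s i) holomorphic_on UNIV"
        unfolding \<gamma>_def by (cases "i = 0") (auto intro!: holomorphic_intros)
    qed
    have "f (\<gamma> 0) = 0"
      by (rule entire_product_zero[of "\<lambda>s. x 0 + s" _ "1 - x 0"])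
        (use zero holo in \<open>auto intro!: holomorphic_intros\<close>)
    then show ?thesis unfolding \<gamma>_def by simp
  qed
  have "indep_forms r d C I g" if ind: "indep_forms r d (coord_space r) I g" for d g and I :: "nat set"
  proof -
    have g: "form r d (g i)" if "i \<in> I" for i using ind that unfolding indep_forms_def by blast
    have "\<forall>i\<in>I. c i = 0" if "\<forall>x\<in>C. (\<Sum>i\<in>I. c i * g i x) = 0" for c
    proof -
      have "form r d (\<lambda>x. \<Sum>i\<in>I. c i * g i x)" by (intro form_sum form_cmult g)
      from vanish[OF this that] have "\<forall>x\<in>coord_space r. (\<Sum>i\<in>I. c i * g i x) = 0" by blast
      then show ?thesis
        using ind unfolding indep_forms_def by (elim conjE) (erule allE[of _ c], simp)
    qed
    then show ?thesis unfolding indep_forms_def using g by blast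
  qed
  then show ?thesis using bound unfolding hilbert_bound_def by meson
qed

lemma irreducible_coord_space:
  assumes "k \<le> r"
  shows "irreducible_in (zariski r) (proj_closure r (coord_space k))"
proof (rule irreducible_proj_closure)
  show "\<forall>x\<in>coord_space k. \<forall>i>r. x i = 0" using assms unfolding coord_space_def by auto
  have "(\<lambda>i. if i = 0 then 1 else 0) \<in> coord_space k \<inter> hom_coords r"
    unfolding coord_space_def hom_coords_def by auto
  then show "\<exists>x\<in>coord_space k. x \<in> hom_coords r" by blast
next
  fix x y assume xy: "x \<in> coord_space k" "y \<in> coord_space k"
  define \<gamma> where "\<gamma> s i = x i + s * (y i - x i)" for s i
  have "(\<lambda>s. \<gamma> s i) holomorphic_on UNIV" for i
    unfolding \<gamma>_def by (intro holomorphic_intros)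
  moreover have "\<gamma> s \<in> coord_space k" for s using xy unfolding \<gamma>_def coord_space_def by auto
  moreover have "\<gamma> 0 = x" "\<gamma> 1 = y" unfolding \<gamma>_def by auto
  ultimately show "\<exists>\<gamma> a b. (\<forall>i\<le>r. (\<lambda>s. \<gamma> s i) holomorphic_on UNIV) \<and> (\<forall>s. \<gamma> s \<in> coord_space k) \<and> \<gamma> a = x \<and> \<gamma> b = y"
    by blast
qed

text \<open>\<open>Y\<close> is kept abstract because it will be the closure of the secant family
  once that is known to fill the space.\<close>

lemma krull_dim_proj_space:
  assumes "proj_closure r (coord_space r) = Y"
  shows "krull_dim (subtopology (zariski r) Y) = enat r"
proof (rule krull_dim_eq[where Z = "\<lambda>k. proj_closure r (coord_space k)"])
  show "closedin (zariski r) Y" unfolding assms[symmetric] by (rule closedin_proj_closure)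
  show "hilbert_bound r (\<Union>Y) r"
    unfolding assms[symmetric] by (intro hilbert_bound_closure hilbert_bound_coord_space)
next
  fix k assume "k \<le> r"
  then show "closedin (zariski r) (proj_closure r (coord_space k)) \<and>
      irreducible_in (zariski r) (proj_closure r (coord_space k)) \<and> proj_closure r (coord_space k) \<subseteq> Y"
    unfolding assms[symmetric]
    by (intro conjI closedin_proj_closure irreducible_coord_space proj_closure_mono) (auto simp: coord_space_def)
next
  fix k assume k: "k < r"
  show "proj_closure r (coord_space k) \<subset> proj_closure r (coord_space (Suc k))"
  proof (rule proj_closure_strict[OF _ form_coord[of "Suc k" r]])
    show "(\<lambda>i. if i = Suc k then 1 else 0) \<in> coord_space (Suc k)" by (auto simp: coord_space_def)
    have "(\<lambda>_. 0) \<in> coord_space k" by (simp add: coord_space_def)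
    then show "coord_space k \<noteq> {}" by blast
  qed (use k in \<open>auto simp: coord_space_def\<close>)
qed

subsection \<open>Secants of a monomial parametrisation\<close>

definition mono_val :: "('n::finite \<Rightarrow> nat) \<Rightarrow> ('n \<Rightarrow> complex) \<Rightarrow> complex" where
  "mono_val e t = (\<Prod>j\<in>UNIV. t j ^ e j)"

definition subtorus :: "'n set \<Rightarrow> ('n \<Rightarrow> complex) set" where
  "subtorus J = {t. (\<forall>j. t j \<noteq> 0) \<and> (\<forall>j. j \<notin> J \<longrightarrow> t j = 1)}"

text \<open>Up to a common factor, the monomials indexed by \<open>A\<close> take arbitrary nonzero
  values on the subtorus. Affine independence of their exponents projected to \<open>J\<close>
  implies this.\<close>

definition torus_separating :: "(nat \<Rightarrow> 'n::finite \<Rightarrow> nat) \<Rightarrow> 'n set \<Rightarrow> nat set \<Rightarrow> bool" where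
  "torus_separating m J A \<longleftrightarrow> (\<forall>y :: nat \<Rightarrow> complex. (\<forall>i. y i \<noteq> 0) \<longrightarrow>
     (\<exists>b. \<exists>t\<in>subtorus J. \<forall>i\<in>A. b * mono_val (m i) t = y i))"

text \<open>A straight line could meet a coordinate hyperplane; interpolating logarithms stays in
  the torus and is entire.\<close>

lemma subtorus_curve:
  assumes "t \<in> subtorus J" "t' \<in> subtorus J"
  obtains \<gamma> where "\<And>j. (\<lambda>s. \<gamma> s j) holomorphic_on UNIV" "\<And>s. \<gamma> s \<in> subtorus J" "\<gamma> 0 = t" "\<gamma> 1 = t'"
proof -
  define \<gamma> where "\<gamma> s j = (if j \<in> J then exp (Ln (t j) + s * (Ln (t' j) - Ln (t j))) else 1)" for s j
  have "(\<lambda>s. \<gamma> s j) holomorphic_on UNIV" for j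
    unfolding \<gamma>_def by (cases "j \<in> J") (auto intro!: holomorphic_intros)
  moreover have "\<gamma> s \<in> subtorus J" for s unfolding \<gamma>_def subtorus_def by auto
  moreover have "\<gamma> 0 = t" "\<gamma> 1 = t'"
    using assms unfolding \<gamma>_def subtorus_def by auto
  ultimately show ?thesis using that by blast
qed

text \<open>In corner coordinates the vertex has exponent 0 and the first lattice points on its
  edges have the unit vectors as exponents; \<open>i0\<close> and \<open>\<epsilon>\<close> are
  their indices.\<close>

locale monomial_secant =
  fixes m :: "nat \<Rightarrow> 'n::finite \<Rightarrow> nat" and r i0 :: nat and \<epsilon> :: "'n \<Rightarrow> nat"
  assumes i0: "i0 \<le> r" "m i0 = (\<lambda>_. 0)"
    and \<epsilon>: "\<And>j. \<epsilon> j \<le> r" "\<And>j. m (\<epsilon> j) = (\<lambda>k. if k = j then 1 else 0)"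
begin

definition pt :: "complex \<Rightarrow> complex \<Rightarrow> ('n \<Rightarrow> complex) \<Rightarrow> ('n \<Rightarrow> complex) \<Rightarrow> nat \<Rightarrow> complex" where
  "pt a b t t' i = (if i \<le> r then a * mono_val (m i) t + b * mono_val (m i) t' else 0)"

text \<open>Freezing the second torus point outside \<open>J\<close> gives families that grow by one
  parameter at a time and provide the upper half of the chain. Allowing \<open>b = 0\<close> makes
  them contain the torus orbit itself.\<close>

definition Sec :: "'n set \<Rightarrow> (nat \<Rightarrow> complex) set" where
  "Sec J = {pt a b t t' | a b t t'. a \<noteq> 0 \<and> t \<in> subtorus UNIV \<and> t' \<in> subtorus J}"

definition Tor :: "'n set \<Rightarrow> (nat \<Rightarrow> complex) set" where
  "Tor J = {pt a 0 t t | a t. a \<noteq> 0 \<and> t \<in> subtorus J}"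

lemma mono_val_i0: "mono_val (m i0) t = 1"
  by (simp add: mono_val_def i0)

lemma mono_val_\<epsilon>: "mono_val (m (\<epsilon> j)) t = t j"
proof -
  have "mono_val (m (\<epsilon> j)) t = (\<Prod>k\<in>UNIV. if k = j then t k else 1)"
    unfolding mono_val_def \<epsilon> by (intro prod.cong) auto
  then show ?thesis by simp
qed

lemma \<epsilon>_neq_i0: "\<epsilon> j \<noteq> i0"
proof
  assume "\<epsilon> j = i0"
  with \<epsilon>(2)[of j] i0(2) have "(\<lambda>k. if k = j then 1 else 0 :: nat) = (\<lambda>_. 0)" by simp
  from fun_cong[OF this, of j] show False by simp
qed

lemma inj_\<epsilon>: "inj \<epsilon>"
proof (rule injI)
  fix j k assume "\<epsilon> j = \<epsilon> k"
  then have "(\<lambda>l. if l = j then 1 else 0 :: nat) = (\<lambda>l. if l = k then 1 else 0)"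
    using \<epsilon>(2)[of j] \<epsilon>(2)[of k] by simp
  from fun_cong[OF this, of j] show "j = k" by (simp split: if_splits)
qed

lemma Sec_supp: "\<forall>x\<in>Sec J. \<forall>i>r. x i = 0"
  unfolding Sec_def pt_def by auto

lemma Tor_supp: "\<forall>x\<in>Tor J. \<forall>i>r. x i = 0"
  unfolding Tor_def pt_def by auto

lemma one_in_subtorus: "(\<lambda>_. 1) \<in> subtorus J"
  unfolding subtorus_def by simp

lemma Tor_hom: "x \<in> Tor J \<Longrightarrow> x \<in> hom_coords r"
proof -
  assume "x \<in> Tor J"
  then obtain a t where x: "x = pt a 0 t t" "a \<noteq> 0" unfolding Tor_def by blast
  then have "x i0 \<noteq> 0" using i0 mono_val_i0 by (simp add: pt_def)
  moreover have "\<forall>i>r. x i = 0" unfolding x(1) by (simp add: pt_def)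
  ultimately show ?thesis unfolding hom_coords_def by blast
qed

lemma subtorus_mono: "J \<subseteq> J' \<Longrightarrow> subtorus J \<subseteq> subtorus J'"
  unfolding subtorus_def by auto

lemma pt_in_Tor: "a \<noteq> 0 \<Longrightarrow> t \<in> subtorus J \<Longrightarrow> pt a 0 t t \<in> Tor J"
  unfolding Tor_def by blast

lemma pt_in_Sec: "a \<noteq> 0 \<Longrightarrow> t \<in> subtorus UNIV \<Longrightarrow> t' \<in> subtorus J \<Longrightarrow> pt a b t t' \<in> Sec J"
  unfolding Sec_def by blast

lemma pt_b0: "pt a 0 t t' = pt a 0 t t''"
  by (rule ext) (simp add: pt_def)

lemma Tor_mono: "J \<subseteq> J' \<Longrightarrow> Tor J \<subseteq> Tor J'"
  unfolding Tor_def using subtorus_mono[of J J'] by blast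

lemma Sec_mono: "J \<subseteq> J' \<Longrightarrow> Sec J \<subseteq> Sec J'"
  unfolding Sec_def using subtorus_mono[of J J'] by blast

lemma Tor_subset_Sec: "Tor J' \<subseteq> Sec J"
proof
  fix x assume "x \<in> Tor J'"
  then obtain a t where x: "x = pt a 0 t t" "a \<noteq> 0" "t \<in> subtorus J'" unfolding Tor_def by blast
  have "pt a 0 t (\<lambda>_. 1) \<in> Sec J"
    using x(2,3) subtorus_mono[of J' UNIV] by (intro pt_in_Sec one_in_subtorus) auto
  then show "x \<in> Sec J" unfolding x(1) by (subst pt_b0[of _ _ _ "\<lambda>_. 1"])
qed

lemma Tor_nonempty: "Tor J \<noteq> {}"
  using pt_in_Tor[OF one_neq_zero one_in_subtorus] by blast

lemma Sec_nonempty: "Sec J \<noteq> {}"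
  using Tor_nonempty Tor_subset_Sec by blast

lemma pt_holomorphic:
  assumes "a holomorphic_on UNIV" "b holomorphic_on UNIV"
    and "\<And>j. (\<lambda>s. t s j) holomorphic_on UNIV" "\<And>j. (\<lambda>s. t' s j) holomorphic_on UNIV"
  shows "(\<lambda>s. pt (a s) (b s) (t s) (t' s) i) holomorphic_on UNIV"
  unfolding pt_def mono_val_def using assms by (cases "i \<le> r") (auto intro!: holomorphic_intros)

lemma irreducible_Sec: "irreducible_in (zariski r) (proj_closure r (Sec J))"
proof (rule irreducible_proj_closure[OF Sec_supp])
  show "\<exists>x\<in>Sec J. x \<in> hom_coords r"
    using Tor_nonempty[of J] Tor_subset_Sec[of J J] Tor_hom[of _ J] by blast
next
  fix x y assume "x \<in> Sec J" "y \<in> Sec J"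
  then obtain a b t t' c d z z' where
    x: "x = pt a b t t'" "a \<noteq> 0" "t \<in> subtorus UNIV" "t' \<in> subtorus J" and
    y: "y = pt c d z z'" "c \<noteq> 0" "z \<in> subtorus UNIV" "z' \<in> subtorus J" unfolding Sec_def by blast
  obtain T where T: "\<And>j. (\<lambda>s. T s j) holomorphic_on UNIV" "\<And>s. T s \<in> subtorus UNIV" "T 0 = t" "T 1 = z"
    by (rule subtorus_curve[OF x(3) y(3)]) blast
  obtain T' where T': "\<And>j. (\<lambda>s. T' s j) holomorphic_on UNIV" "\<And>s. T' s \<in> subtorus J" "T' 0 = t'" "T' 1 = z'"
    by (rule subtorus_curve[OF x(4) y(4)]) blast
  define A where "A s = exp (Ln a + s * (Ln c - Ln a))" for s
  define B where "B s = b + s * (d - b)" for s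
  define \<gamma> where "\<gamma> s = pt (A s) (B s) (T s) (T' s)" for s
  have "A holomorphic_on UNIV" "B holomorphic_on UNIV"
    unfolding A_def B_def by (intro holomorphic_intros)+
  then have "(\<lambda>s. \<gamma> s i) holomorphic_on UNIV" for i
    unfolding \<gamma>_def by (intro pt_holomorphic T(1) T'(1))
  moreover have "\<gamma> s \<in> Sec J" for s
    unfolding \<gamma>_def by (intro pt_in_Sec T(2) T'(2)) (simp add: A_def)
  moreover have "\<gamma> 0 = x" "\<gamma> 1 = y"
    unfolding \<gamma>_def A_def B_def T(3,4) T'(3,4) x(1) y(1) using x(2) y(2) by simp_all
  ultimately show "\<exists>\<gamma> a b. (\<forall>i\<le>r. (\<lambda>s. \<gamma> s i) holomorphic_on UNIV) \<and> (\<forall>s. \<gamma> s \<in> Sec J) \<and> \<gamma> a = x \<and> \<gamma> b = y"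
    by (intro exI[of _ \<gamma>] exI[of _ 0] exI[of _ 1]) simp
qed

lemma irreducible_Tor: "irreducible_in (zariski r) (proj_closure r (Tor J))"
proof (rule irreducible_proj_closure[OF Tor_supp])
  show "\<exists>x\<in>Tor J. x \<in> hom_coords r" using Tor_nonempty[of J] Tor_hom[of _ J] by blast
next
  fix x y assume "x \<in> Tor J" "y \<in> Tor J"
  then obtain a t c z where
    x: "x = pt a 0 t t" "a \<noteq> 0" "t \<in> subtorus J" and
    y: "y = pt c 0 z z" "c \<noteq> 0" "z \<in> subtorus J" unfolding Tor_def by blast
  obtain T where T: "\<And>j. (\<lambda>s. T s j) holomorphic_on UNIV" "\<And>s. T s \<in> subtorus J" "T 0 = t" "T 1 = z"
    by (rule subtorus_curve[OF x(3) y(3)]) blast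
  define A where "A s = exp (Ln a + s * (Ln c - Ln a))" for s
  define \<gamma> where "\<gamma> s = pt (A s) 0 (T s) (T s)" for s
  have "A holomorphic_on UNIV"
    unfolding A_def by (intro holomorphic_intros)
  then have "(\<lambda>s. \<gamma> s i) holomorphic_on UNIV" for i
    unfolding \<gamma>_def by (intro pt_holomorphic T(1) holomorphic_intros)
  moreover have "\<gamma> s \<in> Tor J" for s
    unfolding \<gamma>_def by (intro pt_in_Tor T(2)) (simp add: A_def)
  moreover have "\<gamma> 0 = x" "\<gamma> 1 = y"
    unfolding \<gamma>_def A_def T(3,4) x(1) y(1) using x(2) y(2) by simp_all
  ultimately show "\<exists>\<gamma> a b. (\<forall>i\<le>r. (\<lambda>s. \<gamma> s i) holomorphic_on UNIV) \<and> (\<forall>s. \<gamma> s \<in> Tor J) \<and> \<gamma> a = x \<and> \<gamma> b = y"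
    by (intro exI[of _ \<gamma>] exI[of _ 0] exI[of _ 1]) simp
qed

subsubsection \<open>Parameter count\<close>

text \<open>\<open>None\<close> stands for the ratio \<open>b / a\<close>, \<open>Inl\<close> for
  the coordinates of the first torus point and \<open>Inr\<close> for the free ones of the
  second.\<close>

definition sec_indices :: "'n set \<Rightarrow> ('n + 'n) option set" where
  "sec_indices J = insert None (Some ` (Inl ` UNIV \<union> Inr ` J))"

definition sec_param :: "'n set \<Rightarrow> (('n + 'n) option \<Rightarrow> complex) \<Rightarrow> nat \<Rightarrow> complex" where
  "sec_param J p i = (\<Prod>j\<in>UNIV. p (Some (Inl j)) ^ m i j) + p None * (\<Prod>j\<in>J. p (Some (Inr j)) ^ m i j)"

text \<open>A bound on all exponents that works for every coordinate; the extra 1 pays for the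
  factor \<open>p None\<close>.\<close>

definition exp_bound :: nat where
  "exp_bound = (\<Sum>i\<le>r. \<Sum>j\<in>UNIV. m i j) + 1"

lemma card_sec_indices: "card (sec_indices J) = CARD('n) + card J + 1"
proof -
  have "card (Some ` (Inl ` (UNIV :: 'n set) \<union> Inr ` J)) = card (Inl ` (UNIV :: 'n set) \<union> Inr ` J)"
    by (intro card_image) simp
  also have "\<dots> = card (Inl ` (UNIV :: 'n set) :: ('n + 'n) set) + card (Inr ` J :: ('n + 'n) set)"
    by (intro card_Un_disjoint) auto
  also have "\<dots> = CARD('n) + card J" by (simp add: card_image)
  finally show ?thesis unfolding sec_indices_def by (subst card_insert_disjoint) auto
qed

lemma sum_exp_le: "i \<le> r \<Longrightarrow> (\<Sum>j\<in>J. m i j) \<le> exp_bound - 1"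
proof -
  assume "i \<le> r"
  have "(\<Sum>j\<in>J. m i j) \<le> (\<Sum>j\<in>UNIV. m i j)" by (intro sum_mono2) auto
  also have "\<dots> \<le> (\<Sum>i\<le>r. \<Sum>j\<in>UNIV. m i j)" using \<open>i \<le> r\<close> by (intro member_le_sum) auto
  finally show ?thesis unfolding exp_bound_def by simp
qed

lemma boxpoly_sec_param:
  assumes "i \<le> r"
  shows "boxpoly (sec_indices J) exp_bound (\<lambda>p. sec_param J p i)"
proof -
  have fin: "finite (sec_indices J)" unfolding sec_indices_def by simp
  have "boxpoly (sec_indices J) (\<Sum>j\<in>UNIV. 1 * m i j) (\<lambda>p. \<Prod>j\<in>UNIV. p (Some (Inl j)) ^ m i j)"
    by (intro boxpoly_prod boxpoly_power boxpoly_var fin) (auto simp: sec_indices_def)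
  then have 1: "boxpoly (sec_indices J) exp_bound (\<lambda>p. \<Prod>j\<in>UNIV. p (Some (Inl j)) ^ m i j)"
    by (rule boxpoly_mono[OF fin]) (use sum_exp_le[OF assms, of UNIV] in \<open>simp add: exp_bound_def\<close>)
  have "boxpoly (sec_indices J) (1 + (\<Sum>j\<in>J. 1 * m i j)) (\<lambda>p. p None * (\<Prod>j\<in>J. p (Some (Inr j)) ^ m i j))"
    by (intro boxpoly_mult boxpoly_prod boxpoly_power boxpoly_var fin) (auto simp: sec_indices_def)
  then have 2: "boxpoly (sec_indices J) exp_bound (\<lambda>p. p None * (\<Prod>j\<in>J. p (Some (Inr j)) ^ m i j))"
    by (rule boxpoly_mono[OF fin]) (use sum_exp_le[OF assms, of J] in \<open>simp add: exp_bound_def\<close>)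
  show ?thesis unfolding sec_param_def by (rule boxpoly_add[OF 1 2])
qed

lemma Sec_parametrised:
  assumes "x \<in> Sec J"
  shows "\<exists>c p. \<forall>i\<le>r. x i = c * sec_param J p i"
proof -
  obtain a b t t' where x: "x = pt a b t t'" "a \<noteq> 0" "t' \<in> subtorus J" using assms unfolding Sec_def by blast
  define p where "p q = (case q of None \<Rightarrow> b / a | Some (Inl j) \<Rightarrow> t j | Some (Inr j) \<Rightarrow> t' j)" for q
  have "mono_val (m i) t' = (\<Prod>j\<in>J. t' j ^ m i j)" for i
    unfolding mono_val_def using x(3) by (intro prod.mono_neutral_right) (auto simp: subtorus_def)
  then have "\<forall>i\<le>r. x i = a * sec_param J p i"
    using x(2) unfolding x(1) pt_def sec_param_def p_def by (simp add: mono_val_def algebra_simps)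
  then show ?thesis by blast
qed

lemma Tor_parametrised:
  assumes "x \<in> Tor J"
  shows "\<exists>c p. \<forall>i\<le>r. x i = c * (\<Prod>j\<in>UNIV. p j ^ m i j)"
proof -
  obtain a t where "x = pt a 0 t t" using assms unfolding Tor_def by blast
  then show ?thesis by (intro exI[of _ a] exI[of _ t]) (simp add: pt_def mono_val_def)
qed

lemma boxpoly_tor_param:
  assumes "i \<le> r"
  shows "boxpoly UNIV exp_bound (\<lambda>p. \<Prod>j\<in>UNIV. p j ^ m i j)"
proof (rule boxpoly_monom)
  fix j
  have "m i j \<le> (\<Sum>j\<in>UNIV. m i j)" by (intro member_le_sum) auto
  also have "\<dots> \<le> exp_bound" using sum_exp_le[OF assms, of UNIV] by simp
  finally show "m i j \<le> exp_bound" .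
qed simp

lemma hilbert_bound_Sec: "hilbert_bound r (Sec J) (CARD('n) + card J + 1)"
proof -
  have "finite (sec_indices J)" by (simp add: sec_indices_def)
  from hilbert_bound_parametrised[OF this boxpoly_sec_param Sec_parametrised]
  show ?thesis unfolding card_sec_indices .
qed

subsubsection \<open>Degeneration\<close>

definition leading_coords :: "nat set \<Rightarrow> nat set" where
  "leading_coords A = insert i0 (range \<epsilon> \<union> A)"

text \<open>Put \<open>t = s\<^sup>2 \<tau>\<close> and \<open>b = s\<^sup>3 \<beta>\<close>. As \<open>s\<close> tends to \<open>0\<close>, the coordinates \<open>x\<^sub>i\<close> of the secant point
  behave like \<open>a\<close>, \<open>s\<^sup>2 a \<tau>\<^sub>j\<close> and \<open>s\<^sup>3 \<beta> t'\<^sup>u\<close> for exponents of degree \<open>0\<close>, \<open>1\<close> and \<open>\<ge> 2\<close>; these leading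
  coefficients are arbitrary nonzero numbers.\<close>

lemma degeneration:
  assumes A: "\<And>i. i \<in> A \<Longrightarrow> i \<le> r \<and> (\<Sum>j\<in>UNIV. m i j) \<ge> 2" and sep: "torus_separating m J A"
    and y: "\<And>i. y i \<noteq> 0"
  obtains w g x where "\<And>i. i \<in> leading_coords A \<Longrightarrow> g i holomorphic_on UNIV"
    "\<And>s. s \<noteq> 0 \<Longrightarrow> x s \<in> Sec J"
    "\<And>s i. i \<in> leading_coords A \<Longrightarrow> x s i = s ^ w i * (y i + s * g i s)"
    "w = (\<lambda>i. if i = i0 then 0 else if i \<in> range \<epsilon> then 2 else 3 :: nat)"
proof -
  obtain b t' where bt: "t' \<in> subtorus J" "\<And>i. i \<in> A \<Longrightarrow> b * mono_val (m i) t' = y i"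
    using sep y unfolding torus_separating_def by blast
  \<comment> \<open>With \<open>a = y i0\<close>, this choice gives
    \<open>a * \<tau> j = y (\<epsilon> j)\<close>, the prescribed leading coefficient.\<close>
  define \<tau> where "\<tau> j = y (\<epsilon> j) / y i0" for j
  define x where "x s = pt (y i0) (s ^ 3 * b) (\<lambda>j. s ^ 2 * \<tau> j) t'" for s
  define w where "w = (\<lambda>i. if i = i0 then 0 else if i \<in> range \<epsilon> then 2 else 3 :: nat)"
  define N where "N i = (\<Sum>j\<in>UNIV. m i j)" for i
  define g where "g i s = (if i = i0 then s ^ 2 * b else if i \<in> range \<epsilon> then b * mono_val (m i) t'
      else s ^ (2 * N i - 4) * (y i0 * mono_val (m i) \<tau>))" for i s
  have A01: "i \<noteq> i0 \<and> i \<notin> range \<epsilon>" if "i \<in> A" for i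
  proof -
    have "(\<Sum>k\<in>UNIV. m (\<epsilon> j) k) = 1" for j by (simp add: \<epsilon>)
    then show ?thesis using A[OF that] i0(2) by fastforce
  qed
  have mv: "mono_val (m i) (\<lambda>j. s ^ 2 * \<tau> j) = s ^ (2 * N i) * mono_val (m i) \<tau>" for i s
    unfolding mono_val_def N_def
    by (simp add: power_mult_distrib prod.distrib power_sum sum_distrib_left flip: power_mult)
  have xs: "x s i = s ^ w i * (y i + s * g i s)" if i: "i \<in> leading_coords A" for s i
  proof -
    consider "i = i0" | j where "i = \<epsilon> j" | "i \<in> A" using i unfolding leading_coords_def by blast
    then show ?thesis
    proof cases
      case 1
      then show ?thesis using i0(1)
        by (simp add: x_def pt_def w_def g_def mono_val_i0 eval_nat_numeral algebra_simps)
    next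
      case 2
      then show ?thesis using \<epsilon>(1)[of j] y[of i0]
        by (simp add: x_def pt_def w_def g_def mono_val_\<epsilon> \<epsilon>_neq_i0 \<tau>_def eval_nat_numeral field_simps)
    next
      case 3
      \<comment> \<open>As \<open>N i \<ge> 2\<close>, the first summand has order at least 4,
        beyond the order 3 of the second, so one factor \<open>s\<close> can be split off the
        remainder.\<close>
      have "2 * N i = 3 + 1 + (2 * N i - 4)" using A[OF 3] unfolding N_def by simp
      then have "s ^ (2 * N i) = s ^ 3 * s * s ^ (2 * N i - 4)" by (metis power_add power_one_right)
      then show ?thesis using A[OF 3] A01[OF 3] bt(2)[OF 3]
        by (simp add: x_def pt_def w_def g_def mv, simp add: algebra_simps)
    qed
  qed
  have xS: "x s \<in> Sec J" if "s \<noteq> 0" for s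
    unfolding x_def using that y bt(1) by (intro pt_in_Sec) (auto simp: subtorus_def \<tau>_def)
  have gh: "g i holomorphic_on UNIV" for i
    unfolding g_def by (cases "i = i0"; cases "i \<in> range \<epsilon>") (auto intro!: holomorphic_intros)
  show ?thesis by (rule that[of g x w, OF gh xS xs w_def])
qed

text \<open>Along the degeneration, the lowest power of \<open>s\<close> in a relation has as
  coefficient the part of minimal weight, evaluated at the arbitrary nonzero values
  \<open>y\<close>. By independence of monomials this part is zero, which contradicts its
  choice.\<close>

lemma leading_monomials_independent:
  fixes ex :: "'e \<Rightarrow> nat \<Rightarrow> nat"
  assumes A: "\<And>i. i \<in> A \<Longrightarrow> i \<le> r \<and> (\<Sum>j\<in>UNIV. m i j) \<ge> 2" and sep: "torus_separating m J A"
    and E: "finite E"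
    and dist: "\<And>e e'. e \<in> E \<Longrightarrow> e' \<in> E \<Longrightarrow> e \<noteq> e' \<Longrightarrow> \<exists>i\<in>leading_coords A. ex e i \<noteq> ex e' i"
    and zero: "\<And>x. x \<in> Sec J \<Longrightarrow> (\<Sum>e\<in>E. c e * (\<Prod>i\<in>leading_coords A. x i ^ ex e i)) = 0"
  shows "\<forall>e\<in>E. c e = 0"
proof (rule ccontr)
  assume neg: "\<not> ?thesis"
  let ?B = "leading_coords A"
  have "A \<subseteq> {..r}" using A by auto
  then have "finite ?B" unfolding leading_coords_def by (auto intro: finite_subset)
  define w where "w = (\<lambda>i. if i = i0 then 0 else if i \<in> range \<epsilon> then 2 else 3 :: nat)"
  define E' where "E' = {e \<in> E. c e \<noteq> 0}"
  define W where "W e = (\<Sum>i\<in>?B. w i * ex e i)" for e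
  have E': "finite E'" "E' \<noteq> {}" using E neg unfolding E'_def by auto
  define \<omega> where "\<omega> = Min (W ` E')"
  have \<omega>: "\<omega> \<le> W e" if "e \<in> E'" for e unfolding \<omega>_def using E' that by simp
  have "\<omega> \<in> W ` E'" unfolding \<omega>_def using E' by (intro Min_in) auto
  then obtain e0 where e0: "e0 \<in> E'" "W e0 = \<omega>" by auto
  \<comment> \<open>The factor \<open>0 ^ (W e - \<omega>)\<close> is 1 for terms of minimal weight
    and 0 for all others, so this is the initial part of the relation.\<close>
  have lead: "(\<Sum>e\<in>E'. (c e * 0 ^ (W e - \<omega>)) * (\<Prod>i\<in>?B. y i ^ ex e i)) = 0"
    if y: "\<And>i. y i \<noteq> 0" for y :: "nat \<Rightarrow> complex"
  proof -
    obtain g x where g: "\<And>i. i \<in> ?B \<Longrightarrow> g i holomorphic_on UNIV"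
      and x: "\<And>s. s \<noteq> 0 \<Longrightarrow> x s \<in> Sec J"
        "\<And>s i. i \<in> ?B \<Longrightarrow> x s i = s ^ w i * (y i + s * g i s)"
      by (rule degeneration[OF A sep, where y = y]) (use y in \<open>auto simp: w_def\<close>)
    define h where "h s = (\<Sum>e\<in>E'. c e * s ^ (W e - \<omega>) * (\<Prod>i\<in>?B. (y i + s * g i s) ^ ex e i))" for s
    \<comment> \<open>The successor makes the product vanish at \<open>s = 0\<close> as well, where
      \<open>x s\<close> is not known to lie in \<open>Sec J\<close>.\<close>
    have "s ^ Suc \<omega> * h s = 0" for s
    proof (cases "s = 0")
      case False
      have "(\<Sum>e\<in>E. c e * (\<Prod>i\<in>?B. x s i ^ ex e i)) = (\<Sum>e\<in>E'. c e * (\<Prod>i\<in>?B. x s i ^ ex e i))"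
        unfolding E'_def using E by (intro sum.mono_neutral_right) auto
      also have "\<dots> = s ^ \<omega> * h s"
        unfolding h_def sum_distrib_left
      proof (rule sum.cong[OF refl])
        fix e assume e: "e \<in> E'"
        have "(\<Prod>i\<in>?B. x s i ^ ex e i) = (\<Prod>i\<in>?B. s ^ (w i * ex e i) * (y i + s * g i s) ^ ex e i)"
          by (intro prod.cong) (auto simp: x(2) power_mult_distrib simp flip: power_mult)
        also have "\<dots> = s ^ W e * (\<Prod>i\<in>?B. (y i + s * g i s) ^ ex e i)"
          by (simp add: prod.distrib W_def power_sum)
        also have "s ^ W e = s ^ \<omega> * s ^ (W e - \<omega>)" using \<omega>[OF e] by (simp flip: power_add)
        finally show "c e * (\<Prod>i\<in>?B. x s i ^ ex e i) =
            s ^ \<omega> * (c e * s ^ (W e - \<omega>) * (\<Prod>i\<in>?B. (y i + s * g i s) ^ ex e i))" by simp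
      qed
      finally show ?thesis using zero[OF x(1)[OF False]] by simp
    qed simp
    moreover have "h holomorphic_on UNIV"
      unfolding h_def using g by (auto intro!: holomorphic_intros)
    ultimately have "h 0 = 0"
      by (intro entire_product_zero[of "\<lambda>s. s ^ Suc \<omega>" h 1]) (auto intro!: holomorphic_intros)
    then show ?thesis unfolding h_def by simp
  qed
  have "\<forall>e\<in>E'. c e * 0 ^ (W e - \<omega>) = 0"
  proof (rule monomials_independent[where ex = ex, OF E'(1) \<open>finite ?B\<close>])
    show "\<exists>i\<in>?B. ex e i \<noteq> ex e' i" if "e \<in> E'" "e' \<in> E'" "e \<noteq> e'" for e e'
      using dist that unfolding E'_def by simp
  qed (rule lead)
  then have "c e0 * 0 ^ (W e0 - \<omega>) = 0" using e0(1) by blast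
  then show False using e0 unfolding E'_def by simp
qed

lemma finite_leading_coords: "finite A \<Longrightarrow> finite (leading_coords A)"
  unfolding leading_coords_def by simp

lemma card_leading_coords:
  assumes "finite A" "\<And>i. i \<in> A \<Longrightarrow> (\<Sum>j\<in>UNIV. m i j) \<ge> 2"
  shows "card (leading_coords A) = CARD('n) + 1 + card A"
proof -
  have "(\<Sum>k\<in>UNIV. m (\<epsilon> j) k) = 1" for j by (simp add: \<epsilon>)
  then have "range \<epsilon> \<inter> A = {}" using assms(2) by fastforce
  then have "card (range \<epsilon> \<union> A) = CARD('n) + card A"
    using assms(1) inj_\<epsilon> by (simp add: card_Un_disjoint card_image)
  moreover have "i0 \<notin> range \<epsilon> \<union> A" using \<epsilon>_neq_i0 assms(2)[of i0] i0(2) by auto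
  ultimately show ?thesis unfolding leading_coords_def using assms(1) by simp
qed

text \<open>A set with \<open>q\<close> parameters satisfies an equation in any \<open>q + 2\<close> coordinates.\<close>

lemma strict_by_count:
  assumes A: "\<And>i. i \<in> A \<Longrightarrow> i \<le> r \<and> (\<Sum>j\<in>UNIV. m i j) \<ge> 2" and sep: "torus_separating m J A"
    and sub: "C \<subseteq> Sec J" "C \<noteq> {}"
    and Q: "finite Q" and \<phi>: "\<And>i. i \<le> r \<Longrightarrow> boxpoly Q K (\<lambda>p. \<phi> p i)"
    and C: "\<And>x. x \<in> C \<Longrightarrow> \<exists>c p. \<forall>i\<le>r. x i = c * \<phi> p i"
    and card: "card Q + 1 \<le> CARD('n) + card A"
  shows "proj_closure r C \<subset> proj_closure r (Sec J)"
proof -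
  let ?B = "leading_coords A" and ?q = "card Q"
  have "A \<subseteq> {..r}" using A by auto
  then have finA: "finite A" by (rule finite_subset) simp
  have B: "finite ?B" using finA by (rule finite_leading_coords)
  have Br: "i \<le> r" if "i \<in> ?B" for i using that A i0 \<epsilon> unfolding leading_coords_def by auto
  have "card (?B - {i0}) = CARD('n) + card A"
  proof -
    have "i0 \<in> ?B" by (simp add: leading_coords_def)
    then have "card (?B - {i0}) = card ?B - 1" by (rule card_Diff_singleton)
    also have "card ?B = CARD('n) + 1 + card A" using A by (intro card_leading_coords finA) blast
    finally show ?thesis by simp
  qed
  then have q1: "?q + 1 \<le> card (?B - {i0})" using card by simp
  then obtain B' where B': "B' \<subseteq> ?B - {i0}" "card B' = ?q + 1" "finite B'"
    by (metis obtain_subset_with_card_n)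
  \<comment> \<open>With \<open>d = (q + 1) * N\<close>, the number of monomials on the parameter
    side is at most \<open>(K * (q + 1) + 1) ^ q * (N + 1) ^ q = N * (N + 1) ^ q\<close>, just below
    the \<open>(N + 1) ^ (q + 1)\<close> exponents in the box \<open>E\<close>.\<close>
  define N where "N = (K * (?q + 1) + 1) ^ ?q"
  define d where "d = (?q + 1) * N"
  define E where "E = PiE B' (\<lambda>_. {..N})"
  \<comment> \<open>Coordinate \<open>i0\<close> homogenises: it takes whatever is missing from
    total degree \<open>d\<close>, so the exponents on the \<open>q + 1\<close> other coordinates
    are free.\<close>
  define ex where "ex e i = (if i \<in> B' then e i else if i = i0 then d - (\<Sum>k\<in>B'. e k) else 0)"
    for e :: "nat \<Rightarrow> nat" and i
  have finE: "finite E" unfolding E_def using B'(3) by (intro finite_PiE) auto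
  have cardE: "card E = (N + 1) ^ (?q + 1)" unfolding E_def using B' by (simp add: card_PiE)
  have sum_ex: "(\<Sum>i\<in>?B. ex e i) = d" if "e \<in> E" for e
  proof -
    have i0B: "i0 \<in> ?B" "i0 \<notin> B'" using B'(1) unfolding leading_coords_def by auto
    have "(\<Sum>k\<in>B'. e k) \<le> (\<Sum>k\<in>B'. N)" using that unfolding E_def by (intro sum_mono) auto
    also have "\<dots> = d" using B'(2) by (simp add: d_def)
    finally have le: "(\<Sum>k\<in>B'. e k) \<le> d" .
    have "(\<Sum>i\<in>?B. ex e i) = (\<Sum>i\<in>insert i0 B'. ex e i)"
      using B B'(1) i0B by (intro sum.mono_neutral_right) (auto simp: ex_def)
    also have "\<dots> = ex e i0 + (\<Sum>i\<in>B'. e i)"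
      using B'(3) i0B(2) by (simp add: ex_def cong: sum.cong_simp)
    also have "\<dots> = d" using le i0B(2) by (simp add: ex_def)
    finally show ?thesis .
  qed
  define g where "g e x = (\<Prod>i\<in>?B. x i ^ ex e i)" for e and x :: "nat \<Rightarrow> complex"
  have g: "form r d (g e)" if "e \<in> E" for e
  proof -
    have "form r (\<Sum>i\<in>?B. 1 * ex e i) (\<lambda>x. \<Prod>i\<in>?B. x i ^ ex e i)"
      by (intro form_prod form_power form_coord B Br)
    then show ?thesis using sum_ex[OF that] unfolding g_def by simp
  qed
  have "(K * d + 1) ^ ?q \<le> ((K * (?q + 1) + 1) * (N + 1)) ^ ?q"
    unfolding d_def by (intro power_mono) (simp_all add: algebra_simps)
  also have "\<dots> = N * (N + 1) ^ ?q" unfolding power_mult_distrib N_def by simp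
  also have "\<dots> < (N + 1) ^ (?q + 1)" by simp
  finally have big: "card E > (K * d + 1) ^ ?q" using cardE by simp
  have "\<exists>c. (\<exists>e\<in>E. c e \<noteq> 0) \<and> (\<forall>x\<in>C. (\<Sum>e\<in>E. c e * g e x) = 0)"
    by (rule forms_dependent_on_parametrised[where Q = Q and K = K and \<phi> = \<phi> and r = r, OF Q _ _ finE _ big])
      (fact \<phi>, fact C, fact g)
  then obtain c where c: "\<exists>e\<in>E. c e \<noteq> 0" "\<forall>x\<in>C. (\<Sum>e\<in>E. c e * g e x) = 0" by (elim exE conjE)
  have "\<not> (\<forall>x\<in>Sec J. (\<Sum>e\<in>E. c e * g e x) = 0)"
  proof
    assume zero: "\<forall>x\<in>Sec J. (\<Sum>e\<in>E. c e * g e x) = 0"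
    have dist: "\<exists>i\<in>?B. ex e i \<noteq> ex e' i" if e: "e \<in> E" "e' \<in> E" "e \<noteq> e'" for e e'
    proof -
      obtain i where "i \<in> B'" "e i \<noteq> e' i" using e unfolding E_def by (metis PiE_ext)
      then show ?thesis using B'(1) by (intro bexI[of _ i]) (auto simp: ex_def)
    qed
    have "\<forall>e\<in>E. c e = 0"
      by (rule leading_monomials_independent[OF A sep finE dist]) (use zero in \<open>auto simp: g_def\<close>)
    then show False using c(1) by blast
  qed
  then obtain x where x: "x \<in> Sec J" "(\<Sum>e\<in>E. c e * g e x) \<noteq> 0" by blast
  have "form r d (\<lambda>x. \<Sum>e\<in>E. c e * g e x)" by (intro form_sum form_cmult g)
  from proj_closure_strict[OF sub(1) this c(2) sub(2) x Sec_supp] show ?thesis .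
qed

end

subsection \<open>The secant variety as a closure\<close>

text \<open>Inhomogeneous polynomials enter because moving one of the two points spanning a line
  while the other is fixed turns a form into \<open>f (s * x + z)\<close>.\<close>

inductive sum_of_forms :: "nat \<Rightarrow> ((nat \<Rightarrow> complex) \<Rightarrow> complex) \<Rightarrow> bool" for r where
  form: "form r d f \<Longrightarrow> sum_of_forms r f"
| add: "sum_of_forms r f \<Longrightarrow> sum_of_forms r g \<Longrightarrow> sum_of_forms r (\<lambda>x. f x + g x)"

lemma sum_of_forms_cmult: "sum_of_forms r f \<Longrightarrow> sum_of_forms r (\<lambda>x. c * f x)"
proof (induction rule: sum_of_forms.induct)
  case (form d f)
  show ?case by (rule sum_of_forms.form[OF form_cmult[OF form]])
next
  case (add f g)
  from sum_of_forms.add[OF add.IH] show ?case by (simp add: distrib_left)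
qed

lemma sum_of_forms_mult:
  assumes "sum_of_forms r f" "sum_of_forms r g"
  shows "sum_of_forms r (\<lambda>x. f x * g x)"
  using assms(1)
proof (induction rule: sum_of_forms.induct)
  case (form d f)
  from assms(2) show ?case
  proof (induction rule: sum_of_forms.induct)
    case (form e g)
    show ?case by (rule sum_of_forms.form[OF form_mult[OF \<open>form r d f\<close> form]])
  next
    case (add g h)
    from sum_of_forms.add[OF add.IH] show ?case by (simp add: distrib_left)
  qed
next
  case (add f h)
  from sum_of_forms.add[OF add.IH] show ?case by (simp add: distrib_right)
qed

lemma sum_of_forms_const: "sum_of_forms r (\<lambda>_. c)"
  by (rule sum_of_forms.form[OF form_const])

lemma sum_of_forms_sum:
  "(\<And>i. i \<in> I \<Longrightarrow> sum_of_forms r (f i)) \<Longrightarrow> sum_of_forms r (\<lambda>x. \<Sum>i\<in>I. f i x)"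
  by (induction I rule: infinite_finite_induct) (auto intro: sum_of_forms_const sum_of_forms.add)

lemma sum_of_forms_prod:
  "(\<And>i. i \<in> I \<Longrightarrow> sum_of_forms r (f i)) \<Longrightarrow> sum_of_forms r (\<lambda>x. \<Prod>i\<in>I. f i x)"
  by (induction I rule: infinite_finite_induct) (auto intro: sum_of_forms_const sum_of_forms_mult)

lemma sum_of_forms_power: "sum_of_forms r f \<Longrightarrow> sum_of_forms r (\<lambda>x. f x ^ k)"
  by (induction k) (auto intro: sum_of_forms_const sum_of_forms_mult)

lemma sum_of_forms_affine:
  assumes "form r d f"
  shows "sum_of_forms r (\<lambda>x. f (\<lambda>i. s * x i + z i))"
proof -
  obtain M a where M: "finite M" "\<forall>m\<in>M. (\<Sum>i\<le>r. m i) = d"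
    and f: "f = (\<lambda>x. \<Sum>m\<in>M. a m * (\<Prod>i\<le>r. x i ^ m i))"
    using assms unfolding form_def by blast
  show ?thesis unfolding f
    by (intro sum_of_forms_sum sum_of_forms_cmult sum_of_forms_prod sum_of_forms_power
        sum_of_forms.add sum_of_forms_const sum_of_forms.form[OF form_coord]) auto
qed

lemma sum_of_forms_components:
  "sum_of_forms r h \<Longrightarrow> \<exists>N g. (\<forall>j. form r j (g j)) \<and> (\<forall>x. h x = (\<Sum>j\<le>N. g j x))"
proof (induction rule: sum_of_forms.induct)
  case (form d f)
  define g where "g j = (if j = d then f else (\<lambda>_. 0))" for j
  have "form r j (g j)" for j using form form_zero unfolding g_def by auto
  moreover have "f x = (\<Sum>j\<le>d. g j x)" for x
  proof -
    have "(\<Sum>j\<le>d. g j x) = (\<Sum>j\<le>d. if j = d then f x else 0)" by (intro sum.cong) (auto simp: g_def)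
    then show ?thesis by simp
  qed
  ultimately show ?case by blast
next
  case (add f g)
  obtain N a where a: "\<And>j. form r j (a j)" "\<And>x. f x = (\<Sum>j\<le>N. a j x)" using add.IH(1) by blast
  obtain M b where b: "\<And>j. form r j (b j)" "\<And>x. g x = (\<Sum>j\<le>M. b j x)" using add.IH(2) by blast
  define h where "h j x = (if j \<le> N then a j x else 0) + (if j \<le> M then b j x else 0)" for j x
  have "form r j (h j)" for j
    unfolding h_def by (intro form_add; cases "j \<le> N"; cases "j \<le> M") (auto intro: a b form_zero)
  moreover have "f x + g x = (\<Sum>j\<le>N + M. h j x)" for x
  proof -
    have "f x = (\<Sum>j\<le>N + M. if j \<le> N then a j x else 0)"
      unfolding a(2) by (intro sum.mono_neutral_cong_left) auto
    moreover have "g x = (\<Sum>j\<le>N + M. if j \<le> M then b j x else 0)"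
      unfolding b(2) by (intro sum.mono_neutral_cong_left) auto
    ultimately show ?thesis unfolding h_def by (simp add: sum.distrib)
  qed
  ultimately show ?case by blast
qed

text \<open>A polynomial vanishing on a cone \<open>D\<close> has all its homogeneous components vanishing on \<open>D\<close>.\<close>

lemma affine_vanish_closure:
  assumes f: "form r d f" and D: "\<And>x c. x \<in> D \<Longrightarrow> c \<noteq> 0 \<Longrightarrow> (\<lambda>i. c * x i) \<in> D"
    and zero: "\<And>x. x \<in> D \<Longrightarrow> f (\<lambda>i. s * x i + z i) = 0" and x: "x \<in> \<Union>(proj_closure r D)"
  shows "f (\<lambda>i. s * x i + z i) = 0"
proof -
  obtain N g where g: "\<And>j. form r j (g j)" "\<And>x. f (\<lambda>i. s * x i + z i) = (\<Sum>j\<le>N. g j x)"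
    using sum_of_forms_components[OF sum_of_forms_affine[OF f, of s z]] by blast
  have "g j y = 0" if y: "y \<in> D" and j: "j \<le> N" for y j
  proof -
    \<comment> \<open>The scaling factor is the only variable, indexed by \<open>()\<close>, and its
      distinct powers are independent.\<close>
    have "\<forall>j\<in>{..N}. g j y = 0"
    proof (rule monomials_independent[where ex = "\<lambda>j _. j" and B = "{()}"])
      fix c :: "unit \<Rightarrow> complex" assume c: "\<And>i. c i \<noteq> 0"
      have "(\<Sum>j\<le>N. g j (\<lambda>i. c () * y i)) = 0" using zero[OF D[OF y c]] g(2) by simp
      then show "(\<Sum>j\<le>N. g j y * (\<Prod>i\<in>{()}. c i ^ j)) = 0"
        by (simp add: form_scale[OF g(1)] mult.commute)
    qed auto
    then show ?thesis using j by simp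
  qed
  then have "g j x = 0" if "j \<le> N" for j using vanish_proj_closure[OF g(1) _ x, of j] that by blast
  then show ?thesis using g(2) by simp
qed

lemma line_combination_nonzero:
  assumes "x \<in> hom_coords r" "y \<in> hom_coords r" "proj_pt x \<noteq> proj_pt y" "(s, t) \<noteq> (0, 0)"
  shows "(\<lambda>i. s * x i + t * y i) \<in> hom_coords r"
proof (rule ccontr)
  assume neg: "\<not> ?thesis"
  have "s * x i + t * y i = 0" for i
    using neg assms(1,2) unfolding hom_coords_def by (cases "i > r") auto
  then have eq: "s * x i = - t * y i" for i by (metis add.commute eq_neg_iff_add_eq_0 minus_mult_left)
  obtain i where i: "x i \<noteq> 0" using assms(1) unfolding hom_coords_def by blast
  obtain k where k: "y k \<noteq> 0" using assms(2) unfolding hom_coords_def by blast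
  have st: "s \<noteq> 0" "t \<noteq> 0" using eq[of i] eq[of k] i k assms(4) by auto
  have "x j = (- t / s) * y j" for j using eq[of j] st by (simp add: field_simps)
  then have "x = (\<lambda>j. (- t / s) * y j)" by blast
  moreover have "- t / s \<noteq> 0" using st by simp
  ultimately have "proj_pt x = proj_pt y" using proj_pt_eq_iff[OF assms(2), of x] by blast
  then show False using assms(3) by simp
qed

section \<open>Secant lines of the closed torus orbit\<close>

context monomial_secant
begin

definition tor_points :: "(nat \<Rightarrow> complex) set set" where
  "tor_points = (\<lambda>t. proj_pt (pt 1 0 t t)) ` subtorus UNIV"

definition secant_lines :: "(nat \<Rightarrow> complex) set set" where
  "secant_lines = \<Union>{L. proj_line r L \<and> (\<exists>p\<in>L \<inter> proj_closure r (Tor UNIV). \<exists>q\<in>L \<inter> proj_closure r (Tor UNIV). p \<noteq> q)}"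

lemma pt_scale: "(\<lambda>i. c * pt a b t t' i) = pt (c * a) (c * b) t t'"
  by (rule ext) (simp add: pt_def algebra_simps)

lemma Union_tor_points: "\<Union>tor_points = Tor UNIV"
  unfolding tor_points_def proj_pt_def Tor_def pt_scale by auto

lemma tor_points_closure: "zariski r closure_of tor_points = proj_closure r (Tor UNIV)"
proof -
  have "tor_points \<subseteq> proj_space r"
    unfolding tor_points_def proj_space_def using Tor_hom[OF pt_in_Tor, of 1 _ UNIV] by auto
  then show ?thesis using zariski_closure_of Union_tor_points by metis
qed

lemma Tor_cone: "x \<in> Tor J \<Longrightarrow> c \<noteq> 0 \<Longrightarrow> (\<lambda>i. c * x i) \<in> Tor J"
  unfolding Tor_def using pt_scale by fastforce

text \<open>Secant lines meet the closure of the orbit and not only the orbit. The passage to the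
  closure is made for one of the two points at a time, the other one being held fixed.\<close>

lemma vanish_on_secants:
  assumes f: "form r d f" and zero: "\<forall>x\<in>Sec UNIV. f x = 0"
    and x: "x \<in> \<Union>(proj_closure r (Tor UNIV))" and y: "y \<in> \<Union>(proj_closure r (Tor UNIV))"
  shows "f (\<lambda>i. s * x i + t * y i) = 0"
proof -
  have base: "f (\<lambda>i. s * x i + t * y i) = 0" if "x \<in> Tor UNIV" "y \<in> Tor UNIV" for x y s t
  proof -
    obtain a p where x: "x = pt a 0 p p" "a \<noteq> 0" "p \<in> subtorus UNIV" using \<open>x \<in> _\<close> unfolding Tor_def by blast
    obtain b q where y: "y = pt b 0 q q" "b \<noteq> 0" "q \<in> subtorus UNIV" using \<open>y \<in> _\<close> unfolding Tor_def by blast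
    have eq: "(\<lambda>i. s * x i + t * y i) = pt (s * a) (t * b) p q"
      unfolding x y by (rule ext) (simp add: pt_def algebra_simps)
    show ?thesis
    proof (cases "s = 0")
      case False
      then show ?thesis unfolding eq using zero pt_in_Sec x y by simp
    next
      \<comment> \<open>\<open>Sec\<close> demands a nonzero first coefficient, so here the
        remaining point takes the first place; if both coefficients vanish, the value at the origin
        is needed.\<close>
      case True
      have eq': "(\<lambda>i. s * x i + t * y i) = pt (t * b) 0 q q"
      proof -
        have "pt 0 (t * b) p q = pt (t * b) 0 q q" by (rule ext) (simp add: pt_def)
        then show ?thesis using eq unfolding True by simp
      qed
      show ?thesis
      proof (cases "t = 0")
        case False
        then show ?thesis unfolding eq' using zero pt_in_Sec y by simp
      next
        case True
        have "f y = 0" using zero Tor_subset_Sec \<open>y \<in> Tor UNIV\<close> by blast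
        then have "f (\<lambda>_. 0) = 0" by (rule form_zero_at_0[OF f])
        moreover have "(\<lambda>i. s * x i + t * y i) = (\<lambda>_. 0)" using True \<open>s = 0\<close> by simp
        ultimately show ?thesis by simp
      qed
    qed
  qed
  have step: "f (\<lambda>i. s * x i + t * y i) = 0" if "y \<in> Tor UNIV" for y
    by (rule affine_vanish_closure[OF f Tor_cone base x]) (use that in auto)
  have "f (\<lambda>i. t * y i + s * x i) = 0"
    by (rule affine_vanish_closure[OF f Tor_cone _ y]) (use step in \<open>auto simp: add.commute\<close>)
  then show ?thesis by (simp add: add.commute)
qed

lemma secant_lines_subset: "secant_lines \<subseteq> proj_closure r (Sec UNIV)"
proof
  let ?X = "proj_closure r (Tor UNIV)"
  fix \<zeta> assume "\<zeta> \<in> secant_lines"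
  then obtain L p q where L: "proj_line r L" "p \<in> L" "p \<in> ?X" "q \<in> L" "q \<in> ?X" "p \<noteq> q" "\<zeta> \<in> L"
    unfolding secant_lines_def by blast
  obtain x y where xy: "x \<in> hom_coords r" "y \<in> hom_coords r" "proj_pt x \<noteq> proj_pt y"
    and Leq: "L = {proj_pt (\<lambda>i. s * x i + t * y i) | s t. (s, t) \<noteq> (0, 0)}"
    using L(1) unfolding proj_line_def by blast
  obtain s1 t1 where p: "p = proj_pt (\<lambda>i. s1 * x i + t1 * y i)" "(s1, t1) \<noteq> (0, 0)" using L(2) Leq by blast
  obtain s2 t2 where q: "q = proj_pt (\<lambda>i. s2 * x i + t2 * y i)" "(s2, t2) \<noteq> (0, 0)" using L(4) Leq by blast
  obtain \<sigma> \<tau> where z: "\<zeta> = proj_pt (\<lambda>i. \<sigma> * x i + \<tau> * y i)" "(\<sigma>, \<tau>) \<noteq> (0, 0)" using L(7) Leq by blast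
  define P where "P i = s1 * x i + t1 * y i" for i
  define Q where "Q i = s2 * x i + t2 * y i" for i
  \<comment> \<open>This determinant is nonzero because \<open>p\<close> and \<open>q\<close> are
    different points; so \<open>P\<close> and \<open>Q\<close> span the same line as
    \<open>x\<close> and \<open>y\<close>.\<close>
  define \<delta> where "\<delta> = s1 * t2 - s2 * t1"
  have PX: "P \<in> \<Union>?X" "Q \<in> \<Union>?X"
    using L(3,5) p(1) q(1) proj_pt_self unfolding P_def Q_def by blast+
  have \<delta>: "\<delta> \<noteq> 0"
  proof
    assume "\<delta> = 0"
    obtain c where c: "s2 = c * s1" "t2 = c * t1"
    proof (cases "s1 = 0")
      case True
      then have "t1 \<noteq> 0" "s2 = 0" using p(2) \<open>\<delta> = 0\<close> unfolding \<delta>_def by auto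
      then show ?thesis using that[of "t2 / t1"] True by simp
    next
      case False
      then show ?thesis using that[of "s2 / s1"] \<open>\<delta> = 0\<close> unfolding \<delta>_def by (simp add: field_simps)
    qed
    have "c \<noteq> 0" using c q(2) by auto
    have "Q = (\<lambda>i. c * P i)" unfolding Q_def P_def c by (simp add: algebra_simps)
    moreover have "P \<in> hom_coords r"
      unfolding P_def by (rule line_combination_nonzero[OF xy p(2)])
    ultimately have "proj_pt Q = proj_pt P" using proj_pt_eq_iff[of P r Q] \<open>c \<noteq> 0\<close> by blast
    then show False using L(6) p(1) q(1) unfolding P_def Q_def by simp
  qed
  \<comment> \<open>Cramer's rule for the coordinates of the given point with respect to
    \<open>P\<close> and \<open>Q\<close>.\<close>
  define \<alpha> where "\<alpha> = (\<sigma> * t2 - \<tau> * s2) / \<delta>"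
  define \<beta> where "\<beta> = (\<tau> * s1 - \<sigma> * t1) / \<delta>"
  have "(\<sigma> * t2 - \<tau> * s2) * s1 + (\<tau> * s1 - \<sigma> * t1) * s2 = \<sigma> * \<delta>"
    "(\<sigma> * t2 - \<tau> * s2) * t1 + (\<tau> * s1 - \<sigma> * t1) * t2 = \<tau> * \<delta>"
    by (simp_all add: \<delta>_def algebra_simps)
  moreover have "\<alpha> * u + \<beta> * v = ((\<sigma> * t2 - \<tau> * s2) * u + (\<tau> * s1 - \<sigma> * t1) * v) / \<delta>" for u v
    unfolding \<alpha>_def \<beta>_def by (simp add: add_divide_distrib)
  ultimately have "\<alpha> * s1 + \<beta> * s2 = \<sigma>" "\<alpha> * t1 + \<beta> * t2 = \<tau>"
    using \<delta> by simp_all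
  moreover have "\<alpha> * P i + \<beta> * Q i = (\<alpha> * s1 + \<beta> * s2) * x i + (\<alpha> * t1 + \<beta> * t2) * y i" for i
    unfolding P_def Q_def by (simp add: algebra_simps)
  ultimately have comb: "(\<lambda>i. \<sigma> * x i + \<tau> * y i) = (\<lambda>i. \<alpha> * P i + \<beta> * Q i)"
    by simp
  have "f (\<lambda>i. \<sigma> * x i + \<tau> * y i) = 0" if "f \<in> forms_vanish r (Sec UNIV)" for f
    using that vanish_on_secants[OF _ _ PX, of _ f \<alpha> \<beta>] unfolding comb forms_vanish_def by blast
  then show "\<zeta> \<in> proj_closure r (Sec UNIV)"
    unfolding proj_closure_def z(1)
    by (subst proj_pt_in_zero_locus[OF line_combination_nonzero[OF xy z(2)]]) (auto simp: forms_vanish_def)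
qed

lemma in_secant_lines:
  assumes "x \<in> Tor UNIV" "y \<in> Tor UNIV" "proj_pt x \<noteq> proj_pt y" "(s, t) \<noteq> (0, 0)"
  shows "proj_pt (\<lambda>i. s * x i + t * y i) \<in> secant_lines"
proof -
  define L where "L = {proj_pt (\<lambda>i. s * x i + t * y i) | s t. (s, t) \<noteq> (0, 0)}"
  have hom: "x \<in> hom_coords r" "y \<in> hom_coords r" using assms(1,2) Tor_hom by auto
  then have line: "proj_line r L" unfolding proj_line_def L_def using assms(3) by blast
  have mem: "proj_pt (\<lambda>i. s * x i + t * y i) \<in> L" if "(s, t) \<noteq> (0, 0)" for s t
    unfolding L_def using that by blast
  have "proj_pt x \<in> L" "proj_pt y \<in> L" using mem[of 1 0] mem[of 0 1] by simp_all
  moreover have "proj_pt x \<in> proj_closure r (Tor UNIV)" "proj_pt y \<in> proj_closure r (Tor UNIV)"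
    using proj_pt_in_closure hom assms(1,2) by auto
  ultimately have "L \<subseteq> secant_lines" unfolding secant_lines_def using line assms(3) by blast
  then show ?thesis using mem[OF assms(4)] by blast
qed

lemma Sec_in_secant_lines:
  assumes "x \<in> Sec UNIV" "x \<in> hom_coords r"
  shows "proj_pt x \<in> secant_lines"
proof -
  obtain a b t t' where x: "x = pt a b t t'" "a \<noteq> 0" "t \<in> subtorus UNIV" "t' \<in> subtorus UNIV"
    using assms(1) unfolding Sec_def by blast
  define P where "P = pt 1 0 t t"
  define Q where "Q = pt 1 0 t' t'"
  have PQ: "P \<in> Tor UNIV" "Q \<in> Tor UNIV" unfolding P_def Q_def using x pt_in_Tor by auto
  have comb: "x = (\<lambda>i. a * P i + b * Q i)"
    unfolding x(1) P_def Q_def by (rule ext) (simp add: pt_def)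
  show ?thesis
  proof (cases "proj_pt P = proj_pt Q")
    case False
    then show ?thesis unfolding comb using in_secant_lines[OF PQ, of a b] x(2) by simp
  next
    \<comment> \<open>If both torus points agree projectively, \<open>x\<close> is a multiple of
      \<open>P\<close> and lies on the line from \<open>P\<close> to any other torus point
      \<open>R\<close>.\<close>
    case True
    then obtain c where c: "Q = (\<lambda>i. c * P i)" using proj_pt_eq_iff[OF Tor_hom[OF PQ(1)], of Q] by metis
    have x': "x = (\<lambda>i. (a + b * c) * P i + 0 * pt 1 0 t t i)"
      unfolding comb c by (simp add: algebra_simps)
    have "a + b * c \<noteq> 0"
    proof
      assume "a + b * c = 0"
      then have "x = (\<lambda>_. 0)" unfolding x' by simp
      then show False using assms(2) unfolding hom_coords_def by simp
    qed
    fix j :: 'n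
    \<comment> \<open>Doubling one coordinate changes the point: \<open>i0\<close> pins the
      proportionality factor to 1, and coordinate \<open>\<epsilon> j\<close> then differs.\<close>
    define R where "R = pt 1 0 (t(j := 2 * t j)) (t(j := 2 * t j))"
    have R: "R \<in> Tor UNIV"
      unfolding R_def by (intro pt_in_Tor) (use x(3) in \<open>auto simp: subtorus_def\<close>)
    have "proj_pt P \<noteq> proj_pt R"
    proof
      assume "proj_pt P = proj_pt R"
      then obtain k where k: "R = (\<lambda>i. k * P i)" using proj_pt_eq_iff[OF Tor_hom[OF PQ(1)], of R] by metis
      have "k = 1" using fun_cong[OF k, of i0] i0(1) by (simp add: R_def P_def pt_def mono_val_i0)
      then have "2 * t j = t j"
        using fun_cong[OF k, of "\<epsilon> j"] \<epsilon>(1)[of j] by (simp add: R_def P_def pt_def mono_val_\<epsilon>)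
      then show False using x(3) by (simp add: subtorus_def)
    qed
    from in_secant_lines[OF PQ(1) R this, of "a + b * c" 0] \<open>a + b * c \<noteq> 0\<close> show ?thesis
      unfolding x' by simp
  qed
qed

lemma secant_variety_eq:
  "secant_variety r (zariski r closure_of tor_points) = proj_closure r (Sec UNIV)"
proof -
  have ps: "secant_lines \<subseteq> proj_space r"
    using secant_lines_subset unfolding proj_closure_def zero_locus_def by blast
  have "secant_variety r (zariski r closure_of tor_points) = zariski r closure_of secant_lines"
    unfolding secant_variety_def tor_points_closure secant_lines_def ..
  also have "\<dots> = proj_closure r (Sec UNIV)"
  proof
    show "zariski r closure_of secant_lines \<subseteq> proj_closure r (Sec UNIV)"
      by (intro closure_of_minimal secant_lines_subset closedin_proj_closure)
    show "proj_closure r (Sec UNIV) \<subseteq> zariski r closure_of secant_lines"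
      unfolding zariski_closure_of[OF ps]
    proof (rule proj_closure_mono)
      fix f d assume f: "form r d f" and zero: "\<forall>x\<in>\<Union>secant_lines. f x = 0"
      have hom: "f x = 0" if "x \<in> Sec UNIV" "x \<in> hom_coords r" for x
        using zero Sec_in_secant_lines[OF that] proj_pt_self by blast
      have supp: "\<forall>x\<in>Sec UNIV. \<forall>i>r. x i = 0" by (rule Sec_supp)
      show "\<forall>x\<in>Sec UNIV. f x = 0"
      proof
        fix x assume x: "x \<in> Sec UNIV"
        show "f x = 0"
        proof (cases "x \<in> hom_coords r")
          case False
          then have "x i = 0" for i using supp x unfolding hom_coords_def by (cases "i > r") auto
          then have "x = (\<lambda>_. 0)" by blast
          moreover obtain y where "y \<in> Tor UNIV" using Tor_nonempty by blast
          then have "f y = 0" using hom Tor_hom Tor_subset_Sec by blast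
          ultimately show ?thesis using form_zero_at_0[OF f, of y] by simp
        qed (rule hom[OF x])
      qed
    qed
  qed
  finally show ?thesis .
qed

subsection \<open>The dimension of the secant variety\<close>

text \<open>Here all \<open>r + 1\<close> coordinates are leading, so a form vanishing on the
  secants has only zero coefficients and the closure is the whole space.\<close>

lemma krull_dim_fill:
  assumes cases: "\<And>i. i \<le> r \<Longrightarrow> i = i0 \<or> i \<in> range \<epsilon> \<or> (\<Sum>j\<in>UNIV. m i j) \<ge> 2"
    and sep: "torus_separating m UNIV {i. i \<le> r \<and> (\<Sum>j\<in>UNIV. m i j) \<ge> 2}"
  shows "krull_dim (subtopology (zariski r) (proj_closure r (Sec UNIV))) = enat r"
proof (rule krull_dim_proj_space)
  define A where "A = {i. i \<le> r \<and> (\<Sum>j\<in>UNIV. m i j) \<ge> 2}"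
  have lead: "leading_coords A = {..r}"
    unfolding leading_coords_def A_def using cases i0(1) \<epsilon>(1) by auto
  have A: "i \<le> r \<and> 2 \<le> (\<Sum>j\<in>UNIV. m i j)" if "i \<in> A" for i using that unfolding A_def by simp
  have vanish: "f x = 0" if f: "form r d f" and zero: "\<forall>x\<in>Sec UNIV. f x = 0" for f d x
  proof -
    obtain M a where M: "finite M" "\<forall>m\<in>M. (\<Sum>i\<le>r. m i) = d"
      and feq: "f = (\<lambda>x. \<Sum>m\<in>M. a m * (\<Prod>i\<le>r. x i ^ m i))"
      using f unfolding form_def by blast
    \<comment> \<open>Exponent functions may differ beyond \<open>r\<close> and still give the same
      monomial; terms are collected after cutting them off there.\<close>
    define R where "R e = restrict e {..r}" for e :: "nat \<Rightarrow> nat"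
    define c where "c e = (\<Sum>m\<in>{m \<in> M. R m = e}. a m)" for e
    have feq': "f x = (\<Sum>e\<in>R ` M. c e * (\<Prod>i\<le>r. x i ^ e i))" for x
    proof -
      have "f x = (\<Sum>e\<in>R ` M. \<Sum>m\<in>{m \<in> M. R m = e}. a m * (\<Prod>i\<le>r. x i ^ m i))"
        unfolding feq by (rule sum.image_gen[OF M(1)])
      also have "\<dots> = (\<Sum>e\<in>R ` M. c e * (\<Prod>i\<le>r. x i ^ e i))"
        unfolding c_def sum_distrib_right
        by (intro sum.cong refl arg_cong2[of _ _ _ _ "(*)"] prod.cong) (auto simp: R_def)
      finally show ?thesis .
    qed
    have "\<forall>e\<in>R ` M. c e = 0"
    proof (rule leading_monomials_independent[where A = A and J = UNIV and ex = "\<lambda>e. e", OF A])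
      show "torus_separating m UNIV A" using sep unfolding A_def .
      show "finite (R ` M)" using M(1) by simp
      show "\<exists>i\<in>leading_coords A. e i \<noteq> e' i" if e: "e \<in> R ` M" "e' \<in> R ` M" "e \<noteq> e'" for e e'
      proof (rule ccontr)
        assume "\<not> ?thesis"
        then have "\<forall>i\<le>r. e i = e' i" unfolding lead by simp
        moreover have "\<forall>i>r. e i = undefined" "\<forall>i>r. e' i = undefined"
          using e(1,2) unfolding R_def by auto
        ultimately have "e i = e' i" for i by (cases "i \<le> r") auto
        then show False using e(3) by blast
      qed
      show "(\<Sum>e\<in>R ` M. c e * (\<Prod>i\<in>leading_coords A. x i ^ e i)) = 0" if "x \<in> Sec UNIV" for x
        using zero that unfolding lead feq'[symmetric] by simp
    qed
    then show ?thesis unfolding feq' by (auto intro!: sum.neutral)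
  qed
  show "proj_closure r (coord_space r) = proj_closure r (Sec UNIV)"
  proof
    show "proj_closure r (coord_space r) \<subseteq> proj_closure r (Sec UNIV)"
      by (rule proj_closure_mono) (use vanish in blast)
    show "proj_closure r (Sec UNIV) \<subseteq> proj_closure r (coord_space r)"
      by (rule proj_closure_mono) (use Sec_supp[of UNIV] in \<open>auto simp: coord_space_def\<close>)
  qed
qed

text \<open>The separating form is the equation \<open>t j = 1\<close>, homogenised by coordinate
  \<open>i0\<close>.\<close>

lemma Tor_strict:
  assumes "j \<notin> J"
  shows "proj_closure r (Tor J) \<subset> proj_closure r (Tor (insert j J))"
proof -
  define f where "f x = x (\<epsilon> j) + (-1) * x i0" for x :: "nat \<Rightarrow> complex"
  define t where "t = (\<lambda>_. 1 :: complex)(j := 2)"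
  have f: "form r 1 f"
    unfolding f_def by (intro form_add form_cmult form_coord \<epsilon>(1) i0(1))
  have val: "f (pt a 0 t' t') = a * (t' j - 1)" for a t'
    using \<epsilon>(1)[of j] i0(1) by (simp add: f_def pt_def mono_val_\<epsilon> mono_val_i0 algebra_simps)
  have f0: "\<forall>x\<in>Tor J. f x = 0"
    using assms val unfolding Tor_def by (auto simp: subtorus_def)
  have t: "pt 1 0 t t \<in> Tor (insert j J)"
    by (rule pt_in_Tor) (auto simp: t_def subtorus_def)
  have "f (pt 1 0 t t) \<noteq> 0" unfolding val by (simp add: t_def)
  from proj_closure_strict[OF Tor_mono f f0 Tor_nonempty t this Tor_supp] show ?thesis by blast
qed

text \<open>The chain releases one coordinate at a time, first in the torus orbit and then in the
  second point of the secants. The two halves have \<open>CARD('n) + 1\<close> members each.\<close>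

lemma krull_dim_nondefective:
  assumes full: "\<And>J. \<exists>A. (\<forall>i\<in>A. i \<le> r \<and> (\<Sum>j\<in>UNIV. m i j) \<ge> 2) \<and> card A = card J + 1 \<and>
      torus_separating m J A"
  shows "krull_dim (subtopology (zariski r) (proj_closure r (Sec UNIV))) = enat (2 * CARD('n) + 1)"
proof -
  let ?n = "CARD('n)"
  obtain idx where idx: "bij_betw idx {0..<?n} (UNIV :: 'n set)"
    using ex_bij_betw_nat_finite[of "UNIV :: 'n set"] by auto
  define I where "I k = idx ` {0..<k}" for k
  have inj: "inj_on idx {0..<?n}" using idx by (rule bij_betw_imp_inj_on)
  have cardI: "card (I k) = k" if "k \<le> ?n" for k
    unfolding I_def using that inj by (subst card_image) (auto intro: inj_on_subset)
  have In: "I ?n = UNIV" unfolding I_def using idx by (rule bij_betw_imp_surj_on)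
  have ISuc: "I (Suc k) = insert (idx k) (I k)" for k
    unfolding I_def by (auto simp: atLeast0_lessThan_Suc)
  have idx_notin: "idx k \<notin> I k" if "k < ?n" for k
    unfolding I_def using that inj by (auto dest: inj_onD)
  \<comment> \<open>Index \<open>?n\<close> still belongs to the full torus orbit, so
    \<open>Sec {}\<close> comes at \<open>?n + 1\<close>; hence the shift by
    \<open>?n + 1\<close>.\<close>
  define Z where "Z k = (if k \<le> ?n then proj_closure r (Tor (I k)) else proj_closure r (Sec (I (k - ?n - 1))))" for k
  \<comment> \<open>With \<open>card A = card J + 1\<close> the counting lemma admits subfamilies of
    up to \<open>?n + card J\<close> parameters, one less than \<open>Sec J\<close> itself
    has.\<close>
  have Sec_strict: "proj_closure r C \<subset> proj_closure r (Sec J)"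
    if "C \<subseteq> Sec J" "C \<noteq> {}" "finite Q" "\<And>i. i \<le> r \<Longrightarrow> boxpoly Q K (\<lambda>p. \<phi> p i)"
      "\<And>x. x \<in> C \<Longrightarrow> \<exists>c p. \<forall>i\<le>r. x i = c * \<phi> p i" "card Q \<le> ?n + card J"
    for C J K and Q :: "'q set" and \<phi>
  proof -
    obtain A where A: "\<forall>i\<in>A. i \<le> r \<and> (\<Sum>j\<in>UNIV. m i j) \<ge> 2" "card A = card J + 1" "torus_separating m J A"
      using full[of J] by blast
    show ?thesis
      by (rule strict_by_count[where A = A and Q = Q and K = K and \<phi> = \<phi>]) (use A that in auto)
  qed
  show ?thesis
  proof (rule krull_dim_eq[where Z = Z])
    show "closedin (zariski r) (proj_closure r (Sec UNIV))" by (rule closedin_proj_closure)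
    have "hilbert_bound r (Sec UNIV) (2 * ?n + 1)"
      using hilbert_bound_Sec[of UNIV] by (simp add: mult_2)
    then show "hilbert_bound r (\<Union>(proj_closure r (Sec UNIV))) (2 * ?n + 1)" by (rule hilbert_bound_closure)
  next
    fix k assume "k \<le> 2 * ?n + 1"
    have "proj_closure r (Tor (I k)) \<subseteq> proj_closure r (Sec UNIV)"
      by (rule proj_closure_mono) (use Tor_subset_Sec in blast)
    moreover have "proj_closure r (Sec (I (k - ?n - 1))) \<subseteq> proj_closure r (Sec UNIV)"
      by (rule proj_closure_mono) (use Sec_mono[OF subset_UNIV] in blast)
    ultimately show "closedin (zariski r) (Z k) \<and> irreducible_in (zariski r) (Z k) \<and> Z k \<subseteq> proj_closure r (Sec UNIV)"
      unfolding Z_def using closedin_proj_closure irreducible_Tor irreducible_Sec by auto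
  next
    fix k assume k: "k < 2 * ?n + 1"
    consider "k < ?n" | "k = ?n" | "k > ?n" by linarith
    then show "Z k \<subset> Z (Suc k)"
    proof cases
      case 1
      then show ?thesis using Tor_strict[OF idx_notin[OF 1]] by (simp add: Z_def ISuc)
    next
      case 2
      have "proj_closure r (Tor UNIV) \<subset> proj_closure r (Sec {})"
        by (rule Sec_strict[OF Tor_subset_Sec Tor_nonempty _ boxpoly_tor_param Tor_parametrised]) auto
      then show ?thesis using 2 In by (simp add: Z_def I_def)
    next
      case 3
      define l where "l = k - ?n - 1"
      have l: "l < ?n" "Suc k - ?n - 1 = Suc l" using 3 k unfolding l_def by auto
      have "card (sec_indices (I l)) \<le> ?n + card (I (Suc l))"
        using l cardI[of l] cardI[of "Suc l"] by (simp add: card_sec_indices)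
      then have "proj_closure r (Sec (I l)) \<subset> proj_closure r (Sec (I (Suc l)))"
        by (intro Sec_strict[OF Sec_mono Sec_nonempty _ boxpoly_sec_param Sec_parametrised])
          (auto simp: ISuc sec_indices_def)
      then show ?thesis using 3 l unfolding Z_def l_def by simp
    qed
  qed
qed

end

subsection \<open>Edges at a vertex of a polytope\<close>

lemma face_rel_interior_exists:
  assumes P: "polytope P" and q: "q \<in> (P :: 'a::euclidean_space set)"
  obtains F where "F face_of P" "q \<in> rel_interior F"
proof -
  define \<F> where "\<F> = {F. F face_of P \<and> q \<in> F}"
  have "P \<in> \<F>" using P q by (simp add: \<F>_def face_of_refl polytope_imp_convex)
  moreover have "finite \<F>" unfolding \<F>_def using finite_polytope_faces[OF P] by (rule finite_subset[rotated]) blast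
  \<comment> \<open>A face of least dimension containing \<open>q\<close>: on its relative boundary,
    \<open>q\<close> would lie in a facet of smaller dimension.\<close>
  ultimately obtain F where F: "F \<in> \<F>" "\<And>G. G \<in> \<F> \<Longrightarrow> aff_dim F \<le> aff_dim G"
    using ex_min_if_finite[of "aff_dim ` \<F>"] by (metis arg_min_if_finite(1) arg_min_least empty_iff)
  have poly: "polytope F" using F(1) P unfolding \<F>_def by (auto intro: face_of_polytope_polytope)
  have "q \<in> rel_interior F"
  proof (rule ccontr)
    assume "q \<notin> rel_interior F"
    then have "q \<in> \<Union>{G. G facet_of F}"
      using rel_boundary_of_polyhedron[OF polytope_imp_polyhedron[OF poly]] F(1) unfolding \<F>_def by blast
    then obtain G where G: "G facet_of F" "q \<in> G" by blast
    then have "G \<in> \<F>" using F(1) unfolding \<F>_def facet_of_def by (auto intro: face_of_trans)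
    from F(2)[OF this] G(1) show False unfolding facet_of_def by simp
  qed
  then show ?thesis using that F(1) unfolding \<F>_def by blast
qed

text \<open>Let \<open>F\<close> be the face with \<open>q\<close> in its relative interior. If
  \<open>F\<close> had dimension at least 2, the slice would contain a segment around
  \<open>q\<close>. Some vertex of \<open>F\<close> satisfies \<open>a \<bullet> e \<ge> b\<close>,
  and only \<open>v\<close> does, so \<open>F\<close> is an edge through \<open>v\<close>.\<close>

lemma slice_vertex_on_edge:
  fixes P :: "'a::euclidean_space set"
  assumes P: "polytope P" and v: "v extreme_point_of P"
    and below: "a \<bullet> v > b" and above: "\<And>e. e extreme_point_of P \<Longrightarrow> e \<noteq> v \<Longrightarrow> a \<bullet> e < b"
    and q: "q extreme_point_of (P \<inter> {x. a \<bullet> x = b})"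
  obtains e where "e edge_of P" "v \<in> e" "q \<in> e"
proof -
  have qP: "q \<in> P" "a \<bullet> q = b" using q unfolding extreme_point_of_def by auto
  obtain F where F: "F face_of P" "q \<in> rel_interior F" using face_rel_interior_exists[OF P qP(1)] by blast
  have polyF: "polytope F" using F(1) P by (rule face_of_polytope_polytope[rotated])
  have qF: "q \<in> F" using F(2) rel_interior_subset by blast
  have "F \<subseteq> P" using F(1) by (rule face_of_imp_subset)
  have "\<not> aff_dim F \<ge> 2"
  proof
    assume dim: "aff_dim F \<ge> 2"
    have "aff_dim (affine hull F \<inter> {x. a \<bullet> x = b}) \<ge> 1"
      using dim qF qP(2) hull_inc[OF qF, of affine]
      by (auto simp: aff_dim_affine_Int_hyperplane aff_dim_affine_hull)
    then have "affine hull F \<inter> {x. a \<bullet> x = b} \<noteq> {q}" by auto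
    then obtain p where p: "p \<in> affine hull F" "a \<bullet> p = b" "p \<noteq> q"
      using qF qP(2) hull_inc[OF qF, of affine] by blast
    obtain \<epsilon> where \<epsilon>: "\<epsilon> > 0" "cball q \<epsilon> \<inter> affine hull F \<subseteq> F"
      using F(2) unfolding mem_rel_interior_cball by blast
    define t where "t = \<epsilon> / norm (p - q)"
    have t: "t > 0" using \<epsilon>(1) p(3) unfolding t_def by simp
    have mem: "q + s *\<^sub>R (p - q) \<in> P \<inter> {x. a \<bullet> x = b}" if "\<bar>s\<bar> = t" for s
    proof -
      have "norm (s *\<^sub>R (p - q)) = \<epsilon>" using that p(3) \<epsilon>(1) unfolding t_def by simp
      then have "q + s *\<^sub>R (p - q) \<in> cball q \<epsilon>" by (simp add: dist_norm)
      moreover have "q + s *\<^sub>R (p - q) \<in> affine hull F"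
      proof -
        have "(1 - s) *\<^sub>R q + s *\<^sub>R p \<in> affine hull F"
          by (rule mem_affine[OF affine_affine_hull hull_inc[OF qF] p(1)]) simp
        then show ?thesis by (simp add: algebra_simps)
      qed
      ultimately have "q + s *\<^sub>R (p - q) \<in> F" using \<epsilon>(2) by blast
      then show ?thesis using \<open>F \<subseteq> P\<close> p(2) qP(2) by (auto simp: inner_add_right inner_diff_right)
    qed
    have "q \<in> open_segment (q + (- t) *\<^sub>R (p - q)) (q + t *\<^sub>R (p - q))"
    proof -
      define d where "d = t *\<^sub>R (p - q)"
      have "d \<noteq> 0" using t p(3) unfolding d_def by simp
      have "q - d \<noteq> q + d"
      proof
        assume "q - d = q + d"
        then have "d + d = 0" by (simp add: algebra_simps)
        then have "2 *\<^sub>R d = 0" by (simp add: scaleR_2)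
        then show False using \<open>d \<noteq> 0\<close> by simp
      qed
      then have "midpoint (q - d) (q + d) \<in> open_segment (q - d) (q + d)" by simp
      moreover have "midpoint (q - d) (q + d) = q" by (simp add: midpoint_def scaleR_half_double)
      ultimately show ?thesis unfolding d_def by simp
    qed
    then show False using q mem[of t] mem[of "- t"] t unfolding extreme_point_of_def by (metis abs_minus_cancel abs_of_pos)
  qed
  have extF: "\<exists>e. e extreme_point_of F \<and> a \<bullet> e \<ge> b"
  proof (rule ccontr)
    assume "\<not> ?thesis"
    then have "{x. x extreme_point_of F} \<subseteq> {x. a \<bullet> x < b}" by auto
    then have "convex hull {x. x extreme_point_of F} \<subseteq> {x. a \<bullet> x < b}"
      by (intro hull_minimal convex_halfspace_lt)
    moreover have "F = convex hull {x. x extreme_point_of F}"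
      using polyF by (intro Krein_Milman_Minkowski polytope_imp_compact polytope_imp_convex)
    ultimately show False using qF qP(2) by auto
  qed
  then obtain e where e: "e extreme_point_of F" "a \<bullet> e \<ge> b" by blast
  have "e = v" using above[of e] e extreme_point_of_face[OF F(1)] by force
  then have vF: "v \<in> F" using e(1) unfolding extreme_point_of_def by blast
  have "aff_dim F \<noteq> 0"
  proof
    assume "aff_dim F = 0"
    then have "q = v" using qF vF aff_dim_eq_0 by (metis singletonD)
    then show False using qP(2) below by simp
  qed
  moreover have "aff_dim F \<noteq> -1" using qF aff_dim_empty[of F] by auto
  ultimately have "F edge_of P"
    using F(1) \<open>\<not> aff_dim F \<ge> 2\<close> aff_dim_geq[of F] unfolding edge_of_def by linarith
  then show ?thesis using that vF qF by blast
qed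

text \<open>Vertex figure: a hyperplane separating \<open>v\<close> from the other vertices cuts
  \<open>P\<close> in a polytope whose vertices lie on edges through \<open>v\<close>, so the slice
  lies in the translated cone. The segment from \<open>v\<close> to any other vertex crosses the
  slice.\<close>

lemma polytope_in_edge_cone:
  fixes P :: "'a::euclidean_space set"
  assumes P: "polytope P" and v: "v extreme_point_of P"
    and K: "convex K" "\<And>s x. s \<ge> 0 \<Longrightarrow> x \<in> K \<Longrightarrow> s *\<^sub>R x \<in> K" "0 \<in> K"
    and edges: "\<And>e x. e edge_of P \<Longrightarrow> v \<in> e \<Longrightarrow> x \<in> e \<Longrightarrow> x - v \<in> K"
    and x: "x \<in> P"
  shows "x - v \<in> K"
proof -
  have conv: "convex P" and comp: "compact P" using P by (auto intro: polytope_imp_convex polytope_imp_compact)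
  have "{v} exposed_face_of P"
    using exposed_face_of_polyhedron[OF polytope_imp_polyhedron[OF P]] v by (simp add: face_of_singleton)
  then obtain a b where ab: "P \<subseteq> {x. a \<bullet> x \<le> b}" "{v} = P \<inter> {x. a \<bullet> x = b}"
    unfolding exposed_face_of_def by blast
  define E where "E = {e. e extreme_point_of P} - {v}"
  have finE: "finite E"
    unfolding E_def using finite_polyhedron_extreme_points[OF polytope_imp_polyhedron[OF P]] by simp
  have Elt: "a \<bullet> e < b" if "e \<in> E" for e
  proof -
    have "e \<in> P" "e \<noteq> v" using that unfolding E_def extreme_point_of_def by auto
    then show ?thesis using ab by force
  qed
  obtain b' where b': "b' < b" "\<And>e. e \<in> E \<Longrightarrow> a \<bullet> e < b'"
  proof (cases "E = {}")
    case True
    then show ?thesis using that[of "b - 1"] by auto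
  next
    case False
    define M where "M = Max ((\<bullet>) a ` E)"
    have "M \<in> (\<bullet>) a ` E" unfolding M_def using False finE by (intro Max_in) auto
    then have "M < b" using Elt by auto
    moreover have "a \<bullet> e \<le> M" if "e \<in> E" for e unfolding M_def using finE that by simp
    ultimately show ?thesis using that[of "(M + b) / 2"] by (force simp: field_simps)
  qed
  have avb: "a \<bullet> v = b" using ab(2) by blast
  have vK: "convex ((+) v ` K)" using K(1) by (rule convex_translation)
  have memK: "y - v \<in> K \<longleftrightarrow> y \<in> (+) v ` K" for y
    by (metis (no_types, lifting) add.commute diff_add_cancel image_iff add_diff_cancel_left')
  define Q where "Q = P \<inter> {x. a \<bullet> x = b'}"
  have "polytope Q" unfolding Q_def by (intro polytope_Int_polyhedron P polyhedron_hyperplane)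
  then have QKM: "Q = convex hull {x. x extreme_point_of Q}"
    by (intro Krein_Milman_Minkowski polytope_imp_compact polytope_imp_convex)
  have "{x. x extreme_point_of Q} \<subseteq> (+) v ` K"
  proof
    fix q assume "q \<in> {x. x extreme_point_of Q}"
    then have q: "q extreme_point_of (P \<inter> {x. a \<bullet> x = b'})" unfolding Q_def by simp
    obtain e where "e edge_of P" "v \<in> e" "q \<in> e"
      by (rule slice_vertex_on_edge[OF P v _ _ q]) (use b' avb in \<open>auto simp: E_def\<close>)
    from edges[OF this] show "q \<in> (+) v ` K" using memK by simp
  qed
  then have QK: "Q \<subseteq> (+) v ` K" using QKM hull_minimal[of "{x. x extreme_point_of Q}" "(+) v ` K" convex] vK by auto
  have ext: "e - v \<in> K" if "e extreme_point_of P" for e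
  proof (cases "e = v")
    case True
    then show ?thesis using K(3) by simp
  next
    case False
    then have "e \<in> E" using that unfolding E_def by blast
    then have lt: "a \<bullet> e < b'" using b'(2) by blast
    define s where "s = (b - b') / (b - a \<bullet> e)"
    have s: "0 < s" "s \<le> 1" unfolding s_def using lt b'(1) by (auto simp: field_simps)
    define z where "z = v + s *\<^sub>R (e - v)"
    have "z = (1 - s) *\<^sub>R v + s *\<^sub>R e" unfolding z_def by (simp add: algebra_simps)
    then have "z \<in> P"
      using convexD[OF conv, of v e "1 - s" s] v that s unfolding extreme_point_of_def by auto
    moreover have "a \<bullet> z = b'"
    proof -
      have "s * (b - a \<bullet> e) = b - b'" unfolding s_def using lt b'(1) by simp
      then show ?thesis unfolding z_def using avb
        by (simp add: inner_add_right inner_diff_right algebra_simps)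
    qed
    ultimately have "z - v \<in> K" using QK memK unfolding Q_def by blast
    then have "(1 / s) *\<^sub>R (z - v) \<in> K" using K(2)[of "1 / s"] s by simp
    then show ?thesis unfolding z_def using s by simp
  qed
  have "P = convex hull {x. x extreme_point_of P}"
    by (intro Krein_Milman_Minkowski comp conv)
  moreover have "convex hull {x. x extreme_point_of P} \<subseteq> (+) v ` K"
    using ext memK by (intro hull_minimal vK) auto
  ultimately show ?thesis using x memK by blast
qed

lemma edge_is_segment:
  assumes P: "polytope P" and e: "e edge_of P" "v \<in> e" and v: "v extreme_point_of (P :: 'a::euclidean_space set)"
  obtains v' where "v' \<noteq> v" "e = closed_segment v v'" "v' extreme_point_of P"
proof -
  have face: "e face_of P" "aff_dim e = 1" using e(1) unfolding edge_of_def by auto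
  have poly: "polytope e" using face(1) P by (rule face_of_polytope_polytope[rotated])
  have "collinear e" using face(2) collinear_aff_dim by fastforce
  moreover have "e \<noteq> {}" using e(2) by blast
  ultimately obtain a b where ab: "e = closed_segment a b"
    using compact_convex_collinear_segment[of e] poly by (metis polytope_imp_compact polytope_imp_convex)
  have "a \<noteq> b" using face(2) ab by auto
  have vext: "v extreme_point_of e" using extreme_point_of_face[OF face(1)] v e(2) by blast
  then have "v = a \<or> v = b" unfolding ab extreme_point_of_segment .
  moreover have "a extreme_point_of P" "b extreme_point_of P"
    using extreme_point_of_face[OF face(1)] extreme_point_of_segment[of _ a b] ab by blast+
  ultimately show ?thesis
    using that[of b] that[of a] ab \<open>a \<noteq> b\<close> closed_segment_commute by metis
qed

lemma edge_unique:
  assumes "convex P" "e edge_of P" "e' edge_of P" "x \<in> e \<inter> e'" "y \<in> e \<inter> e'" "x \<noteq> (y :: 'a::euclidean_space)"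
  shows "e = e'"
proof -
  have sub: "e \<inter> e' = e" if "e edge_of P" "e' edge_of P" "x \<in> e \<inter> e'" "y \<in> e \<inter> e'" for e e'
  proof (rule ccontr)
    assume neq: "e \<inter> e' \<noteq> e"
    have f: "e face_of P" "e' face_of P" "aff_dim e = 1" using that unfolding edge_of_def by auto
    have "e \<inter> e' face_of e" using face_of_Int[OF f(1,2)] face_of_face[OF f(1)] by auto
    then have "aff_dim (e \<inter> e') < 1"
      using face_of_aff_dim_lt[of e "e \<inter> e'"] neq f face_of_imp_convex[OF f(1)] by auto
    moreover have "aff_dim {x, y} \<le> aff_dim (e \<inter> e')" using that by (intro aff_dim_subset) auto
    moreover have "aff_dim {x, y} = 1" using assms(6) by (simp add: aff_dim_2)
    ultimately show False by simp
  qed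
  show ?thesis using sub[OF assms(2-5)] sub[of e' e] assms by (metis Int_commute)
qed

subsection \<open>Lattice bases\<close>

lemma axis_in_lattice: "axis i 1 \<in> int_lattice"
  unfolding int_lattice_def by (simp add: axis_def)

text \<open>The integer coefficients of the unit vectors, extended linearly, give real coordinates
  that are integral on the lattice. Duality comes from uniqueness of integral expansions.\<close>

lemma lattice_basis_dual:
  fixes B :: "(real ^ 'n) set"
  assumes "lattice_basis B"
  obtains l :: "real ^ 'n \<Rightarrow> real ^ 'n \<Rightarrow> real" where "\<forall>b. linear (l b)" "\<forall>b\<in>B. \<forall>b'\<in>B. l b b' = (if b = b' then 1 else 0)"
    "\<forall>x. x = (\<Sum>b\<in>B. l b x *\<^sub>R b)" "\<forall>b. \<forall>x\<in>int_lattice. l b x \<in> \<int>"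
proof -
  have B: "finite B" "B \<subseteq> int_lattice" using assms unfolding lattice_basis_def by auto
  have ex: "\<exists>!c :: real ^ 'n \<Rightarrow> int. (\<forall>b. b \<notin> B \<longrightarrow> c b = 0) \<and> v = (\<Sum>b\<in>B. of_int (c b) *\<^sub>R b)"
    if "v \<in> int_lattice" for v using assms that unfolding lattice_basis_def by blast
  have "\<forall>i. \<exists>c :: real ^ 'n \<Rightarrow> int. (\<forall>b. b \<notin> B \<longrightarrow> c b = 0) \<and> axis i 1 = (\<Sum>b\<in>B. of_int (c b) *\<^sub>R b)"
    using ex[OF axis_in_lattice] by blast
  from choice[OF this] obtain c :: "'n \<Rightarrow> real ^ 'n \<Rightarrow> int"
    where c: "\<And>i b. b \<notin> B \<Longrightarrow> c i b = 0" "\<And>i. axis i 1 = (\<Sum>b\<in>B. of_int (c i b) *\<^sub>R b)" by blast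
  define l where "l b x = (\<Sum>i\<in>UNIV. x $ i * of_int (c i b))" for b and x :: "real ^ 'n"
  have lin: "linear (l b)" for b
    unfolding l_def
    by (rule linearI) (simp_all add: sum.distrib algebra_simps sum_distrib_left)
  have rep: "x = (\<Sum>b\<in>B. l b x *\<^sub>R b)" for x
  proof -
    have "x = (\<Sum>i\<in>UNIV. x $ i *\<^sub>R axis i 1)"
      using basis_expansion[of x] by (simp add: scalar_mult_eq_scaleR)
    also have "\<dots> = (\<Sum>i\<in>UNIV. \<Sum>b\<in>B. (x $ i * of_int (c i b)) *\<^sub>R b)"
      by (intro sum.cong refl) (simp add: c(2) scaleR_sum_right)
    also have "\<dots> = (\<Sum>b\<in>B. l b x *\<^sub>R b)"
      unfolding l_def scaleR_sum_left by (rule sum.swap)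
    finally show ?thesis .
  qed
  have int: "l b x \<in> \<int>" if "x \<in> int_lattice" for b x
    using that unfolding l_def int_lattice_def by (intro Ints_sum Ints_mult) auto
  have "l b b' = (if b = b' then 1 else 0)" if b: "b \<in> B" "b' \<in> B" for b b'
  proof -
    have lat: "b' \<in> int_lattice" using b(2) B(2) by blast
    \<comment> \<open>Two integral expansions of \<open>b'\<close> are compared; the floor is exact
      because the coordinates \<open>l b b'\<close> are integers.\<close>
    define d1 where "d1 b = (if b \<in> B then \<lfloor>l b b'\<rfloor> else 0)" for b
    define d2 where "d2 b = (if b = b' then 1 else 0 :: int)" for b
    have d1: "of_int (d1 b) = l b b'" if "b \<in> B" for b
      using int[OF lat, of b] that unfolding d1_def by (auto simp: Ints_def)
    have "(\<Sum>b\<in>B. of_int (d1 b) *\<^sub>R b) = (\<Sum>b\<in>B. l b b' *\<^sub>R b)"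
      by (intro sum.cong refl) (simp add: d1)
    also have "\<dots> = b'" using rep[of b'] by (rule sym)
    finally have "(\<forall>b. b \<notin> B \<longrightarrow> d1 b = 0) \<and> b' = (\<Sum>b\<in>B. of_int (d1 b) *\<^sub>R b)"
      by (simp add: d1_def)
    moreover have "(\<forall>b. b \<notin> B \<longrightarrow> d2 b = 0) \<and> b' = (\<Sum>b\<in>B. of_int (d2 b) *\<^sub>R b)"
    proof -
      have "(\<Sum>b\<in>B. of_int (d2 b) *\<^sub>R b) = (\<Sum>b\<in>B. if b = b' then b else 0)"
        unfolding d2_def by (intro sum.cong) auto
      then show ?thesis using b(2) B(1) by (auto simp: d2_def)
    qed
    ultimately have "d1 = d2" using ex[OF lat] by blast
    then show ?thesis using d1[OF b(1)] by (simp add: d2_def split: if_splits)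
  qed
  with lin rep int show ?thesis by (intro that[of l]) simp_all
qed

lemma lattice_basis_card:
  assumes "lattice_basis (B :: (real ^ 'n) set)"
  shows "card B \<le> CARD('n)"
proof -
  obtain l :: "real ^ 'n \<Rightarrow> real ^ 'n \<Rightarrow> real" where l': "\<forall>b. linear (l b)" "\<forall>b\<in>B. \<forall>b'\<in>B. l b b' = (if b = b' then 1 else 0)"
    by (rule lattice_basis_dual[OF assms])
  have l: "linear (l b)" "b \<in> B \<Longrightarrow> b' \<in> B \<Longrightarrow> l b b' = (if b = b' then 1 else 0)" for b b'
    using l' by simp_all
  have fin: "finite B" using assms unfolding lattice_basis_def by blast
  have "u b = 0" if u: "(\<Sum>b\<in>B. u b *\<^sub>R b) = 0" and b: "b \<in> B" for u b
  proof -
    have "0 = l b (\<Sum>b\<in>B. u b *\<^sub>R b)" unfolding u using linear_0[OF l(1)] by simp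
    also have "\<dots> = (\<Sum>b'\<in>B. u b' * l b b')"
      by (simp add: linear_sum[OF l(1)] linear_scale[OF l(1)])
    also have "\<dots> = (\<Sum>b'\<in>B. if b' = b then u b' else 0)"
      using l(2) b by (intro sum.cong) auto
    also have "\<dots> = u b" using b fin by simp
    finally show ?thesis by simp
  qed
  then have "independent B" unfolding independent_explicit using fin by blast
  then have "card B \<le> dim (UNIV :: (real ^ 'n) set)" by (intro independent_card_le_dim) auto
  then show ?thesis by simp
qed

subsection \<open>Corners\<close>

text \<open>The edge vectors are indexed by the coordinate type itself, so that coordinates with
  respect to them live again in \<open>real ^ 'n\<close>.\<close>

definition corner :: "(real ^ 'n) set \<Rightarrow> real ^ 'n \<Rightarrow> ('n \<Rightarrow> real ^ 'n) \<Rightarrow> bool" where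
  "corner P v W \<longleftrightarrow> v extreme_point_of P \<and> inj W \<and> range W = first_lattice_vectors P v \<and>
     lattice_basis (range W) \<and> (\<forall>x\<in>P. \<exists>y. (\<forall>i. 0 \<le> y i) \<and> x = v + (\<Sum>i\<in>UNIV. y i *\<^sub>R W i))"

lemma lattice_polytope_extreme:
  assumes "lattice_polytope P" "v extreme_point_of P"
  shows "v \<in> int_lattice"
  using assms extreme_point_of_convex_hull unfolding lattice_polytope_def by blast

lemma lattice_polytope_polytope: "lattice_polytope P \<Longrightarrow> polytope P"
  unfolding lattice_polytope_def polytope_def by blast

lemma int_lattice_add: "x \<in> int_lattice \<Longrightarrow> y \<in> int_lattice \<Longrightarrow> x + y \<in> int_lattice"
  and int_lattice_diff: "x \<in> int_lattice \<Longrightarrow> y \<in> int_lattice \<Longrightarrow> x - y \<in> int_lattice"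
  and int_lattice_scale: "c \<in> \<int> \<Longrightarrow> x \<in> int_lattice \<Longrightarrow> c *\<^sub>R x \<in> int_lattice"
  unfolding int_lattice_def by auto

lemma int_lattice_sum: "(\<And>i. i \<in> I \<Longrightarrow> f i \<in> int_lattice) \<Longrightarrow> sum f I \<in> int_lattice"
  unfolding int_lattice_def by (auto intro: Ints_sum)

lemma first_lattice_vector_exists:
  assumes P: "lattice_polytope P" and fin: "finite (P \<inter> int_lattice)"
    and v: "v extreme_point_of P" and e: "e edge_of P" "v \<in> e"
  shows "\<exists>w\<in>first_lattice_vectors P v. v + w \<in> e"
proof -
  obtain v' where v': "v' \<noteq> v" "e = closed_segment v v'" "v' extreme_point_of P"
    by (rule edge_is_segment[OF lattice_polytope_polytope[OF P] e v])
  define S where "S = e \<inter> int_lattice - {v}"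
  have "v' \<in> S" using v' lattice_polytope_extreme[OF P v'(3)] unfolding S_def by auto
  moreover have "e \<subseteq> P" using e(1) by (rule edge_of_imp_subset)
  then have "finite S" unfolding S_def by (intro finite_subset[OF _ fin]) auto
  ultimately obtain p where p: "p \<in> S" "\<And>p'. p' \<in> S \<Longrightarrow> dist v p \<le> dist v p'"
    by (metis arg_min_if_finite(1) arg_min_least empty_iff)
  have "open_segment v p \<inter> int_lattice = {}"
  proof (rule ccontr)
    assume "\<not> ?thesis"
    then obtain z where z: "z \<in> open_segment v p" "z \<in> int_lattice" by blast
    have "closed_segment v p \<subseteq> e"
      unfolding v'(2) using p(1) by (intro subset_closed_segment[THEN iffD2]) (auto simp: S_def v'(2))
    then have "z \<in> S" using z unfolding S_def open_segment_def by auto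
    moreover have "dist v z < dist v p"
      using dist_in_open_segment[OF z(1)] by (simp add: dist_commute)
    ultimately show False using p(2) by force
  qed
  then have "p - v \<in> first_lattice_vectors P v"
    unfolding first_lattice_vectors_def using e p(1) by (auto simp: S_def intro!: exI[of _ e])
  then show ?thesis using p(1) by (intro bexI[of _ "p - v"]) (auto simp: S_def)
qed

lemma corner_exists:
  fixes P :: "(real ^ 'n) set"
  assumes smooth: "smooth_polytope P" and dim: "aff_dim P = int CARD('n)"
    and fin: "finite (P \<inter> int_lattice)" and v: "v extreme_point_of P"
  obtains W where "corner P v W"
proof -
  have lat: "lattice_polytope P" using smooth unfolding smooth_polytope_def by blast
  have P: "polytope P" using lat by (rule lattice_polytope_polytope)
  define Es where "Es = {e. e edge_of P \<and> v \<in> e}"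
  have "int (card Es) = int CARD('n)"
    using smooth v dim unfolding smooth_polytope_def Es_def by metis
  then have cardE: "card Es = CARD('n)" by simp
  obtain B where B: "lattice_basis B" "first_lattice_vectors P v \<subseteq> B"
    using smooth v unfolding smooth_polytope_def by blast
  have finB: "finite B" using B(1) unfolding lattice_basis_def by blast
  have "\<forall>e\<in>Es. \<exists>w. w \<in> first_lattice_vectors P v \<and> v + w \<in> e"
    using first_lattice_vector_exists[OF lat fin v] unfolding Es_def by blast
  from bchoice[OF this] obtain \<omega> where \<omega>: "\<And>e. e \<in> Es \<Longrightarrow> \<omega> e \<in> first_lattice_vectors P v"
    "\<And>e. e \<in> Es \<Longrightarrow> v + \<omega> e \<in> e" by blast
  have nz: "w \<noteq> 0" if "w \<in> first_lattice_vectors P v" for w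
    using that unfolding first_lattice_vectors_def by blast
  have inj: "inj_on \<omega> Es"
  proof (rule inj_onI)
    fix e e' assume e: "e \<in> Es" "e' \<in> Es" "\<omega> e = \<omega> e'"
    have "v + \<omega> e \<in> e \<inter> e'" using \<omega>(2)[OF e(1)] \<omega>(2)[OF e(2)] e(3) by simp
    then show "e = e'"
      by (intro edge_unique[where P = P and x = v and y = "v + \<omega> e"])
        (use e(1,2) nz[OF \<omega>(1)[OF e(1)]] P in \<open>auto simp: Es_def polytope_imp_convex\<close>)
  qed
  have sub: "\<omega> ` Es \<subseteq> B" using \<omega>(1) B(2) by blast
  \<comment> \<open>There are \<open>CARD('n)\<close> edges with distinct first vectors, and a
    lattice basis has at most that many elements, so these vectors exhaust the basis.\<close>
  have "card (\<omega> ` Es) = CARD('n)" using card_image[OF inj] cardE by simp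
  then have img: "\<omega> ` Es = B"
    using lattice_basis_card[OF B(1)] card_seteq[OF finB sub] by simp
  then have flv: "first_lattice_vectors P v = B" using B(2) \<omega>(1) by blast
  have cardB: "card B = CARD('n)" using img \<open>card (\<omega> ` Es) = _\<close> by simp
  obtain W where W: "bij_betw W (UNIV :: 'n set) B"
    using finite_same_card_bij[of "UNIV :: 'n set" B] finB cardB by auto
  have injW: "inj W" and rangeW: "range W = B" using W by (auto simp: bij_betw_def)
  define K where "K = {x. \<exists>y. (\<forall>i. 0 \<le> y i) \<and> x = (\<Sum>i\<in>UNIV. y i *\<^sub>R W i)}"
  have KI: "(\<Sum>i\<in>UNIV. y i *\<^sub>R W i) \<in> K" if "\<forall>i. 0 \<le> y i" for y
    unfolding K_def by (intro CollectI exI[of _ y] conjI that refl)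
  have KD: "\<exists>y. (\<forall>i. 0 \<le> y i) \<and> x = (\<Sum>i\<in>UNIV. y i *\<^sub>R W i)" if "x \<in> K" for x
    using that unfolding K_def by (rule CollectD)
  have Kadd: "x + x' \<in> K" if x: "x \<in> K" and x': "x' \<in> K" for x x'
  proof -
    obtain y where y: "\<forall>i. 0 \<le> y i" "x = (\<Sum>i\<in>UNIV. y i *\<^sub>R W i)" using KD[OF x] by (elim exE conjE)
    obtain y' where y': "\<forall>i. 0 \<le> y' i" "x' = (\<Sum>i\<in>UNIV. y' i *\<^sub>R W i)" using KD[OF x'] by (elim exE conjE)
    have "(\<Sum>i\<in>UNIV. (y i + y' i) *\<^sub>R W i) \<in> K" using y(1) y'(1) by (intro KI) simp
    then show ?thesis unfolding y(2) y'(2) by (simp add: scaleR_add_left sum.distrib)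
  qed
  have Kscale: "s *\<^sub>R x \<in> K" if s: "s \<ge> 0" and x: "x \<in> K" for s x
  proof -
    obtain y where y: "\<forall>i. 0 \<le> y i" "x = (\<Sum>i\<in>UNIV. y i *\<^sub>R W i)" using KD[OF x] by (elim exE conjE)
    have "(\<Sum>i\<in>UNIV. (s * y i) *\<^sub>R W i) \<in> K" using y(1) s by (intro KI) simp
    then show ?thesis unfolding y(2) by (simp add: scaleR_sum_right)
  qed
  have K0: "0 \<in> K" using KI[of "\<lambda>_. 0"] by simp
  have convK: "convex K" unfolding convex_def using Kadd Kscale by simp
  have WK: "W i \<in> K" for i
  proof -
    have "(\<Sum>j\<in>UNIV. (if j = i then 1 else 0) *\<^sub>R W j) = (\<Sum>j\<in>UNIV. if j = i then W j else 0)"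
      by (intro sum.cong) auto
    then show ?thesis using KI[of "\<lambda>j. if j = i then 1 else 0"] by simp
  qed
  have edgeK: "x - v \<in> K" if e: "e edge_of P" "v \<in> e" "x \<in> e" for e x
  proof -
    have eE: "e \<in> Es" using e unfolding Es_def by blast
    obtain v' where v': "v' \<noteq> v" "e = closed_segment v v'"
      by (rule edge_is_segment[OF P e(1,2) v])
    obtain s where s: "0 \<le> s" "s \<le> 1" "x = (1 - s) *\<^sub>R v + s *\<^sub>R v'"
      using e(3) unfolding v'(2) in_segment by blast
    obtain t where t: "0 \<le> t" "t \<le> 1" "v + \<omega> e = (1 - t) *\<^sub>R v + t *\<^sub>R v'"
      using \<omega>(2)[OF eE] unfolding v'(2) in_segment by blast
    have \<omega>e: "\<omega> e = t *\<^sub>R (v' - v)" using t(3) by (simp add: algebra_simps)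
    have "t \<noteq> 0" using nz[OF \<omega>(1)[OF eE]] unfolding \<omega>e by auto
    have "x - v = (s / t) *\<^sub>R \<omega> e" unfolding \<omega>e s(3) using \<open>t \<noteq> 0\<close> by (simp add: algebra_simps)
    moreover have "\<omega> e \<in> range W" unfolding rangeW img[symmetric] using eE by (rule imageI)
    then have "\<omega> e \<in> K" using WK by auto
    ultimately show ?thesis using Kscale[of "s / t" "\<omega> e"] s(1) t(1) by simp
  qed
  have "\<exists>y. (\<forall>i. 0 \<le> y i) \<and> x = v + (\<Sum>i\<in>UNIV. y i *\<^sub>R W i)" if "x \<in> P" for x
  proof -
    have "x - v \<in> K" by (rule polytope_in_edge_cone[OF P v convK Kscale K0 edgeK that])
    from KD[OF this] obtain y where y: "\<forall>i. 0 \<le> y i" "x - v = (\<Sum>i\<in>UNIV. y i *\<^sub>R W i)"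
      by (elim exE conjE)
    have "x = v + (x - v)" by simp
    then show ?thesis unfolding y(2) using y(1) by blast
  qed
  then have "corner P v W" unfolding corner_def using v injW rangeW flv B(1) by simp
  then show ?thesis by (rule that)
qed

lemma corner_dual:
  fixes W :: "'n \<Rightarrow> real ^ 'n"
  assumes "corner P v W"
  obtains l :: "'n \<Rightarrow> real ^ 'n \<Rightarrow> real" where "\<forall>j. linear (l j)"
    "\<forall>j k. l j (W k) = (if j = k then 1 else 0)"
    "\<forall>x. x = (\<Sum>j\<in>UNIV. l j x *\<^sub>R W j)" "\<forall>j. \<forall>x\<in>int_lattice. l j x \<in> \<int>"
proof -
  have W: "inj W" "lattice_basis (range W)" using assms unfolding corner_def by auto
  obtain l where l: "\<forall>b. linear (l b)" "\<forall>b\<in>range W. \<forall>b'\<in>range W. l b b' = (if b = b' then 1 else 0)"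
    "\<forall>x. x = (\<Sum>b\<in>range W. l b x *\<^sub>R b)" "\<forall>b. \<forall>x\<in>int_lattice. l b x \<in> \<int>"
    by (rule lattice_basis_dual[OF W(2)])
  have "x = (\<Sum>j\<in>UNIV. l (W j) x *\<^sub>R W j)" for x
    by (rule trans[OF l(3)[rule_format]]) (simp add: sum.reindex[OF W(1)])
  then show ?thesis
    using l(1,2,4) W(1) by (intro that[of "\<lambda>j. l (W j)"]) (auto simp: inj_eq)
qed

lemma corner_coeff_unique:
  assumes "corner P v W" "(\<Sum>j\<in>UNIV. y j *\<^sub>R W j) = (\<Sum>j\<in>UNIV. z j *\<^sub>R W j)"
  shows "y = z"
proof
  fix k
  obtain l where l: "\<forall>j. linear (l j)" "\<forall>j k. l j (W k) = (if j = k then 1 else 0)"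
    "\<forall>x. x = (\<Sum>j\<in>UNIV. l j x *\<^sub>R W j)" "\<forall>j. \<forall>x\<in>int_lattice. l j x \<in> \<int>"
    by (rule corner_dual[OF assms(1)])
  have "l k (\<Sum>j\<in>UNIV. u j *\<^sub>R W j) = u k" for u
    using l(1,2) by (simp add: linear_sum linear_scale if_distrib[of "\<lambda>x. _ * x"] cong: if_cong)
  then show "y k = z k" using assms(2) by metis
qed

lemma corner_nonneg:
  assumes "corner P v W" "v + (\<Sum>j\<in>UNIV. y j *\<^sub>R W j) \<in> P"
  shows "0 \<le> y i"
proof -
  have "\<forall>x\<in>P. \<exists>y. (\<forall>i. 0 \<le> y i) \<and> x = v + (\<Sum>i\<in>UNIV. y i *\<^sub>R W i)"
    using assms(1) unfolding corner_def by (elim conjE)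
  from bspec[OF this assms(2)]
  obtain z where z: "\<forall>i. 0 \<le> z i" "v + (\<Sum>j\<in>UNIV. y j *\<^sub>R W j) = v + (\<Sum>j\<in>UNIV. z j *\<^sub>R W j)"
    by (elim exE conjE)
  then have "y = z" using corner_coeff_unique[OF assms(1)] by simp
  then show ?thesis using z(1) by simp
qed

lemma corner_lattice:
  assumes "corner P v W"
  shows "W i \<in> int_lattice" "v + W i \<in> P" "v \<in> P"
proof -
  show "W i \<in> int_lattice" using assms unfolding corner_def lattice_basis_def by blast
  have "W i \<in> first_lattice_vectors P v" using assms unfolding corner_def by blast
  then show "v + W i \<in> P" unfolding first_lattice_vectors_def using edge_of_imp_subset by blast
  show "v \<in> P" using assms unfolding corner_def extreme_point_of_def by blast
qed

text \<open>Edge vectors at the far end of the edge in direction \<open>W i\<close>: that edge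
  reversed and, for every other \<open>j\<close>, the second edge of the two-dimensional face
  spanned by \<open>W i\<close> and \<open>W j\<close>, which agrees with \<open>W j\<close> up to a
  multiple of \<open>W i\<close>.\<close>

definition corner_step :: "('n \<Rightarrow> real ^ 'n) \<Rightarrow> 'n \<Rightarrow> ('n \<Rightarrow> int) \<Rightarrow> 'n \<Rightarrow> real ^ 'n" where
  "corner_step W i c j = (if j = i then - W i else W j + of_int (c j) *\<^sub>R W i)"

lemma nonneg_Ints_sum_eq_1:
  fixes f :: "'k::finite \<Rightarrow> real"
  assumes "\<And>k. f k \<in> \<int>" "\<And>k. 0 \<le> f k" "(\<Sum>k\<in>UNIV. f k) = 1"
  obtains k where "f k = 1"
proof -
  obtain k where k: "f k \<noteq> 0" using assms(3) by (metis sum.neutral zero_neq_one)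
  have "f k \<ge> 1" using assms(1,2)[of k] k by (metis Ints_nonzero_abs_ge1 abs_of_nonneg)
  moreover have "f k \<le> 1" using member_le_sum[of k UNIV f] assms(2,3) by simp
  ultimately show ?thesis using that[of k] by simp
qed

text \<open>Modulo \<open>W i\<close> the edge vectors at either end are nonnegative integer
  combinations of those at the other end. A nonnegative integer matrix with such an inverse is a
  permutation matrix, so the two sets of edge vectors match up.\<close>

lemma corner_stepE:
  fixes P :: "(real ^ 'n) set"
  assumes smooth: "smooth_polytope P" and dim: "aff_dim P = int CARD('n)"
    and fin: "finite (P \<inter> int_lattice)" and corner: "corner P v W"
  obtains a :: nat and c where "a \<ge> 1" "corner P (v + real a *\<^sub>R W i) (corner_step W i c)"
proof -
  have lat: "lattice_polytope P" using smooth unfolding smooth_polytope_def by blast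
  have P: "polytope P" using lat by (rule lattice_polytope_polytope)
  have v: "v extreme_point_of P" using corner unfolding corner_def by blast
  obtain l where l: "\<forall>j. linear (l j)" "\<forall>j k. l j (W k) = (if j = k then 1 else 0)"
    "\<forall>x. x = (\<Sum>j\<in>UNIV. l j x *\<^sub>R W j)" "\<forall>j. \<forall>x\<in>int_lattice. l j x \<in> \<int>"
    by (rule corner_dual[OF corner])
  have lW: "l j (W k) = (if j = k then 1 else 0)" for j k using l(2) by simp
  have lscale: "l j (s *\<^sub>R x) = s * l j x" and ladd: "l j (x + y) = l j x + l j y"
    and ldiff: "l j (x - y) = l j x - l j y" and lsum: "l j (sum g UNIV) = (\<Sum>k\<in>UNIV. l j (g k))"
    for j s x y and g :: "'n \<Rightarrow> _"
    using l(1) by (simp_all add: linear_scale linear_add linear_diff linear_sum)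
  have "W i \<in> first_lattice_vectors P v" using corner unfolding corner_def by blast
  then obtain e where e: "e edge_of P" "v \<in> e" "W i \<noteq> 0" "v + W i \<in> e"
    unfolding first_lattice_vectors_def by blast
  obtain v' where v': "v' \<noteq> v" "e = closed_segment v v'" "v' extreme_point_of P"
    by (rule edge_is_segment[OF P e(1,2) v])
  obtain s where s: "0 \<le> s" "s \<le> 1" "v + W i = (1 - s) *\<^sub>R v + s *\<^sub>R v'"
    using e(4) unfolding v'(2) in_segment by blast
  have sW: "W i = s *\<^sub>R (v' - v)" using s(3) by (simp add: algebra_simps)
  then have s0: "s > 0" using e(3) s(1) by (cases "s = 0") auto
  \<comment> \<open>The lattice length of the edge; it is an integer because both ends are lattice
    points and \<open>l i\<close> is integral.\<close>
  define \<alpha> where "\<alpha> = 1 / s"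
  have \<alpha>: "\<alpha> \<ge> 1" "v' = v + \<alpha> *\<^sub>R W i" unfolding \<alpha>_def sW using s0 s(2) by auto
  have v'lat: "v' \<in> int_lattice" and vlat: "v \<in> int_lattice"
    using lattice_polytope_extreme[OF lat] v v'(3) by auto
  have "\<alpha> = l i (v' - v)" unfolding \<alpha>(2) by (simp add: lscale lW)
  then have "\<alpha> \<in> \<int>" using l(4) int_lattice_diff[OF v'lat vlat] by simp
  then obtain \<alpha>' :: int where "\<alpha> = of_int \<alpha>'" by (rule Ints_cases)
  then have a: "\<alpha> = real (nat \<alpha>')" using \<alpha>(1) by simp
  define a where "a = nat \<alpha>'"
  obtain W0 where W0: "corner P v' W0" by (rule corner_exists[OF smooth dim fin v'(3)])
  obtain l0 where l0: "\<forall>j. linear (l0 j)" "\<forall>j k. l0 j (W0 k) = (if j = k then 1 else 0)"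
    "\<forall>x. x = (\<Sum>j\<in>UNIV. l0 j x *\<^sub>R W0 j)" "\<forall>j. \<forall>x\<in>int_lattice. l0 j x \<in> \<int>"
    by (rule corner_dual[OF W0])
  have "- W i \<in> first_lattice_vectors P v'"
  proof -
    have "v' - W i = (1 - s) *\<^sub>R v' + s *\<^sub>R v" unfolding sW by (simp add: algebra_simps)
    then have "v' - W i \<in> closed_segment v' v" unfolding in_segment using s(1,2) by (intro exI[of _ s]) auto
    then have "v' + - W i \<in> e" unfolding v'(2) by (simp add: closed_segment_commute)
    moreover have "v' + - W i \<in> int_lattice"
      using int_lattice_diff[OF v'lat corner_lattice(1)[OF corner]] by simp
    moreover have "open_segment v' (v' + - W i) \<inter> int_lattice = {}"
    proof (rule ccontr)
      assume "\<not> ?thesis"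
      then obtain z where z: "z \<in> open_segment v' (v' + - W i)" "z \<in> int_lattice" by blast
      then obtain u where u: "0 < u" "u < 1" "z = (1 - u) *\<^sub>R v' + u *\<^sub>R (v' + - W i)"
        unfolding in_segment by blast
      have "v' - z = u *\<^sub>R W i" unfolding u(3) by (simp add: algebra_simps)
      then have "l i (v' - z) = u" by (simp add: lscale lW)
      then have "u \<in> \<int>" using l(4) int_lattice_diff[OF v'lat z(2)] by metis
      then show False using u(1,2) by (auto simp: Ints_def)
    qed
    moreover have "v' \<in> e" unfolding v'(2) by simp
    ultimately show ?thesis unfolding first_lattice_vectors_def using e(1,3) by auto
  qed
  moreover have "range W0 = first_lattice_vectors P v'" using W0 unfolding corner_def by blast
  ultimately have "- W i \<in> range W0" by simp
  then obtain k0 where k0: "W0 k0 = - W i" by force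
  have W0_int: "l j (W0 k) \<in> \<int>" for j k using l(4) corner_lattice(1)[OF W0] by simp
  have W0_nonneg: "0 \<le> l j (W0 k)" if "j \<noteq> i" for j k
  proof -
    have "v' + W0 k = v + (v' + W0 k - v)" by simp
    also have "v' + W0 k - v = (\<Sum>j\<in>UNIV. l j (v' + W0 k - v) *\<^sub>R W j)" using l(3) by blast
    finally have "0 \<le> l j (v' + W0 k - v)"
      using corner_lattice(2)[OF W0, of k] by (intro corner_nonneg[OF corner]) simp
    also have "\<dots> = l j (W0 k)" unfolding \<alpha>(2) using that by (simp add: ldiff ladd lscale lW)
    finally show ?thesis .
  qed
  have ex: "\<exists>k c. W0 k = W j + of_int c *\<^sub>R W i" if ji: "j \<noteq> i" for j
  proof -
    \<comment> \<open>\<open>x = W j - \<alpha> *\<^sub>R W i\<close> leads from \<open>v'\<close>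
      to a point of \<open>P\<close>, so its coordinates in \<open>W0\<close> are nonnegative
      integers. Its \<open>j\<close>-coordinate 1 must then come from a single \<open>W0 k\<close>,
      whose coordinates outside \<open>i\<close> and \<open>j\<close> vanish.\<close>
    define x where "x = v + W j - v'"
    have xlat: "x \<in> int_lattice" unfolding x_def
      by (intro int_lattice_diff int_lattice_add vlat v'lat corner_lattice(1)[OF corner])
    have rep: "x = (\<Sum>k\<in>UNIV. l0 k x *\<^sub>R W0 k)" using l0(3) by blast
    have "v' + (\<Sum>k\<in>UNIV. l0 k x *\<^sub>R W0 k) \<in> P"
    proof -
      have "v' + x \<in> P" unfolding x_def using corner_lattice(2)[OF corner, of j] by simp
      then show ?thesis using rep by simp
    qed
    then have nonneg: "0 \<le> l0 k x" for k by (rule corner_nonneg[OF W0])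
    have xi: "x = W j - \<alpha> *\<^sub>R W i" unfolding x_def \<alpha>(2) by simp
    have coord: "l q x = (\<Sum>k\<in>UNIV. l0 k x * l q (W0 k))" for q
    proof -
      have "l q x = l q (\<Sum>k\<in>UNIV. l0 k x *\<^sub>R W0 k)" using rep by simp
      then show ?thesis unfolding lsum lscale .
    qed
    have int0: "l0 k x \<in> \<int>" for k using l0(4) xlat by simp
    have "l j x = 1" unfolding xi using ji by (simp add: ldiff lscale lW)
    then have "(\<Sum>k\<in>UNIV. l0 k x * l j (W0 k)) = 1" using coord by simp
    then obtain k where k: "l0 k x * l j (W0 k) = 1"
      using nonneg_Ints_sum_eq_1[of "\<lambda>k. l0 k x * l j (W0 k)"] int0 W0_int nonneg W0_nonneg[OF ji]
      by (metis Ints_mult mult_nonneg_nonneg)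
    obtain p q :: int where pq: "l0 k x = of_int p" "l j (W0 k) = of_int q"
      using int0[of k] W0_int[of j k] by (auto simp: Ints_def)
    have "p * q = 1" using k unfolding pq by (metis of_int_eq_1_iff of_int_mult)
    moreover have "p \<ge> 0" using nonneg[of k] pq(1) by simp
    ultimately have "p = 1" "q = 1" by (auto simp: zmult_eq_1_iff)
    then have k1: "l0 k x = 1" "l j (W0 k) = 1" using pq by auto
    have k_other: "l q (W0 k) = 0" if q: "q \<noteq> i" "q \<noteq> j" for q
    proof -
      have "l q x = 0" unfolding xi using q by (simp add: ldiff lscale lW)
      then have "(\<Sum>k\<in>UNIV. l0 k x * l q (W0 k)) = 0" using coord by simp
      then have "\<forall>k\<in>UNIV. l0 k x * l q (W0 k) = 0"
        using nonneg W0_nonneg[OF q(1)] by (subst (asm) sum_nonneg_eq_0_iff) auto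
      then have "l0 k x * l q (W0 k) = 0" by blast
      then show ?thesis using k1(1) by simp
    qed
    obtain c :: int where c: "l i (W0 k) = of_int c" using W0_int[of i k] by (auto simp: Ints_def)
    have "W0 k = (\<Sum>q\<in>UNIV. l q (W0 k) *\<^sub>R W q)" using l(3) by blast
    also have "\<dots> = (\<Sum>q\<in>{i, j}. l q (W0 k) *\<^sub>R W q)"
      by (rule sum.mono_neutral_right) (auto simp: k_other)
    also have "\<dots> = W j + of_int c *\<^sub>R W i" using ji k1(2) c by simp
    finally show ?thesis by blast
  qed
  have "\<forall>j. \<exists>kc. W0 (fst kc) = (if j = i then - W i else W j + of_int (snd kc) *\<^sub>R W i)"
    using ex k0 by (metis fst_conv snd_conv)
  from choice[OF this] obtain kc where
    kc: "\<And>j. W0 (fst (kc j)) = (if j = i then - W i else W j + of_int (snd (kc j)) *\<^sub>R W i)" by blast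
  \<comment> \<open>\<open>\<kappa>\<close> renumbers the edge vectors at \<open>v'\<close> by the
    directions at \<open>v\<close>.\<close>
  define \<kappa> where "\<kappa> j = fst (kc j)" for j
  define c where "c j = snd (kc j)" for j
  have \<kappa>: "corner_step W i c = W0 \<circ> \<kappa>"
    unfolding \<kappa>_def c_def by (rule ext) (simp add: corner_step_def kc)
  have lstep: "l j (corner_step W i c j') = (if j = i then (if j' = i then -1 else of_int (c j')) else if j = j' then 1 else 0)" for j j'
  proof -
    have "l j (- W i) = - (if j = i then 1 else 0)" using ldiff[of j 0 "W i"] lscale[of j 0 0] lW by simp
    then show ?thesis by (cases "j = i") (simp_all add: corner_step_def ladd lscale lW)
  qed
  have "inj \<kappa>"
  proof (rule injI)
    fix j j' assume "\<kappa> j = \<kappa> j'"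
    then have eq: "corner_step W i c j = corner_step W i c j'" unfolding \<kappa> by simp
    show "j = j'"
    proof (rule ccontr)
      assume "j \<noteq> j'"
      then consider "j \<noteq> i" | "j' \<noteq> i" by blast
      then show False using lstep[of j j] lstep[of j j'] lstep[of j' j] lstep[of j' j'] eq \<open>j \<noteq> j'\<close>
        by cases auto
    qed
  qed
  then have surj: "surj \<kappa>" and bij: "bij \<kappa>" using finite_UNIV_inj_surj[of \<kappa>] by (auto simp: bij_def)
  have W0props: "inj W0" "range W0 = first_lattice_vectors P v'" "lattice_basis (range W0)"
    "\<And>x. x \<in> P \<Longrightarrow> \<exists>y. (\<forall>i. 0 \<le> y i) \<and> x = v' + (\<Sum>i\<in>UNIV. y i *\<^sub>R W0 i)"
    using W0 unfolding corner_def by auto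
  have rng: "range (corner_step W i c) = range W0" unfolding \<kappa> image_comp[symmetric] using surj by simp
  have cone: "\<exists>y. (\<forall>i. 0 \<le> y i) \<and> x = v' + (\<Sum>j\<in>UNIV. y j *\<^sub>R corner_step W i c j)" if x: "x \<in> P" for x
  proof -
    obtain y where y: "\<forall>i. 0 \<le> y i" "x = v' + (\<Sum>i\<in>UNIV. y i *\<^sub>R W0 i)" using W0props(4)[OF x] by blast
    have "(\<Sum>j\<in>UNIV. y (\<kappa> j) *\<^sub>R W0 (\<kappa> j)) = (\<Sum>i\<in>UNIV. y i *\<^sub>R W0 i)"
      by (rule sum.reindex_bij_betw[OF bij])
    then show ?thesis using y by (intro exI[of _ "\<lambda>j. y (\<kappa> j)"]) (simp add: \<kappa>)
  qed
  have "corner P v' (corner_step W i c)"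
    unfolding corner_def rng using v'(3) W0props(2,3) cone \<open>inj \<kappa>\<close> W0props(1)
    by (auto simp: \<kappa> intro: inj_compose)
  moreover have "a \<ge> 1" using \<alpha>(1) a unfolding a_def by linarith
  ultimately show ?thesis using that[of a c] \<alpha>(2) a unfolding a_def by simp
qed

subsection \<open>Lattice points of small degree\<close>

definition deg :: "real ^ 'n \<Rightarrow> real" where
  "deg y = (\<Sum>k\<in>UNIV. y $ k)"

abbreviation unit_vec :: "'n \<Rightarrow> real ^ 'n" ("\<e>") where
  "\<e> i \<equiv> axis i 1"

lemma deg_simps [simp]: "deg (x + y) = deg x + deg y" "deg (s *\<^sub>R x) = s * deg x" "deg (\<e> i) = 1" "deg 0 = 0"
proof -
  show "deg (\<e> i) = 1" unfolding deg_def axis_def by simp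
qed (simp_all add: deg_def sum.distrib sum_distrib_left)

lemma unit_nth: "\<e> i $ k = (if k = i then 1 else 0)"
  by (simp add: axis_def)

lemma lattice_split_unit:
  assumes "y \<in> int_lattice" "\<forall>k. 0 \<le> y $ k" "deg y > 0"
  obtains i z where "y = \<e> i + z" "z \<in> int_lattice" "\<forall>k. 0 \<le> z $ k"
proof -
  obtain i where i: "y $ i \<noteq> 0"
    using assms(3) unfolding deg_def by (metis less_irrefl sum.neutral)
  have "y $ i \<in> \<int>" using assms(1) unfolding int_lattice_def by blast
  then have "y $ i \<ge> 1" using i assms(2) Ints_nonzero_abs_ge1[of "y $ i"] by simp
  then have "\<forall>k. 0 \<le> (y - \<e> i) $ k" using assms(2) by (auto simp: axis_def)
  moreover have "y - \<e> i \<in> int_lattice" using assms(1) unfolding int_lattice_def by (auto simp: axis_def)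
  ultimately show ?thesis using that[of i "y - \<e> i"] by simp
qed

lemma lattice_deg_Ints: "y \<in> int_lattice \<Longrightarrow> deg y \<in> \<int>"
  unfolding deg_def int_lattice_def by (intro Ints_sum) auto

lemma deg_nonneg_eq_0: "\<forall>k. 0 \<le> y $ k \<Longrightarrow> deg y \<le> 0 \<Longrightarrow> y = 0"
proof -
  assume y: "\<forall>k. 0 \<le> y $ k" "deg y \<le> 0"
  then have "deg y = 0" unfolding deg_def by (meson order_antisym sum_nonneg)
  then have "\<forall>k. y $ k = 0" using y(1) unfolding deg_def by (subst (asm) sum_nonneg_eq_0_iff) auto
  then show "y = 0" by (simp add: vec_eq_iff)
qed

lemma lattice_deg_le_1:
  assumes "y \<in> int_lattice" "\<forall>k. 0 \<le> y $ k" "deg y < 2"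
  shows "y = 0 \<or> (\<exists>i. y = \<e> i)"
proof (cases "deg y > 0")
  case True
  obtain i z where z: "y = \<e> i + z" "z \<in> int_lattice" "\<forall>k. 0 \<le> z $ k"
    by (rule lattice_split_unit[OF assms(1,2) True])
  have "deg z < 1" using assms(3) unfolding z(1) by simp
  then have "deg z \<le> 0" using lattice_deg_Ints[OF z(2)] by (auto simp: Ints_def)
  then show ?thesis using deg_nonneg_eq_0[OF z(3)] z(1) by auto
qed (use deg_nonneg_eq_0[OF assms(2)] in auto)

lemma lattice_deg_2:
  assumes "y \<in> int_lattice" "\<forall>k. 0 \<le> y $ k" "2 \<le> deg y" "deg y < 3"
  shows "\<exists>i j. y = \<e> i + \<e> j"
proof -
  obtain i z where z: "y = \<e> i + z" "z \<in> int_lattice" "\<forall>k. 0 \<le> z $ k"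
    by (rule lattice_split_unit[OF assms(1,2)]) (use assms(3) in auto)
  have "deg z < 2" "deg z \<ge> 1" using assms(3,4) unfolding z(1) by simp_all
  then have "\<exists>j. z = \<e> j" using lattice_deg_le_1[OF z(2,3)] by auto
  then show ?thesis using z(1) by blast
qed

lemma convex_sum_units:
  fixes X :: "(real ^ 'n) set"
  assumes "convex X" "p \<in> X" "\<And>i. i \<in> I \<Longrightarrow> p + s *\<^sub>R \<e> i \<in> X" "s > 0"
    and "\<And>i. i \<in> I \<Longrightarrow> 0 \<le> y $ i" "(\<Sum>i\<in>I. y $ i) \<le> s"
  shows "p + (\<Sum>i\<in>I. y $ i *\<^sub>R \<e> i) \<in> X"
proof -
  \<comment> \<open>The simplex with apex \<open>p\<close>, indexed by \<open>None\<close>, and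
    vertices \<open>p + s *\<^sub>R \<e> i\<close>; the apex takes the weight left over.\<close>
  define z where "z i = (case i of None \<Rightarrow> p | Some i \<Rightarrow> p + s *\<^sub>R \<e> i)" for i
  define u where "u i = (case i of None \<Rightarrow> 1 - (\<Sum>i\<in>I. y $ i) / s | Some i \<Rightarrow> y $ i / s)" for i
  have split: "(\<Sum>i\<in>insert None (Some ` I). g i) = g None + (\<Sum>i\<in>I. g (Some i))" for g :: "'n option \<Rightarrow> 'b::comm_monoid_add"
    by (simp add: sum.reindex)
  have u1: "(\<Sum>i\<in>insert None (Some ` I). u i) = 1"
    unfolding split u_def by (simp add: sum_divide_distrib)
  have "(\<Sum>i\<in>insert None (Some ` I). u i *\<^sub>R z i) \<in> X"
    using assms u1 by (intro convex_sum) (auto simp: u_def z_def field_simps)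
  moreover have "(\<Sum>i\<in>insert None (Some ` I). u i *\<^sub>R z i) = p + (\<Sum>i\<in>I. y $ i *\<^sub>R \<e> i)"
  proof -
    have "(\<Sum>i\<in>I. u (Some i) *\<^sub>R z (Some i)) = (\<Sum>i\<in>I. (y $ i / s) *\<^sub>R p + y $ i *\<^sub>R \<e> i)"
      using assms(4) unfolding u_def z_def by (intro sum.cong) (auto simp: scaleR_add_right)
    also have "\<dots> = ((\<Sum>i\<in>I. y $ i) / s) *\<^sub>R p + (\<Sum>i\<in>I. y $ i *\<^sub>R \<e> i)"
      by (simp add: sum.distrib scaleR_sum_left sum_divide_distrib)
    finally show ?thesis unfolding split by (simp add: u_def z_def algebra_simps)
  qed
  ultimately show ?thesis by simp
qed

lemma vec_sum_units: "(y :: real ^ 'n) = (\<Sum>i\<in>UNIV. y $ i *\<^sub>R \<e> i)"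
  using basis_expansion[of y] by (simp add: scalar_mult_eq_scaleR)

subsection \<open>Charts\<close>

definition chart :: "(real ^ 'n) set \<Rightarrow> real ^ 'n \<Rightarrow> ('n \<Rightarrow> real ^ 'n) \<Rightarrow> (real ^ 'n) set" where
  "chart P v W = {y. v + (\<Sum>j\<in>UNIV. y $ j *\<^sub>R W j) \<in> P}"

text \<open>In corner coordinates \<open>y $ i \<le> a + slope c i y\<close> is the inequality of
  the facet met at the far end of the \<open>i\<close>-th edge.\<close>

definition slope :: "('n \<Rightarrow> int) \<Rightarrow> 'n \<Rightarrow> real ^ 'n \<Rightarrow> real" where
  "slope c i y = (\<Sum>j\<in>- {i}. of_int (c j) * y $ j)"

text \<open>The coordinate change between the corners at the two ends of an edge. It is the same map
  in both directions.\<close>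

definition transition :: "'n \<Rightarrow> nat \<Rightarrow> ('n \<Rightarrow> int) \<Rightarrow> real ^ 'n \<Rightarrow> real ^ 'n" where
  "transition i a c z = (\<chi> k. if k = i then real a - z $ i + slope c i z else z $ k)"

lemma slope_simps [simp]: "slope c i (x + y) = slope c i x + slope c i y" "slope c i (s *\<^sub>R x) = s * slope c i x"
  "slope c i (\<e> j) = (if j = i then 0 else of_int (c j))" "slope c i 0 = 0"
proof -
  have "slope c i (\<e> j) = (\<Sum>k\<in>- {i}. if k = j then of_int (c j) else 0)"
    unfolding slope_def by (intro sum.cong) (auto simp: axis_def)
  then show "slope c i (\<e> j) = (if j = i then 0 else of_int (c j))" by simp
qed (simp_all add: slope_def sum.distrib sum_distrib_left algebra_simps)

lemma slope_cong: "(\<And>j. j \<noteq> i \<Longrightarrow> x $ j = y $ j) \<Longrightarrow> slope c i x = slope c i y"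
  unfolding slope_def by (intro sum.cong) auto

lemma transition_invol: "transition i a c (transition i a c z) = z"
proof -
  have "slope c i (transition i a c z) = slope c i z"
    by (rule slope_cong) (simp add: transition_def)
  then show ?thesis by (simp add: vec_eq_iff) (simp add: transition_def)
qed

lemma chart_transition:
  "z \<in> chart P (v + real a *\<^sub>R W i) (corner_step W i c) \<longleftrightarrow> transition i a c z \<in> chart P v W"
proof -
  have split: "(\<Sum>j\<in>UNIV. g j) = g i + (\<Sum>j\<in>- {i}. g j)" for g :: "'a \<Rightarrow> real ^ 'a"
    by (subst sum.remove[of UNIV i]) (auto simp: Compl_eq_Diff_UNIV)
  have 1: "(\<Sum>j\<in>UNIV. z $ j *\<^sub>R corner_step W i c j) =
      z $ i *\<^sub>R (- W i) + (\<Sum>j\<in>- {i}. z $ j *\<^sub>R (W j + of_int (c j) *\<^sub>R W i))"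
    unfolding split by (simp add: corner_step_def)
  have "(\<Sum>j\<in>- {i}. z $ j *\<^sub>R (W j + of_int (c j) *\<^sub>R W i)) =
      (\<Sum>j\<in>- {i}. z $ j *\<^sub>R W j) + slope c i z *\<^sub>R W i"
    unfolding slope_def scaleR_sum_left by (simp add: sum.distrib algebra_simps)
  with 1 have "real a *\<^sub>R W i + (\<Sum>j\<in>UNIV. z $ j *\<^sub>R corner_step W i c j) =
      (real a - z $ i + slope c i z) *\<^sub>R W i + (\<Sum>j\<in>- {i}. z $ j *\<^sub>R W j)"
    by (simp add: algebra_simps)
  also have "\<dots> = (\<Sum>j\<in>UNIV. transition i a c z $ j *\<^sub>R W j)"
    unfolding split by (simp add: transition_def)
  finally show ?thesis unfolding chart_def by (simp add: add.assoc)
qed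

section \<open>A corner together with its neighbours\<close>

locale smooth_full_polytope =
  fixes P :: "(real ^ 'n) set"
  assumes smooth: "smooth_polytope P" and dim: "aff_dim P = int CARD('n)"
    and fin: "finite (P \<inter> int_lattice)"

text \<open>\<open>a i\<close> is the lattice length of the \<open>i\<close>-th edge and
  \<open>c i\<close> describes the corner at its far end.\<close>

locale polytope_corner = smooth_full_polytope P for P :: "(real ^ 'n) set" +
  fixes v :: "real ^ 'n" and W :: "'n \<Rightarrow> real ^ 'n" and a :: "'n \<Rightarrow> nat" and c :: "'n \<Rightarrow> 'n \<Rightarrow> int"
  assumes corner: "corner P v W" and a_ge_1: "1 \<le> a i"
    and step: "corner P (v + real (a i) *\<^sub>R W i) (corner_step W i (c i))"

lemma (in smooth_full_polytope) polytope_corner_exists: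
  assumes "corner P v W"
  shows "\<exists>a c. polytope_corner P v W a c"
proof -
  have "\<exists>ac. 1 \<le> fst ac \<and> corner P (v + real (fst ac) *\<^sub>R W i) (corner_step W i (snd ac))" for i
    using corner_stepE[OF smooth dim fin assms, of i] by (metis fst_conv snd_conv)
  then have "\<forall>i. \<exists>ac. 1 \<le> fst ac \<and> corner P (v + real (fst ac) *\<^sub>R W i) (corner_step W i (snd ac))" by blast
  from choice[OF this] obtain ac where
    "\<forall>i. 1 \<le> fst (ac i) \<and> corner P (v + real (fst (ac i)) *\<^sub>R W i) (corner_step W i (snd (ac i)))" ..
  then have "polytope_corner P v W (\<lambda>i. fst (ac i)) (\<lambda>i. snd (ac i))"
    using assms by unfold_locales auto
  then show ?thesis by blast
qed

context polytope_corner
begin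

abbreviation X :: "(real ^ 'n) set" where "X \<equiv> chart P v W"

lemma lat: "lattice_polytope P"
  using smooth unfolding smooth_polytope_def by blast

lemma convex_P: "convex P"
  using lattice_polytope_polytope[OF lat] by (rule polytope_imp_convex)

lemma convex_X: "convex X"
proof (rule convexI)
  fix x y and s t :: real assume xy: "x \<in> X" "y \<in> X" and st: "0 \<le> s" "0 \<le> t" "s + t = 1"
  have "s *\<^sub>R (v + (\<Sum>j\<in>UNIV. x $ j *\<^sub>R W j)) + t *\<^sub>R (v + (\<Sum>j\<in>UNIV. y $ j *\<^sub>R W j)) \<in> P"
    using convexD[OF convex_P, of "v + (\<Sum>j\<in>UNIV. x $ j *\<^sub>R W j)" "v + (\<Sum>j\<in>UNIV. y $ j *\<^sub>R W j)" s t] xy st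
    unfolding chart_def by simp
  also have "s *\<^sub>R (v + (\<Sum>j\<in>UNIV. x $ j *\<^sub>R W j)) + t *\<^sub>R (v + (\<Sum>j\<in>UNIV. y $ j *\<^sub>R W j)) =
      (s + t) *\<^sub>R v + (\<Sum>j\<in>UNIV. (s *\<^sub>R x + t *\<^sub>R y) $ j *\<^sub>R W j)"
    by (simp add: algebra_simps scaleR_sum_right sum.distrib)
  finally show "s *\<^sub>R x + t *\<^sub>R y \<in> X" unfolding chart_def using st(3) by simp
qed

lemma nonneg: "y \<in> X \<Longrightarrow> 0 \<le> y $ i"
  unfolding chart_def using corner_nonneg[OF corner] by blast

text \<open>This is nonnegativity of the \<open>i\<close>-th coordinate at the far corner.\<close>

lemma upper: "y \<in> X \<Longrightarrow> y $ i \<le> real (a i) + slope (c i) i y"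
proof -
  assume "y \<in> X"
  then have "transition i (a i) (c i) y \<in> chart P (v + real (a i) *\<^sub>R W i) (corner_step W i (c i))"
    unfolding chart_transition transition_invol .
  then have "0 \<le> transition i (a i) (c i) y $ i" unfolding chart_def using corner_nonneg[OF step] by blast
  then show ?thesis by (simp add: transition_def)
qed

lemma zero_in: "0 \<in> X"
  unfolding chart_def using corner_lattice(3)[OF corner] by simp

lemma corner_unit_in:
  assumes "corner P u V"
  shows "\<e> i \<in> chart P u V"
proof -
  have "(\<Sum>j\<in>UNIV. \<e> i $ j *\<^sub>R V j) = (\<Sum>j\<in>UNIV. if j = i then V j else 0)"
    by (intro sum.cong) (auto simp: axis_def)
  then show ?thesis unfolding chart_def using corner_lattice(2)[OF assms, of i] by simp
qed

lemma unit_in: "\<e> i \<in> X"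
  by (rule corner_unit_in[OF corner])

lemma top_in: "real (a i) *\<^sub>R \<e> i \<in> X"
proof -
  have "0 \<in> chart P (v + real (a i) *\<^sub>R W i) (corner_step W i (c i))"
    unfolding chart_def using corner_lattice(3)[OF step] by simp
  then have "transition i (a i) (c i) 0 \<in> X" unfolding chart_transition .
  moreover have "transition i (a i) (c i) 0 = real (a i) *\<^sub>R \<e> i"
    by (simp add: transition_def vec_eq_iff axis_def)
  ultimately show ?thesis by simp
qed

text \<open>The point is the unit vector \<open>\<e> j\<close> of the far corner, written in the
  coordinates of the near one.\<close>

lemma shift_in:
  assumes "j \<noteq> i"
  shows "\<e> j + (real (a i) + of_int (c i j)) *\<^sub>R \<e> i \<in> X"
proof -
  have "transition i (a i) (c i) (\<e> j) \<in> X"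
    using corner_unit_in[OF step] unfolding chart_transition .
  moreover have "transition i (a i) (c i) (\<e> j) = \<e> j + (real (a i) + of_int (c i j)) *\<^sub>R \<e> i"
    using assms by (simp add: transition_def vec_eq_iff) (simp add: axis_def)
  ultimately show ?thesis by simp
qed

lemma shift_nonneg: "j \<noteq> i \<Longrightarrow> 0 \<le> int (a i) + c i j"
proof -
  assume "j \<noteq> i"
  from nonneg[OF shift_in[OF this], of i] have "0 \<le> real (a i) + of_int (c i j)"
    using \<open>j \<noteq> i\<close> by (simp add: axis_def)
  then show ?thesis by linarith
qed

lemma segment_in:
  assumes "p \<in> X" "p + s *\<^sub>R \<e> i \<in> X" "0 \<le> t" "t \<le> s"
  shows "p + t *\<^sub>R \<e> i \<in> X"
proof (cases "s = 0")
  case False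
  then have s: "s > 0" using assms by simp
  have "(1 - t / s) *\<^sub>R p + (t / s) *\<^sub>R (p + s *\<^sub>R \<e> i) \<in> X"
    using assms s by (intro convexD[OF convex_X]) auto
  then show ?thesis using s by (simp add: algebra_simps)
qed (use assms in auto)

lemma shift_segment:
  assumes "j \<noteq> i" "0 \<le> t" "t \<le> real (a i) + of_int (c i j)"
  shows "\<e> j + t *\<^sub>R \<e> i \<in> X"
  by (rule segment_in[OF unit_in shift_in[OF assms(1)] assms(2,3)])

lemma axis_segment: "0 \<le> t \<Longrightarrow> t \<le> real (a i) \<Longrightarrow> t *\<^sub>R \<e> i \<in> X"
  using segment_in[OF zero_in, of "real (a i)" i t] top_in by simp

text \<open>If the shift along \<open>i\<close> does not provide the point, then
  \<open>c i j = - a i\<close>, which forces \<open>a j = 1\<close>; then \<open>a i \<ge> 2\<close>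
  forces \<open>c j i \<ge> 0\<close>, and the shift along \<open>j\<close> provides it.\<close>

lemma long_pair:
  assumes "a i \<ge> 2"
  shows "\<e> i + \<e> j \<in> X"
proof (cases "j = i")
  case True
  then show ?thesis using axis_segment[of 2 i] assms by (simp add: scaleR_2)
next
  case False
  show ?thesis
  proof (cases "int (a i) + c i j \<ge> 1")
    case True
    then have "1 \<le> real (a i) + of_int (c i j)" by linarith
    from shift_segment[OF False _ this] show ?thesis by (simp add: add.commute)
  next
    case neg: False
    then have cij: "c i j = - int (a i)" using shift_nonneg[OF False] by linarith
    have "0 \<le> real (a i) + real (a j) * of_int (c i j)"
      using upper[OF top_in[of j], of i] False by (simp add: unit_nth)
    then have "real (a i) * real (a j) \<le> real (a i)" unfolding cij by (simp add: mult.commute)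
    then have aj: "a j = 1" using a_ge_1[of j] assms by (simp add: mult_le_cancel_left1)
    have "0 \<le> real (a j) + real (a i) * of_int (c j i)"
      using upper[OF top_in[of i], of j] False by (simp add: unit_nth)
    then have "0 \<le> real_of_int (1 + int (a i) * c j i)" using aj by simp
    then have "0 \<le> 1 + int (a i) * c j i" unfolding of_int_0_le_iff .
    then have "c j i \<ge> 0"
    proof -
      have "\<not> c j i \<le> -1"
      proof
        assume "c j i \<le> -1"
        then have "int (a i) * c j i \<le> int (a i) * (-1)" by (intro mult_left_mono) auto
        then show False using \<open>0 \<le> 1 + int (a i) * c j i\<close> assms by linarith
      qed
      then show ?thesis by linarith
    qed
    then have "1 \<le> real (a j) + of_int (c j i)" using aj by simp
    from shift_segment[OF False[symmetric] _ this] show ?thesis by simp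
  qed
qed

lemma pair_iff:
  assumes "j \<noteq> i" "a i = 1"
  shows "\<e> i + \<e> j \<in> X \<longleftrightarrow> 0 \<le> c i j"
proof
  assume "\<e> i + \<e> j \<in> X"
  from upper[OF this, of i] show "0 \<le> c i j" using assms by (simp add: unit_nth)
next
  assume "0 \<le> c i j"
  then have "1 \<le> real (a i) + of_int (c i j)" using assms(2) by simp
  from shift_segment[OF assms(1) _ this] show "\<e> i + \<e> j \<in> X" by (simp add: add.commute)
qed

text \<open>The vertex \<open>e\<^sub>i + e\<^sub>j\<close> is reached by two edges from \<open>0\<close>; simplicity there forces a third edge
  leaving the half space of degree at most \<open>2\<close>.\<close>

lemma no_flat_triple:
  assumes dist: "i \<noteq> j" "i \<noteq> k" "j \<noteq> k" and ai: "a i = 1" and aj: "a j = 1"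
    and pairs: "\<e> i + \<e> j \<in> X" "\<e> i + \<e> k \<in> X" "\<e> j + \<e> k \<in> X"
    and deg2: "\<And>y. y \<in> X \<Longrightarrow> deg y \<le> 2"
  shows False
proof -
  have c0: "c i l = 0" if l: "l \<noteq> i" "\<e> i + \<e> l \<in> X" for l
    using pair_iff[OF l(1) ai] l(2) deg2[OF shift_in[OF l(1)]] ai by simp
  have cij: "c i j = 0" and cik: "c i k = 0" using c0 dist pairs by auto
  \<comment> \<open>The corner at the vertex \<open>\<e> i\<close>. Because
    \<open>c i j = c i k = 0\<close>, on the span of the three directions the transition only
    replaces \<open>z $ i\<close> by \<open>1 - z $ i\<close>.\<close>
  define v' where "v' = v + real (a i) *\<^sub>R W i"
  define W' where "W' = corner_step W i (c i)"
  obtain a' c' where "polytope_corner P v' W' a' c'"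
    using polytope_corner_exists[OF step] unfolding v'_def W'_def by blast
  then interpret Q: polytope_corner P v' W' a' c' .
  define \<sigma> where "\<sigma> = transition i 1 (c i)"
  have mem: "z \<in> Q.X \<longleftrightarrow> \<sigma> z \<in> X" for z
    unfolding v'_def W'_def \<sigma>_def ai[symmetric] by (rule chart_transition)
  have "\<sigma> (real (a' j) *\<^sub>R \<e> j) \<in> X" using Q.top_in mem by blast
  moreover have "\<sigma> (real (a' j) *\<^sub>R \<e> j) = \<e> i + real (a' j) *\<^sub>R \<e> j"
    unfolding \<sigma>_def transition_def using dist cij by (simp add: vec_eq_iff) (simp add: axis_def)
  ultimately have "1 + real (a' j) \<le> 2" using deg2 by force
  then have a'j: "a' j = 1" using Q.a_ge_1[of j] by simp
  have "\<sigma> (\<e> k + (1 + of_int (c' j k)) *\<^sub>R \<e> j) \<in> X"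
    using Q.shift_in[of k j] mem dist a'j by simp
  moreover have "\<sigma> (\<e> k + (1 + of_int (c' j k)) *\<^sub>R \<e> j) = \<e> i + \<e> k + (1 + of_int (c' j k)) *\<^sub>R \<e> j"
    unfolding \<sigma>_def transition_def using dist cij cik by (simp add: vec_eq_iff) (simp add: axis_def)
  ultimately have "deg (\<e> i + \<e> k + (1 + of_int (c' j k)) *\<^sub>R \<e> j) \<le> 2" using deg2 by metis
  then have c'jk: "of_int (c' j k) \<le> (-1 :: real)" by simp
  have "\<sigma> (\<e> i + (1 + of_int (c' j i)) *\<^sub>R \<e> j) \<in> X"
    using Q.shift_in[of i j] mem dist a'j by simp
  moreover have "\<sigma> (\<e> i + (1 + of_int (c' j i)) *\<^sub>R \<e> j) = (1 + of_int (c' j i)) *\<^sub>R \<e> j"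
    unfolding \<sigma>_def transition_def using dist cij by (simp add: vec_eq_iff) (simp add: axis_def)
  ultimately have "(1 + of_int (c' j i)) *\<^sub>R \<e> j \<in> X" by simp
  from upper[OF this, of j] have c'ji: "of_int (c' j i) \<le> (0 :: real)" using aj by simp
  \<comment> \<open>Seen from the new corner, \<open>\<e> j + \<e> k\<close> becomes
    \<open>\<e> i + \<e> j + \<e> k\<close>. It violates the bound at the far end of edge
    \<open>j\<close>, since \<open>c' j i \<le> 0\<close> and
    \<open>c' j k \<le> -1\<close>.\<close>
  have "\<sigma> (\<sigma> (\<e> j + \<e> k)) \<in> X" unfolding \<sigma>_def transition_invol by (rule pairs(3))
  then have "\<sigma> (\<e> j + \<e> k) \<in> Q.X" using mem by blast
  moreover have "\<sigma> (\<e> j + \<e> k) = \<e> i + \<e> j + \<e> k"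
    unfolding \<sigma>_def transition_def using dist cij cik by (simp add: vec_eq_iff) (simp add: axis_def)
  ultimately have "\<e> i + \<e> j + \<e> k \<in> Q.X" by simp
  from Q.upper[OF this, of j] have "1 \<le> 1 + of_int (c' j i) + (of_int (c' j k) :: real)"
    using dist a'j by (simp add: unit_nth)
  then show False using c'jk c'ji by simp
qed

text \<open>Corner coordinates are integral on the lattice, so they carry the lattice points
  spanning \<open>P\<close> to lattice points of the chart.\<close>

lemma hull_X: "X \<subseteq> convex hull (X \<inter> int_lattice)"
proof
  fix y assume y: "y \<in> X"
  obtain l where l: "\<forall>j. linear (l j)" "\<forall>j k. l j (W k) = (if j = k then 1 else 0)"
    "\<forall>x. x = (\<Sum>j\<in>UNIV. l j x *\<^sub>R W j)" "\<forall>j. \<forall>x\<in>int_lattice. l j x \<in> \<int>"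
    by (rule corner_dual[OF corner])
  define g where "g x = (\<chi> j. l j x)" for x
  have lin: "linear g"
    unfolding g_def using l(1) by (intro linearI) (simp_all add: vec_eq_iff linear_add linear_scale)
  obtain S where S: "finite S" "S \<subseteq> int_lattice" "P = convex hull S"
    using lat unfolding lattice_polytope_def by blast
  have v: "v \<in> int_lattice"
    using corner lattice_polytope_extreme[OF lat] unfolding corner_def by blast
  have gW: "(\<Sum>j\<in>UNIV. g x $ j *\<^sub>R W j) = x" for x
    unfolding g_def using l(3) by simp
  have mem: "g (x - v) \<in> X" if "x \<in> P" for x
    unfolding chart_def using that by (simp add: gW)
  have gl: "g x \<in> int_lattice" if "x \<in> int_lattice" for x
    unfolding g_def int_lattice_def using l(4) that by simp
  define x where "x = v + (\<Sum>j\<in>UNIV. y $ j *\<^sub>R W j)"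
  have xP: "x \<in> P" using y unfolding chart_def x_def by simp
  have "g (x - v) = y"
  proof -
    have "(\<Sum>j\<in>UNIV. g (x - v) $ j *\<^sub>R W j) = (\<Sum>j\<in>UNIV. y $ j *\<^sub>R W j)"
      unfolding gW by (simp add: x_def)
    from corner_coeff_unique[OF corner this] show ?thesis by (metis vec_eq_iff)
  qed
  moreover have "g (x - v) \<in> convex hull (X \<inter> int_lattice)"
  proof -
    have "(\<lambda>x. x - v) ` P = convex hull ((\<lambda>x. x - v) ` S)"
      unfolding S(3) using convex_hull_translation[of "- v" S] by (simp add: image_def)
    then have "g ` (\<lambda>x. x - v) ` P = convex hull (g ` (\<lambda>x. x - v) ` S)"
      by (simp add: convex_hull_linear_image[OF lin])
    moreover have "g ` (\<lambda>x. x - v) ` S \<subseteq> X \<inter> int_lattice"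
    proof -
      have "S \<subseteq> P" unfolding S(3) by (rule hull_subset)
      then show ?thesis using mem gl int_lattice_diff[OF _ v] S(2) by auto
    qed
    ultimately show ?thesis using xP hull_mono by blast
  qed
  ultimately show "y \<in> convex hull (X \<inter> int_lattice)" by simp
qed

lemma X_eq_hull: "X = convex hull (X \<inter> int_lattice)"
  using hull_X hull_minimal[of "X \<inter> int_lattice" X convex] convex_X by blast

lemma deg_bound:
  assumes "\<And>y. y \<in> X \<inter> int_lattice \<Longrightarrow> deg y \<le> d" "y \<in> X"
  shows "deg y \<le> d"
proof -
  have "convex {y :: real ^ 'n. deg y \<le> d}"
    by (rule convexI) (simp, metis (no_types, lifting) add_mono convex_bound_le deg_simps(1,2))
  then have "convex hull (X \<inter> int_lattice) \<subseteq> {y. deg y \<le> d}" using assms(1) by (intro hull_minimal) auto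
  then show ?thesis using hull_X assms(2) by blast
qed

end

subsection \<open>Truncated simplices\<close>

lemma two_simplex_iff: "y \<in> two_simplex \<longleftrightarrow> (\<forall>k. 0 \<le> y $ k) \<and> deg y \<le> 2"
  unfolding two_simplex_def deg_def by simp

lemma convex_two_simplex: "convex (two_simplex :: (real ^ 'n) set)"
proof (rule convexI)
  fix x y :: "real ^ 'n" and s t :: real
  assume "x \<in> two_simplex" "y \<in> two_simplex" "0 \<le> s" "0 \<le> t" "s + t = 1"
  moreover from this have "s * deg x + t * deg y \<le> 2"
    by (intro convex_bound_le) (auto simp: two_simplex_iff)
  ultimately show "s *\<^sub>R x + t *\<^sub>R y \<in> two_simplex" by (auto simp: two_simplex_iff)
qed

text \<open>The face is twice the convex hull of the unit vectors indexed by \<open>T\<close>, from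
  which its dimension is read off.\<close>

lemma two_simplex_face:
  fixes T :: "'n::finite set"
  shows "two_simplex \<inter> {x. (\<Sum>i\<in>T. \<e> i) \<bullet> x = 2} face_of two_simplex"
    and "aff_dim (two_simplex \<inter> {x. (\<Sum>i\<in>T. \<e> i) \<bullet> x = 2}) = int (card T) - 1"
proof -
  have ip: "(\<Sum>i\<in>T. \<e> i) \<bullet> x = (\<Sum>i\<in>T. x $ i)" for x :: "real ^ 'n"
    by (simp add: inner_sum_left inner_axis')
  have le: "(\<Sum>i\<in>T. x $ i) \<le> deg x" if "\<forall>k. 0 \<le> x $ k" for x :: "real ^ 'n"
    unfolding deg_def using that by (intro sum_mono2) auto
  show "two_simplex \<inter> {x. (\<Sum>i\<in>T. \<e> i) \<bullet> x = 2} face_of two_simplex"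
  proof (rule face_of_Int_supporting_hyperplane_le[OF convex_two_simplex])
    fix x :: "real ^ 'n" assume "x \<in> two_simplex"
    then show "(\<Sum>i\<in>T. \<e> i) \<bullet> x \<le> 2" unfolding ip using le[of x] by (auto simp: two_simplex_iff)
  qed
  define H where "H = convex hull ((\<e> :: 'n \<Rightarrow> real ^ 'n) ` T)"
  have eq: "two_simplex \<inter> {x. (\<Sum>i\<in>T. \<e> i) \<bullet> x = 2} = (\<lambda>x. 2 *\<^sub>R x) ` H"
  proof
    show "two_simplex \<inter> {x. (\<Sum>i\<in>T. \<e> i) \<bullet> x = 2} \<subseteq> (\<lambda>x. 2 *\<^sub>R x) ` H"
    proof
      fix x :: "real ^ 'n" assume "x \<in> two_simplex \<inter> {x. (\<Sum>i\<in>T. \<e> i) \<bullet> x = 2}"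
      then have x: "\<forall>k. 0 \<le> x $ k" "deg x \<le> 2" "(\<Sum>i\<in>T. x $ i) = 2" by (auto simp: two_simplex_iff ip)
      have "deg x = (\<Sum>i\<in>T. x $ i) + (\<Sum>i\<in>- T. x $ i)"
        unfolding deg_def using sum.union_disjoint[of T "- T" "\<lambda>i. x $ i"] by (simp add: Compl_partition)
      then have "(\<Sum>i\<in>- T. x $ i) \<le> 0" using x by simp
      moreover have "0 \<le> (\<Sum>i\<in>- T. x $ i)" using x(1) by (intro sum_nonneg) auto
      ultimately have "(\<Sum>i\<in>- T. x $ i) = 0" by simp
      then have out: "\<forall>i\<in>- T. x $ i = 0" using x(1) by (subst (asm) sum_nonneg_eq_0_iff) auto
      have "x = (\<Sum>i\<in>UNIV. x $ i *\<^sub>R \<e> i)" by (rule vec_sum_units)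
      also have "\<dots> = (\<Sum>i\<in>T. x $ i *\<^sub>R \<e> i)" using out by (intro sum.mono_neutral_right) auto
      also have "\<dots> = 2 *\<^sub>R (\<Sum>i\<in>T. (x $ i / 2) *\<^sub>R \<e> i)" by (simp add: scaleR_sum_right)
      finally have "x = 2 *\<^sub>R (\<Sum>i\<in>T. (x $ i / 2) *\<^sub>R \<e> i)" .
      moreover have "(\<Sum>i\<in>T. (x $ i / 2) *\<^sub>R \<e> i) \<in> H"
        unfolding H_def using x(1,3)
        by (intro convex_sum convex_convex_hull) (auto simp: hull_inc simp flip: sum_divide_distrib)
      ultimately show "x \<in> (\<lambda>x. 2 *\<^sub>R x) ` H" by blast
    qed
    have "convex {x :: real ^ 'n. 2 *\<^sub>R x \<in> two_simplex \<inter> {x. (\<Sum>i\<in>T. \<e> i) \<bullet> x = 2}}"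
    proof -
      have "convex ((\<lambda>x. 2 *\<^sub>R x) -` (two_simplex \<inter> {x :: real ^ 'n. (\<Sum>i\<in>T. \<e> i) \<bullet> x = 2}))"
        by (intro convex_linear_vimage convex_Int convex_two_simplex convex_hyperplane)
          (auto intro: linearI simp: scaleR_add_right)
      then show ?thesis by (simp add: vimage_def)
    qed
    moreover have "2 *\<^sub>R \<e> i \<in> two_simplex \<inter> {x. (\<Sum>i\<in>T. \<e> i) \<bullet> x = 2}" if "i \<in> T" for i
    proof -
      have "(\<Sum>j\<in>T. (2 *\<^sub>R (\<e> i :: real ^ 'n)) $ j) = (\<Sum>j\<in>T. if j = i then 2 else 0)"
        by (intro sum.cong) (auto simp: unit_nth)
      then show ?thesis using that by (simp add: two_simplex_iff ip unit_nth)
    qed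
    ultimately have "H \<subseteq> {x. 2 *\<^sub>R x \<in> two_simplex \<inter> {x. (\<Sum>i\<in>T. \<e> i) \<bullet> x = 2}}"
      unfolding H_def by (intro hull_minimal) auto
    then show "(\<lambda>x. 2 *\<^sub>R x) ` H \<subseteq> two_simplex \<inter> {x. (\<Sum>i\<in>T. \<e> i) \<bullet> x = 2}" by blast
  qed
  have "independent ((\<e> :: 'n \<Rightarrow> real ^ 'n) ` T)"
    by (rule independent_mono[OF independent_Basis]) (auto simp: Basis_vec_def)
  then have "\<not> affine_dependent ((\<e> :: 'n \<Rightarrow> real ^ 'n) ` T)" using affine_dependent_imp_dependent by blast
  then have "aff_dim H = int (card ((\<e> :: 'n \<Rightarrow> real ^ 'n) ` T)) - 1"
    unfolding H_def aff_dim_convex_hull using affine_independent_iff_card by blast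
  also have "card ((\<e> :: 'n \<Rightarrow> real ^ 'n) ` T) = card T"
    by (intro card_image inj_onI) (simp add: axis_eq_axis)
  finally have "aff_dim H = int (card T) - 1" .
  moreover have "aff_dim ((\<lambda>x. 2 *\<^sub>R x) ` H) = aff_dim H"
    by (intro aff_dim_injective_linear_image) (auto intro: linearI injI simp: scaleR_add_right)
  ultimately show "aff_dim (two_simplex \<inter> {x. (\<Sum>i\<in>T. \<e> i) \<bullet> x = 2}) = int (card T) - 1"
    unfolding eq by simp
qed

subsection \<open>Classification of the corner charts\<close>

text \<open>Equivalently, the lattice points of degree at least \<open>2\<close> span the space affinely.\<close>

definition full_rank :: "(real ^ 'n) set \<Rightarrow> bool" where
  "full_rank X \<longleftrightarrow> (\<forall>\<alpha> \<beta>. (\<forall>y\<in>X \<inter> int_lattice. 2 \<le> deg y \<longrightarrow> \<alpha> \<bullet> y = \<beta>) \<longrightarrow> \<alpha> = 0)"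

text \<open>The points \<open>\<e> i + \<e> j\<close> with \<open>i\<close> fixed are affinely
  independent, and there are at most \<open>CARD('n)\<close> of them; this is the case where the
  secants fill the space.\<close>

definition thin :: "(real ^ 'n) set \<Rightarrow> bool" where
  "thin X \<longleftrightarrow> (\<exists>i. \<forall>y\<in>X \<inter> int_lattice. 2 \<le> deg y \<longrightarrow> (\<exists>j. y = \<e> i + \<e> j))"

definition exceptional :: "(real ^ 'n) set \<Rightarrow> bool" where
  "exceptional X \<longleftrightarrow> (2 \<le> CARD('n) \<and> X = two_simplex) \<or>
     (\<exists>k. k + 3 \<le> CARD('n) \<and> is_truncated_two_simplex k X) \<or>
     (\<exists>I. 2 \<le> card I \<and> card I + 2 \<le> CARD('n) \<and> X = simplex_product I)"

lemma inner_unit: "\<alpha> \<bullet> \<e> i = \<alpha> $ i"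
  by (simp add: inner_axis)

lemma full_rankI:
  assumes "\<And>\<alpha> \<beta>. (\<And>y. y \<in> X \<Longrightarrow> y \<in> int_lattice \<Longrightarrow> 2 \<le> deg y \<Longrightarrow> \<alpha> \<bullet> y = \<beta>) \<Longrightarrow> \<forall>i. \<alpha> $ i = 0"
  shows "full_rank X"
  unfolding full_rank_def
proof (intro allI impI)
  fix \<alpha> \<beta> assume "\<forall>y\<in>X \<inter> int_lattice. 2 \<le> deg y \<longrightarrow> \<alpha> \<bullet> y = \<beta>"
  then have "\<forall>i. \<alpha> $ i = 0" by (intro assms[of \<alpha> \<beta>]) auto
  then show "\<alpha> = 0" by (simp add: vec_eq_iff)
qed

lemma inner_const_deg: "(\<And>i. \<alpha> $ i = s) \<Longrightarrow> \<alpha> \<bullet> y = s * deg y"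
  unfolding inner_vec_def deg_def by (simp add: sum_distrib_left)

text \<open>The hypothesis leaves degree 2 as the only hyperplane that could contain all points in
  question, and \<open>q\<close> does not lie on it.\<close>

lemma full_rank_of_half:
  assumes half: "\<And>\<alpha> \<beta>. (\<And>y. y \<in> X \<Longrightarrow> y \<in> int_lattice \<Longrightarrow> 2 \<le> deg y \<Longrightarrow> \<alpha> \<bullet> y = \<beta>) \<Longrightarrow> \<forall>i. \<alpha> $ i = \<beta> / 2"
    and q: "q \<in> X \<inter> int_lattice" "deg q > 2"
  shows "full_rank X"
proof (rule full_rankI)
  fix \<alpha> \<beta> assume *: "\<And>y. y \<in> X \<Longrightarrow> y \<in> int_lattice \<Longrightarrow> 2 \<le> deg y \<Longrightarrow> \<alpha> \<bullet> y = \<beta>"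
  have h: "\<forall>i. \<alpha> $ i = \<beta> / 2" using half[OF *] by blast
  then have "\<beta> / 2 * deg q = \<beta>" using *[of q] q inner_const_deg[of \<alpha> "\<beta> / 2" q] by simp
  then have "\<beta> * (deg q - 2) = 0" by (simp add: algebra_simps)
  then show "\<forall>i. \<alpha> $ i = 0" using h q(2) by simp
qed

section \<open>The two cases of the classification: a long edge, and unit edges only\<close>

context polytope_corner
begin

lemma lattice_nonneg: "y \<in> X \<inter> int_lattice \<Longrightarrow> \<forall>k. 0 \<le> y $ k"
  using nonneg by blast

lemma small_lattice_points:
  assumes "\<And>y. y \<in> X \<inter> int_lattice \<Longrightarrow> deg y \<le> 2" "y \<in> X \<inter> int_lattice"
  shows "y = 0 \<or> (\<exists>i. y = \<e> i) \<or> (\<exists>i j. y = \<e> i + \<e> j)"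
proof (cases "deg y < 2")
  case True
  then show ?thesis using lattice_deg_le_1[of y] lattice_nonneg[OF assms(2)] assms(2) by blast
next
  case False
  then show ?thesis using lattice_deg_2[of y] lattice_nonneg[OF assms(2)] assms by fastforce
qed

text \<open>The points \<open>\<e> i1 + \<e> j\<close>, including \<open>j = i1\<close>, force every
  normal vector to be constant, so a point of degree above 2 gives full rank. Otherwise the chart
  lies in \<open>two_simplex\<close>, and it is determined by the set of directions with a long
  edge.\<close>

lemma classification_long_edge:
  assumes i1: "a i1 \<ge> 2"
  shows "full_rank X \<or> thin X \<or> exceptional X"
proof (cases "\<exists>q\<in>X \<inter> int_lattice. deg q > 2")
  case True
  then obtain q where q: "q \<in> X \<inter> int_lattice" "deg q > 2" by blast
  have "full_rank X"
  proof (rule full_rank_of_half[OF _ q])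
    fix \<alpha> \<beta> assume *: "\<And>y. y \<in> X \<Longrightarrow> y \<in> int_lattice \<Longrightarrow> 2 \<le> deg y \<Longrightarrow> \<alpha> \<bullet> y = \<beta>"
    have pair: "\<alpha> $ i1 + \<alpha> $ j = \<beta>" for j
    proof -
      have "\<e> i1 + \<e> j \<in> int_lattice" by (intro int_lattice_add axis_in_lattice)
      from *[OF long_pair[OF i1] this] show ?thesis by (simp add: inner_add_right inner_unit)
    qed
    have "\<alpha> $ j = \<beta> / 2" for j using pair[of i1] pair[of j] by simp
    then show "\<forall>i. \<alpha> $ i = \<beta> / 2" by blast
  qed
  then show ?thesis by blast
next
  case False
  then have L2: "deg y \<le> 2" if "y \<in> X \<inter> int_lattice" for y using that by force
  have X2: "deg y \<le> 2" if "y \<in> X" for y by (rule deg_bound[OF L2 that])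
  define S where "S = {i. a i \<ge> 2}"
  have a1: "a i = 1" if "i \<notin> S" for i using that a_ge_1[of i] unfolding S_def by simp
  have pairs: "\<e> i + \<e> j \<in> X \<longleftrightarrow> i \<in> S \<or> j \<in> S" for i j
  proof
    assume ij: "\<e> i + \<e> j \<in> X"
    show "i \<in> S \<or> j \<in> S"
    proof (rule ccontr)
      assume "\<not> ?thesis"
      then have n: "i \<notin> S" "j \<notin> S" by auto
      have "i1 \<in> S" using i1 unfolding S_def by simp
      show False
      proof (cases "i = j")
        case True
        then have "2 *\<^sub>R \<e> i \<in> X" using ij by (simp add: scaleR_2)
        from upper[OF this, of i] show False using a1[OF n(1)] by (simp add: unit_nth)
      next
        case False
        \<comment> \<open>Two short directions whose sum belongs to \<open>X\<close> would form a
          flat triple with the long direction \<open>i1\<close>.\<close>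
        show False
          using no_flat_triple[OF False _ _ a1[OF n(1)] a1[OF n(2)] ij _ _ X2, of i1]
            long_pair[OF i1, of i] long_pair[OF i1, of j] n \<open>i1 \<in> S\<close> by (auto simp: add.commute)
      qed
    qed
  next
    assume "i \<in> S \<or> j \<in> S"
    then show "\<e> i + \<e> j \<in> X" unfolding S_def using long_pair[of i j] long_pair[of j i] by (auto simp: add.commute)
  qed
  \<comment> \<open>The face with vertices \<open>2 *\<^sub>R \<e> i\<close> for short
    \<open>i\<close>. Its lattice points are the sums of two short unit vectors, exactly the points
    missing from \<open>X\<close>.\<close>
  define Fc where "Fc = two_simplex \<inter> {x. (\<Sum>i\<in>- S. \<e> i :: real ^ 'n) \<bullet> x = 2}"
  have ip: "(\<Sum>i\<in>- S. \<e> i) \<bullet> x = (\<Sum>i\<in>- S. x $ i)" for x :: "real ^ 'n"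
    by (simp add: inner_sum_left inner_axis')
  have lattice: "X \<inter> int_lattice = (two_simplex - Fc) \<inter> int_lattice"
  proof (intro equalityI subsetI)
    fix y assume y: "y \<in> X \<inter> int_lattice"
    have ts: "y \<in> two_simplex" using lattice_nonneg[OF y] L2[OF y] by (simp add: two_simplex_iff)
    have "(\<Sum>k\<in>- S. y $ k) \<noteq> 2"
    proof
      assume sum2: "(\<Sum>k\<in>- S. y $ k) = 2"
      have unit_sum: "(\<Sum>k\<in>- S. (\<e> i :: real ^ 'n) $ k) = (if i \<in> S then 0 else 1)" for i
      proof -
        have "(\<Sum>k\<in>- S. (\<e> i :: real ^ 'n) $ k) = (\<Sum>k\<in>- S. if k = i then 1 else 0)"
          by (intro sum.cong) (auto simp: unit_nth)
        then show ?thesis by simp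
      qed
      have "y = 0 \<or> (\<exists>i. y = \<e> i) \<or> (\<exists>i j. y = \<e> i + \<e> j)"
        by (rule small_lattice_points[OF _ y]) (rule L2)
      then show False
      proof (elim disjE exE)
        assume "y = 0" then show False using sum2 by simp
      next
        fix i assume "y = \<e> i" then show False using sum2 unit_sum[of i] by (simp split: if_splits)
      next
        fix i j assume yij: "y = \<e> i + \<e> j"
        then have "i \<in> S \<or> j \<in> S" using pairs y by blast
        then show False using sum2 unit_sum[of i] unit_sum[of j] unfolding yij
          by (auto simp: sum.distrib split: if_splits)
      qed
    qed
    then show "y \<in> (two_simplex - Fc) \<inter> int_lattice" using ts y unfolding Fc_def ip by simp
  next
    fix y assume y: "y \<in> (two_simplex - Fc) \<inter> int_lattice"
    then have yl: "y \<in> int_lattice" and y0: "\<forall>k. 0 \<le> y $ k" and y2: "deg y \<le> 2" by (auto simp: two_simplex_iff)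
    show "y \<in> X \<inter> int_lattice"
    proof (cases "deg y < 2")
      case True
      then show ?thesis using lattice_deg_le_1[OF yl y0] zero_in unit_in yl by auto
    next
      case False
      then obtain i j where yij: "y = \<e> i + \<e> j" using lattice_deg_2[OF yl y0] y2 by fastforce
      have "i \<in> S \<or> j \<in> S"
      proof (rule ccontr)
        assume n: "\<not> ?thesis"
        have "(\<Sum>k\<in>- S. (\<e> l :: real ^ 'n) $ k) = 1" if "l \<notin> S" for l
        proof -
          have "(\<Sum>k\<in>- S. (\<e> l :: real ^ 'n) $ k) = (\<Sum>k\<in>- S. if k = l then 1 else 0)"
            by (intro sum.cong) (auto simp: unit_nth)
          then show ?thesis using that by simp
        qed
        then have "(\<Sum>k\<in>- S. y $ k) = 2" unfolding yij using n by (simp add: sum.distrib)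
        then show False using y unfolding Fc_def ip by simp
      qed
      then show ?thesis using pairs yij yl by blast
    qed
  qed
  have i1S: "i1 \<in> S" using i1 unfolding S_def by simp
  consider "S = {i1}" | "S = UNIV" "card S \<ge> 2" | "S \<noteq> UNIV" "card S \<ge> 2"
  proof (cases "S = {i1}")
    case False
    then obtain j where "j \<in> S" "j \<noteq> i1" using i1S by blast
    then have "card {i1, j} \<le> card S" using i1S by (intro card_mono) auto
    moreover have "card {i1, j} = 2" using \<open>j \<noteq> i1\<close> by simp
    ultimately have "card S \<ge> 2" by linarith
    then show ?thesis using that by blast
  qed (use that in auto)
  then show ?thesis
  proof cases
    case 1
    have "\<exists>j. y = \<e> i1 + \<e> j" if y: "y \<in> X \<inter> int_lattice" "2 \<le> deg y" for y
    proof -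
      obtain i j where yij: "y = \<e> i + \<e> j"
        using lattice_deg_2[of y] y lattice_nonneg[OF y(1)] L2[OF y(1)] by fastforce
      then have "i = i1 \<or> j = i1" using pairs[of i j] y 1 by auto
      then show ?thesis using yij by (auto simp: add.commute)
    qed
    then show ?thesis unfolding thin_def by blast
  next
    case 2
    have "y \<in> X" if "y \<in> two_simplex" for y
    proof -
      have "0 + (\<Sum>i\<in>UNIV. y $ i *\<^sub>R \<e> i) \<in> X"
      proof (rule convex_sum_units[OF convex_X zero_in])
        show "0 + 2 *\<^sub>R \<e> i \<in> X" for i using pairs[of i i] 2 by (simp add: scaleR_2)
        show "(\<Sum>i\<in>UNIV. y $ i) \<le> 2" using that by (simp add: two_simplex_iff deg_def)
      qed (use that in \<open>auto simp: two_simplex_iff\<close>)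
      then show ?thesis using vec_sum_units[of y] by simp
    qed
    moreover have "y \<in> two_simplex" if "y \<in> X" for y using that nonneg X2 by (simp add: two_simplex_iff)
    ultimately have "X = two_simplex" by blast
    then show ?thesis unfolding exceptional_def using 2 by simp
  next
    case 3
    \<comment> \<open>A simplex with \<open>card (- S)\<close> vertices has this dimension, and
      \<open>card S \<ge> 2\<close> yields \<open>k + 3 \<le> CARD('n)\<close>.\<close>
    define k where "k = card (- S) - 1"
    have cS: "card (- S) + card S = CARD('n)"
      using card_Un_disjoint[of "- S" S] by (simp add: Un_commute)
    have "card (- S) \<ge> 1" using 3(1) by (metis Compl_UNIV_eq One_nat_def Suc_leI boolean_algebra.compl_zero card_gt_0_iff double_compl finite)
    then have k: "int (card (- S)) - 1 = int k" unfolding k_def by simp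
    have "is_truncated_two_simplex k X"
      unfolding is_truncated_two_simplex_def
    proof (intro exI[of _ Fc] conjI)
      show "Fc face_of two_simplex" unfolding Fc_def by (rule two_simplex_face(1))
      show "aff_dim Fc = int k" unfolding Fc_def two_simplex_face(2) k ..
      show "X = convex hull ((two_simplex - Fc) \<inter> int_lattice)"
        unfolding lattice[symmetric] by (rule X_eq_hull)
    qed
    moreover have "k + 3 \<le> CARD('n)" using cS 3(2) \<open>card (- S) \<ge> 1\<close> unfolding k_def by simp
    ultimately show ?thesis unfolding exceptional_def by blast
  qed
qed

lemma simplex_product_in:
  assumes y: "y \<in> simplex_product I" and pairs: "\<And>i j. i \<in> I \<Longrightarrow> j \<notin> I \<Longrightarrow> \<e> i + \<e> j \<in> X"
  shows "y \<in> X"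
proof -
  have y0: "0 \<le> y $ i" for i using y unfolding simplex_product_def by blast
  have sums: "(\<Sum>i\<in>I. y $ i) \<le> 1" "(\<Sum>i\<in>- I. y $ i) \<le> 1" using y unfolding simplex_product_def by auto
  define z where "z = (\<Sum>i\<in>- I. y $ i *\<^sub>R (\<e> i :: real ^ 'n))"
  have z: "p + z \<in> X" if "p \<in> X" "\<And>j. j \<notin> I \<Longrightarrow> p + \<e> j \<in> X" for p
    unfolding z_def using convex_sum_units[OF convex_X that(1), of "- I" 1 y] that(2) y0 sums by simp
  have "z + (\<Sum>i\<in>I. y $ i *\<^sub>R \<e> i) \<in> X"
  proof (rule convex_sum_units[OF convex_X, where s = 1])
    show "z \<in> X" using z[OF zero_in] unit_in by simp
    show "z + 1 *\<^sub>R \<e> i \<in> X" if "i \<in> I" for i using z[OF unit_in pairs[OF that]] by (simp add: add.commute)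
  qed (use y0 sums in auto)
  moreover have "z + (\<Sum>i\<in>I. y $ i *\<^sub>R \<e> i) = y"
  proof -
    have "(\<Sum>i\<in>UNIV. y $ i *\<^sub>R \<e> i) = (\<Sum>i\<in>- I. y $ i *\<^sub>R \<e> i) + (\<Sum>i\<in>I. y $ i *\<^sub>R (\<e> i :: real ^ 'n))"
      by (subst sum.union_disjoint[symmetric]) auto
    then show ?thesis unfolding z_def using vec_sum_units[of y] by simp
  qed
  ultimately show ?thesis by simp
qed

text \<open>Non-adjacency is an equivalence relation, so \<open>adj\<close> is a complete
  multipartite graph. One class gives a unimodular simplex, three or more give full rank, and two
  give a product of simplices or full rank. The hypothesis concerns all corners because it is also
  applied at a neighbour.\<close>

lemma classification_unit_edges:
  assumes unit_edges: "\<And>u V i. corner P u V \<Longrightarrow> 2 *\<^sub>R \<e> i \<notin> chart P u V"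
  shows "full_rank X \<or> thin X \<or> exceptional X"
proof -
  have a1: "a i = 1" for i
  proof (rule ccontr)
    assume "a i \<noteq> 1"
    then have "2 \<le> real (a i)" using a_ge_1[of i] by simp
    then have "2 *\<^sub>R \<e> i \<in> X" by (intro axis_segment) auto
    then show False using unit_edges[OF corner] by blast
  qed
  define adj where "adj i j \<longleftrightarrow> \<e> i + \<e> j \<in> X" for i j
  have adj_sym: "adj i j \<longleftrightarrow> adj j i" for i j unfolding adj_def by (simp add: add.commute)
  have not_refl: "\<not> adj i i" for i
    using unit_edges[OF corner, of i] unfolding adj_def by (simp add: scaleR_2)
  have adj_c: "adj i j \<longleftrightarrow> 0 \<le> c i j" if "i \<noteq> j" for i j
    unfolding adj_def using pair_iff[of j i] a1 that by simp
  have nadj_c: "c i j = -1" if "i \<noteq> j" "\<not> adj i j" for i j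
    using adj_c[OF that(1)] that shift_nonneg[of j i] a1[of i] by simp
  have nadj_trans: "\<not> adj i k" if ij: "\<not> adj i j" and jk: "\<not> adj j k" for i j k
  proof
    assume ik: "adj i k"
    have ne: "i \<noteq> j" "k \<noteq> j" "i \<noteq> k" using ik ij jk adj_sym not_refl by metis+
    have "c j i = -1" "c j k = -1" using nadj_c ne ij jk adj_sym by metis+
    \<comment> \<open>With \<open>c j i = c j k = -1\<close> the bound in direction \<open>j\<close>
      at \<open>\<e> i + \<e> k\<close> would read \<open>0 \<le> 1 - 1 - 1\<close>.\<close>
    then show False using upper[of "\<e> i + \<e> k" j] ik ne a1[of j] unfolding adj_def by (simp add: unit_nth)
  qed
  have inL: "\<e> i + \<e> j \<in> int_lattice" for i j :: 'n by (intro int_lattice_add axis_in_lattice)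
  show ?thesis
  proof (cases "\<exists>p q. adj p q")
    case False
    have "deg y < 2" if "y \<in> X" for y
    proof -
      fix i :: 'n
      \<comment> \<open>All \<open>c i j\<close> are -1, so the facet inequality in any direction
        says \<open>deg y \<le> 1\<close>.\<close>
      have "slope (c i) i y = - (\<Sum>j\<in>- {i}. y $ j)"
        unfolding slope_def sum_negf[symmetric] using nadj_c False by (intro sum.cong) auto
      moreover have "deg y = y $ i + (\<Sum>j\<in>- {i}. y $ j)"
        unfolding deg_def by (subst sum.remove[of UNIV i]) (auto simp: Compl_eq_Diff_UNIV)
      ultimately show ?thesis using upper[OF that, of i] a1[of i] by simp
    qed
    then show ?thesis unfolding thin_def by force
  next
    case True
    then obtain p q where pq: "adj p q" by blast
    define C where "C = {i. \<not> adj p i}"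
    define D where "D = {i. \<not> adj q i}"
    have pC: "p \<in> C" and qD: "q \<in> D" unfolding C_def D_def using not_refl by auto
    have disj: "C \<inter> D = {}" unfolding C_def D_def using pq nadj_trans adj_sym by blast
    show ?thesis
    proof (cases "C \<union> D = UNIV")
      case False
      \<comment> \<open>\<open>p\<close>, \<open>q\<close> and \<open>k\<close> lie in three
        different classes. Their pairwise sums force \<open>\<beta> / 2\<close> on a normal vector,
        and \<open>no_flat_triple\<close> provides a point of degree above 2.\<close>
      then obtain k where k: "adj p k" "adj q k" unfolding C_def D_def by blast
      have ne: "p \<noteq> q" "p \<noteq> k" "q \<noteq> k" using pq k not_refl by auto
      have "\<exists>y\<in>X \<inter> int_lattice. deg y > 2"
      proof (rule ccontr)
        assume "\<not> ?thesis"
        then have "deg y \<le> 2" if "y \<in> X" for y by (intro deg_bound[OF _ that]) force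
        then show False
          using no_flat_triple[OF ne a1 a1] pq k unfolding adj_def by blast
      qed
      then obtain y0 where y0: "y0 \<in> X \<inter> int_lattice" "deg y0 > 2" by blast
      have "full_rank X"
      proof (rule full_rank_of_half[OF _ y0])
        fix \<alpha> \<beta> assume *: "\<And>y. y \<in> X \<Longrightarrow> y \<in> int_lattice \<Longrightarrow> 2 \<le> deg y \<Longrightarrow> \<alpha> \<bullet> y = \<beta>"
        have pair: "\<alpha> $ i + \<alpha> $ j = \<beta>" if "adj i j" for i j
          using *[of "\<e> i + \<e> j"] that inL unfolding adj_def by (simp add: inner_add_right inner_unit)
        have pqk: "\<alpha> $ p = \<beta> / 2" "\<alpha> $ q = \<beta> / 2"
          using pair[OF pq] pair[OF k(1)] pair[OF k(2)] by simp_all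
        have "\<alpha> $ l = \<beta> / 2" for l
        proof -
          have "adj p l \<or> adj q l" using disj unfolding C_def D_def by blast
          then show ?thesis using pair[of p l] pair[of q l] pqk by auto
        qed
        then show "\<forall>i. \<alpha> $ i = \<beta> / 2" by blast
      qed
      then show ?thesis by blast
    next
      case True
      then have D: "D = - C" using disj by blast
      have cross: "adj i j" if "i \<in> C" "j \<notin> C" for i j
      proof (rule ccontr)
        assume "\<not> adj i j"
        moreover have "\<not> adj p i" using that(1) unfolding C_def by blast
        moreover have "\<not> adj j q" using that(2) D adj_sym unfolding D_def by blast
        ultimately show False using nadj_trans pq by blast
      qed
      have within: "\<not> adj i j" if "(i \<in> C \<and> j \<in> C) \<or> (i \<notin> C \<and> j \<notin> C)" for i j
      proof -
        have "\<not> adj i j" if "\<not> adj s i" "\<not> adj s j" for s using that nadj_trans adj_sym by blast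
        then show ?thesis using that D unfolding C_def D_def by blast
      qed
      \<comment> \<open>If \<open>c j i\<close> were 0, the point
        \<open>\<e> j + 2 *\<^sub>R \<e> i\<close> would appear as \<open>2 *\<^sub>R \<e> i\<close>
        at the neighbouring corner along \<open>j\<close>, against the absence of long
        edges.\<close>
      have both: "c j i \<ge> 1" if ij: "adj i j" "c i j \<ge> 1" for i j
      proof (rule ccontr)
        assume n: "\<not> ?thesis"
        have ne: "i \<noteq> j" using ij(1) not_refl by auto
        have cji: "c j i = 0" using n adj_c[of j i] ij adj_sym ne by auto
        have "\<e> j + 2 *\<^sub>R \<e> i \<in> X" using shift_segment[of j i 2] ne ij(2) a1[of i] by simp
        moreover have "transition j (a j) (c j) (2 *\<^sub>R \<e> i) = \<e> j + 2 *\<^sub>R \<e> i"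
          using ne a1[of j] cji by (simp add: transition_def vec_eq_iff) (simp add: axis_def)
        ultimately have "2 *\<^sub>R \<e> i \<in> chart P (v + real (a j) *\<^sub>R W j) (corner_step W j (c j))"
          unfolding chart_transition by simp
        then show False using unit_edges[OF step] by blast
      qed
      show ?thesis
      proof (cases "\<exists>i j. adj i j \<and> c i j \<ge> 1")
        case True
        then obtain i j where ij: "adj i j" "c i j \<ge> 1" by blast
        have ji: "c j i \<ge> 1" using both[OF ij] .
        have ne: "i \<noteq> j" using ij(1) not_refl by auto
        have "\<e> j + 2 *\<^sub>R \<e> i \<in> X" "\<e> i + 2 *\<^sub>R \<e> j \<in> X"
          using shift_segment[of j i 2] shift_segment[of i j 2] ne ij(2) ji a1 by simp_all
        moreover have "\<e> s + 2 *\<^sub>R \<e> t \<in> int_lattice" for s t :: 'n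
          by (intro int_lattice_add int_lattice_scale axis_in_lattice) auto
        moreover have "full_rank X" if pts: "\<e> j + 2 *\<^sub>R \<e> i \<in> X" "\<e> i + 2 *\<^sub>R \<e> j \<in> X"
          and lat: "\<And>s t :: 'n. \<e> s + 2 *\<^sub>R \<e> t \<in> int_lattice"
        proof (rule full_rankI)
          fix \<alpha> \<beta> assume *: "\<And>y. y \<in> X \<Longrightarrow> y \<in> int_lattice \<Longrightarrow> 2 \<le> deg y \<Longrightarrow> \<alpha> \<bullet> y = \<beta>"
          have pair: "\<alpha> $ s + \<alpha> $ t = \<beta>" if "adj s t" for s t
            using *[of "\<e> s + \<e> t"] that inL unfolding adj_def by (simp add: inner_add_right inner_unit)
          \<comment> \<open>Subtracting the relation at \<open>\<e> i + \<e> j\<close> from these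
            two gives \<open>\<alpha> $ i = \<alpha> $ j = 0\<close>, hence
            \<open>\<beta> = 0\<close>; every other index is adjacent to \<open>i\<close> or to
            \<open>j\<close>.\<close>
          have "\<alpha> $ j + 2 * \<alpha> $ i = \<beta>" "\<alpha> $ i + 2 * \<alpha> $ j = \<beta>"
            using *[OF pts(1) lat] *[OF pts(2) lat] by (simp_all add: inner_add_right inner_unit)
          then have z: "\<alpha> $ i = 0" "\<alpha> $ j = 0" "\<beta> = 0" using pair[OF ij(1)] by simp_all
          have "\<alpha> $ l = 0" for l
          proof -
            have "adj i l \<or> adj j l" using within cross ij(1) adj_sym by metis
            then show ?thesis using pair[of i l] pair[of j l] z by auto
          qed
          then show "\<forall>i. \<alpha> $ i = 0" by blast
        qed
        ultimately show ?thesis by blast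
      next
        case False
        have c0: "c i j = 0" if "adj i j" for i j
        proof -
          have "i \<noteq> j" using that not_refl by auto
          then have "0 \<le> c i j" using adj_c that by blast
          moreover have "\<not> c i j \<ge> 1" using False that by blast
          ultimately show ?thesis by linarith
        qed
        \<comment> \<open>Within a class \<open>c\<close> is -1 and across classes it is 0, so each
          facet inequality bounds the coordinate sum of one class by 1.\<close>
        have block: "(\<Sum>j\<in>B. y $ j) \<le> 1" if y: "y \<in> X" and B: "B = C \<or> B = - C" and i: "i \<in> B" for y B i
        proof -
          have "slope (c i) i y = (\<Sum>j\<in>- {i}. if j \<in> B then - (y $ j) else 0)"
            unfolding slope_def
          proof (rule sum.cong[OF refl])
            fix j assume "j \<in> - {i}"
            then have "i \<noteq> j" by auto
            show "of_int (c i j) * y $ j = (if j \<in> B then - (y $ j) else 0)"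
            proof (cases "j \<in> B")
              case True
              then have "\<not> adj i j" using within B i by auto
              then show ?thesis using True nadj_c[OF \<open>i \<noteq> j\<close>] by simp
            next
              case False
              then have "adj i j" using cross[of i j] cross[of j i] B i adj_sym by auto
              then show ?thesis using False c0 by simp
            qed
          qed
          also have "\<dots> = - (\<Sum>j\<in>B - {i}. y $ j)"
            by (simp add: sum.If_cases sum_negf Int_commute Diff_eq[symmetric])
          finally have "slope (c i) i y = - (\<Sum>j\<in>B - {i}. y $ j)" .
          moreover have "(\<Sum>j\<in>B. y $ j) = y $ i + (\<Sum>j\<in>B - {i}. y $ j)"
            using i by (intro sum.remove) auto
          ultimately show ?thesis using upper[OF y, of i] a1[of i] by simp
        qed
        have qC: "q \<in> - C" using qD D by blast
        have "y \<in> simplex_product C" if "y \<in> X" for y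
          unfolding simplex_product_def using nonneg[OF that] block[OF that _ pC] block[OF that _ qC] by simp
        moreover have "y \<in> X" if "y \<in> simplex_product C" for y
          using simplex_product_in[OF that] cross unfolding adj_def by blast
        ultimately have prod: "X = simplex_product C" by blast
        have points: "\<exists>i j. i \<in> C \<and> j \<in> - C \<and> y = \<e> i + \<e> j" if y: "y \<in> X \<inter> int_lattice" "2 \<le> deg y" for y
        proof -
          have "deg y = (\<Sum>j\<in>C. y $ j) + (\<Sum>j\<in>- C. y $ j)"
            unfolding deg_def by (subst sum.union_disjoint[symmetric]) (auto simp: Compl_partition)
          then have "deg y \<le> 2" using block[of y C p] block[of y "- C" q] y pC qC by simp
          then obtain i j where yij: "y = \<e> i + \<e> j"
            using lattice_deg_2[of y] y lattice_nonneg[OF y(1)] by fastforce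
          then have "adj i j" using y(1) unfolding adj_def by blast
          then have "(i \<in> C \<and> j \<in> - C) \<or> (j \<in> C \<and> i \<in> - C)" using within by blast
          then show ?thesis using yij by (metis add.commute)
        qed
        have cC: "card (- C) + card C = CARD('n)"
          using card_Un_disjoint[of "- C" C] by (simp add: Un_commute)
        consider "card C = 1" | "card (- C) = 1" | "2 \<le> card C" "2 \<le> card (- C)"
          using pC qC card_gt_0_iff[of C] card_gt_0_iff[of "- C"] by fastforce
        then show ?thesis
        proof cases
          case 1
          then have "C = {p}" using pC by (metis card_1_singletonE singletonD)
          then show ?thesis unfolding thin_def using points by blast
        next
          case 2
          then have "- C = {q}" using qC by (metis card_1_singletonE singletonD)
          then have "\<exists>j. y = \<e> q + \<e> j" if "y \<in> X \<inter> int_lattice" "2 \<le> deg y" for y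
            using points[OF that] by (metis add.commute singletonD)
          then show ?thesis unfolding thin_def by blast
        next
          case 3
          then have "card C + 2 \<le> CARD('n)" using cC by simp
          then show ?thesis unfolding exceptional_def using prod 3(1) by blast
        qed
      qed
    qed
  qed
qed

end

text \<open>Since \<open>2 *\<^sub>R \<e> i\<close> in a chart signals a long edge, a corner with
  such a point is preferred; if none exists, any corner will do.\<close>

theorem (in smooth_full_polytope) corner_classification:
  obtains v W where "corner P v W"
    "full_rank (chart P v W) \<or> thin (chart P v W) \<or> exceptional (chart P v W)"
proof (cases "\<exists>v W i. corner P v W \<and> 2 *\<^sub>R \<e> i \<in> chart P v W")
  case True
  then obtain v W i where vW: "corner P v W" "2 *\<^sub>R \<e> i \<in> chart P v W" by blast
  obtain a c where "polytope_corner P v W a c" using polytope_corner_exists[OF vW(1)] by blast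
  then interpret polytope_corner P v W a c .
  have "2 \<le> real (a i)" using upper[OF vW(2), of i] by (simp add: unit_nth)
  then have "2 \<le> a i" by simp
  then show ?thesis using that vW(1) classification_long_edge by blast
next
  case False
  have lat: "lattice_polytope P" using smooth unfolding smooth_polytope_def by blast
  have "polytope P" using lat by (rule lattice_polytope_polytope)
  moreover have "P \<noteq> {}" using dim by auto
  ultimately obtain v where v: "v extreme_point_of P"
    using extreme_point_exists_convex by (metis polytope_imp_compact polytope_imp_convex)
  obtain W where W: "corner P v W" by (rule corner_exists[OF smooth dim fin v])
  obtain a c where "polytope_corner P v W a c" using polytope_corner_exists[OF W] by blast
  then interpret polytope_corner P v W a c .
  show ?thesis using that W classification_unit_edges False by blast
qed

subsection \<open>Separating tori\<close>

definition restrict_vec :: "'n::finite set \<Rightarrow> real ^ 'n \<Rightarrow> real ^ 'n" where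
  "restrict_vec J y = (\<chi> j. if j \<in> J then y $ j else 0)"

lemma exp_mono_val:
  fixes J :: "'n::finite set"
  assumes "linear f" "\<forall>j. T j = (if j \<in> J then f (\<e> j) else 0)"
  shows "mono_val e (\<lambda>j. exp (T j)) = exp (f (restrict_vec J (\<chi> j. real (e j))) :: complex)"
proof -
  have "f (restrict_vec J (\<chi> j. real (e j))) = f (\<Sum>j\<in>UNIV. restrict_vec J (\<chi> j. real (e j)) $ j *\<^sub>R \<e> j)"
    using vec_sum_units[of "restrict_vec J (\<chi> j. real (e j))"] by simp
  also have "\<dots> = (\<Sum>j\<in>UNIV. restrict_vec J (\<chi> j. real (e j)) $ j *\<^sub>R f (\<e> j))"
    by (simp only: linear_sum[OF assms(1)] linear_scale[OF assms(1)])
  also have "\<dots> = (\<Sum>j\<in>UNIV. of_nat (e j) * T j)"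
    by (intro sum.cong) (auto simp: restrict_vec_def assms(2) scaleR_conv_of_real)
  finally show ?thesis
    unfolding mono_val_def by (simp add: exp_sum exp_of_nat_mult)
qed

text \<open>In logarithms the task is a linear map with prescribed values on the differences
  \<open>z J i - z J i0\<close>, which are linearly independent. The common factor \<open>b\<close>
  adjusts the value at \<open>i0\<close>.\<close>

lemma torus_separating_affine_independent:
  fixes m :: "nat \<Rightarrow> 'n::finite \<Rightarrow> nat"
  defines "z \<equiv> \<lambda>J i. restrict_vec J (\<chi> j. real (m i j))"
  assumes A: "A \<noteq> {}" "inj_on (z J) A" "\<not> affine_dependent (z J ` A)"
  shows "torus_separating m J A"
  unfolding torus_separating_def
proof (intro allI impI)
  fix y :: "nat \<Rightarrow> complex" assume y: "\<forall>i. y i \<noteq> 0"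
  obtain i0 where i0: "i0 \<in> A" using A(1) by blast
  let ?Z = "z J"
  define g where "g x = Ln (y (inv_into A ?Z (x + ?Z i0)) / y i0)" for x
  have "\<not> dependent ((\<lambda>x. - ?Z i0 + x) ` (?Z ` A - {?Z i0}))"
    using A(3) affine_dependent_iff_dependent2[of "?Z i0" "?Z ` A"] i0 by blast
  from linear_independent_extend[OF this, of g]
  obtain f where f: "linear f" "\<forall>x\<in>(\<lambda>x. - ?Z i0 + x) ` (?Z ` A - {?Z i0}). f x = g x" by blast
  define T where "T j = (if j \<in> J then f (\<e> j) else 0)" for j
  define t where "t j = exp (T j)" for j
  have t: "t \<in> subtorus J" unfolding subtorus_def t_def T_def by simp
  have mv: "mono_val (m i) t = exp (f (?Z i))" for i
    unfolding t_def z_def by (rule exp_mono_val[OF f(1)]) (simp add: T_def)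
  define b where "b = y i0 / exp (f (?Z i0))"
  have "b * mono_val (m i) t = y i" if i: "i \<in> A" for i
  proof (cases "i = i0")
    case True
    then show ?thesis unfolding mv b_def by simp
  next
    case False
    then have "?Z i \<noteq> ?Z i0" using A(2) i i0 by (auto dest: inj_onD)
    then have "f (- ?Z i0 + ?Z i) = g (- ?Z i0 + ?Z i)" using f(2) i by blast
    also have "\<dots> = Ln (y i / y i0)" unfolding g_def using A(2) i by simp
    finally have "f (?Z i) - f (?Z i0) = Ln (y i / y i0)"
      using linear_add[OF f(1), of "- ?Z i0" "?Z i"] linear_neg[OF f(1), of "?Z i0"] by simp
    then have "exp (f (?Z i)) / exp (f (?Z i0)) = y i / y i0" using y by (simp flip: exp_diff)
    then show ?thesis unfolding mv b_def using y by (simp add: field_simps)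
  qed
  then show "\<exists>b. \<exists>t\<in>subtorus J. \<forall>i\<in>A. b * mono_val (m i) t = y i" using t by blast
qed

text \<open>If the exponents projected to \<open>J\<close> spanned too little, a nonzero vector
  supported on \<open>J\<close> would be orthogonal to all their differences, so its inner product
  would be constant on \<open>A\<close>, contrary to \<open>full\<close>.\<close>

lemma full_rank_separating:
  fixes m :: "nat \<Rightarrow> 'n::finite \<Rightarrow> nat"
  assumes full: "\<And>\<alpha> \<beta>. (\<And>i. i \<in> A \<Longrightarrow> \<alpha> \<bullet> (\<chi> j. real (m i j)) = \<beta>) \<Longrightarrow> \<alpha> = 0"
  shows "\<exists>A'\<subseteq>A. card A' = card J + 1 \<and> torus_separating m J A'"
proof -
  define Y where "Y i = (\<chi> j. real (m i j))" for i
  define z where "z i = restrict_vec J (Y i)" for i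
  have "A \<noteq> {}"
  proof
    assume "A = {}"
    then have "(\<e> undefined :: real ^ 'n) = 0" by (intro full[of _ 0]) auto
    then show False by simp
  qed
  then obtain i0 where i0: "i0 \<in> A" by blast
  define L where "L = z ` A"
  have dimL: "int (card J) \<le> aff_dim L"
  proof (rule ccontr)
    assume lt: "\<not> ?thesis"
    define S where "S = (+) (- z i0) ` L"
    have "aff_dim L = int (dim S)"
      unfolding S_def by (rule aff_dim_eq_dim) (simp add: L_def i0 hull_inc)
    then have dimS: "dim S < card J" using lt by simp
    define V where "V = (\<e> :: 'n \<Rightarrow> real ^ 'n) ` J"
    have "independent V"
      unfolding V_def by (rule independent_mono[OF independent_Basis]) (auto simp: Basis_vec_def)
    moreover have "card V = card J"
      unfolding V_def by (intro card_image inj_onI) (simp add: axis_eq_axis)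
    ultimately have dimV: "dim V = card J" by (simp add: dim_eq_card_independent)
    have restr: "restrict_vec J x \<in> span V" for x
    proof -
      have "restrict_vec J x = (\<Sum>j\<in>UNIV. restrict_vec J x $ j *\<^sub>R \<e> j)" by (rule vec_sum_units)
      also have "\<dots> = (\<Sum>j\<in>J. x $ j *\<^sub>R \<e> j)"
        by (rule sum.mono_neutral_cong_right) (auto simp: restrict_vec_def)
      also have "\<dots> \<in> span V" unfolding V_def by (intro span_sum span_scale span_base) auto
      finally show ?thesis .
    qed
    have "S \<subseteq> span V"
      unfolding S_def L_def z_def using restr span_diff[OF restr restr] by (auto simp: algebra_simps)
    then have "span S \<subseteq> span V" by (simp add: span_minimal)
    moreover have "span S \<noteq> span V" using span_eq_dim[of S V] dimS dimV by auto
    ultimately have "span S \<subset> span V" by blast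
    then obtain \<alpha> where \<alpha>: "\<alpha> \<noteq> 0" "\<alpha> \<in> span V" "\<And>y. y \<in> span S \<Longrightarrow> orthogonal \<alpha> y"
      by (rule orthogonal_to_subspace_exists_gen) blast
    have "span V \<subseteq> {x. \<forall>j. j \<notin> J \<longrightarrow> x $ j = 0}"
    proof (rule span_minimal)
      show "V \<subseteq> {x. \<forall>j. j \<notin> J \<longrightarrow> x $ j = 0}" unfolding V_def by (auto simp: unit_nth)
      show "subspace {x :: real ^ 'n. \<forall>j. j \<notin> J \<longrightarrow> x $ j = 0}" unfolding subspace_def by simp
    qed
    then have \<alpha>J: "\<alpha> $ j = 0" if "j \<notin> J" for j using \<alpha>(2) that by blast
    have \<alpha>Y: "\<alpha> \<bullet> Y i = \<alpha> \<bullet> z i" for i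
      unfolding inner_vec_def z_def restrict_vec_def using \<alpha>J by (intro sum.cong) auto
    have "\<alpha> \<bullet> Y i = \<alpha> \<bullet> z i0" if "i \<in> A" for i
    proof -
      have "- z i0 + z i \<in> span S" unfolding S_def L_def using that by (intro span_base) blast
      then have "\<alpha> \<bullet> (- z i0 + z i) = 0" using \<alpha>(3) unfolding orthogonal_def by blast
      then show ?thesis unfolding \<alpha>Y by (simp add: inner_diff_right)
    qed
    then have "\<alpha> = 0" unfolding Y_def by (rule full)
    then show False using \<alpha>(1) by simp
  qed
  obtain B where B: "B \<subseteq> L" "\<not> affine_dependent B" "affine hull L = affine hull B"
    using affine_basis_exists[of L] by blast
  have "int (card B) = aff_dim L + 1" using aff_dim_unique[of B L] B by simp
  then have "card J + 1 \<le> card B" using dimL by linarith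
  then obtain B' where B': "B' \<subseteq> B" "card B' = card J + 1" by (metis obtain_subset_with_card_n)
  have "B' \<subseteq> z ` A" using B'(1) B(1) unfolding L_def by blast
  then obtain A' where A': "A' \<subseteq> A" "inj_on z A'" "z ` A' = B'" by (metis subset_image_inj)
  have "card A' = card J + 1" using card_image[OF A'(2)] A'(3) B'(2) by simp
  moreover have "torus_separating m J A'"
  proof (rule torus_separating_affine_independent)
    show "A' \<noteq> {}" using \<open>card A' = _\<close> by auto
    show "inj_on (\<lambda>i. restrict_vec J (\<chi> j. real (m i j))) A'" using A'(2) unfolding z_def Y_def .
    have "\<not> affine_dependent (z ` A')" using A'(3) B'(1) B(2) affine_independent_subset by blast
    then show "\<not> affine_dependent ((\<lambda>i. restrict_vec J (\<chi> j. real (m i j))) ` A')" unfolding z_def Y_def .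
  qed
  ultimately show ?thesis using A'(1) by blast
qed

lemma thin_separating:
  fixes m :: "nat \<Rightarrow> 'n::finite \<Rightarrow> nat"
  assumes \<kappa>: "inj_on \<kappa> A" "\<And>i k. i \<in> A \<Longrightarrow> m i k = (if k = p then 1 else 0) + (if k = \<kappa> i then 1 else 0)"
  shows "torus_separating m UNIV A"
  unfolding torus_separating_def
proof (intro allI impI)
  fix y :: "nat \<Rightarrow> complex" assume y: "\<forall>i. y i \<noteq> 0"
  define Y where "Y j = (if j \<in> \<kappa> ` A then y (inv_into A \<kappa> j) else 1)" for j
  have Y: "Y (\<kappa> i) = y i" if "i \<in> A" for i using that \<kappa>(1) by (simp add: Y_def)
  \<comment> \<open>Here \<open>t p = 1\<close>, so with \<open>b = Y p\<close> the value
    \<open>b * t p * t (\<kappa> i)\<close> is \<open>Y (\<kappa> i)\<close>, also when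
    \<open>\<kappa> i = p\<close>.\<close>
  define t where "t j = Y j / Y p" for j
  have Y0: "Y j \<noteq> 0" for j unfolding Y_def using y by simp
  have t: "t \<in> subtorus UNIV" unfolding subtorus_def t_def using Y0 by simp
  have "Y p * mono_val (m i) t = y i" if i: "i \<in> A" for i
  proof -
    have "mono_val (m i) t = (\<Prod>k\<in>UNIV. (if k = p then t k else 1) * (if k = \<kappa> i then t k else 1))"
      unfolding mono_val_def using \<kappa>(2)[OF i] by (intro prod.cong) auto
    also have "\<dots> = t p * t (\<kappa> i)" by (simp add: prod.distrib)
    finally show ?thesis unfolding t_def using Y0 Y[OF i] by simp
  qed
  then show "\<exists>b. \<exists>t\<in>subtorus UNIV. \<forall>i\<in>A. b * mono_val (m i) t = y i" using t by blast
qed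

subsection \<open>Characters\<close>

lemma character_add:
  assumes "x \<in> int_lattice" "y \<in> int_lattice" "t \<in> torus"
  shows "character (x + y) t = character x t * character y t"
proof -
  have "\<lfloor>(x + y) $ i\<rfloor> = \<lfloor>x $ i\<rfloor> + \<lfloor>y $ i\<rfloor>" for i
    using assms(1,2) unfolding int_lattice_def by (auto simp: Ints_def elim!: allE[of _ i])
  then show ?thesis
    using assms(3) unfolding character_def torus_def by (simp add: power_int_add prod.distrib)
qed

lemma character_0: "character 0 t = 1"
  unfolding character_def by simp

lemma character_scale:
  assumes "x \<in> int_lattice" "t \<in> torus"
  shows "character (real n *\<^sub>R x) t = character x t ^ n"
proof (induction n)
  case 0
  then show ?case by (simp add: character_0)
next
  case (Suc n)
  have "real n *\<^sub>R x \<in> int_lattice" using assms(1) by (intro int_lattice_scale) auto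
  from character_add[OF assms(1) this assms(2)] Suc show ?case by (simp add: algebra_simps)
qed

lemma character_sum:
  assumes "finite J" "\<And>j. j \<in> J \<Longrightarrow> W j \<in> int_lattice" "t \<in> torus"
  shows "character (\<Sum>j\<in>J. real (e j) *\<^sub>R W j) t = (\<Prod>j\<in>J. character (W j) t ^ e j)"
  using assms(1,2)
proof (induction J rule: finite_induct)
  case empty
  then show ?case by (simp add: character_0)
next
  case (insert j J)
  have "real (e j) *\<^sub>R W j \<in> int_lattice" using insert.prems by (intro int_lattice_scale) auto
  moreover have "(\<Sum>j\<in>J. real (e j) *\<^sub>R W j) \<in> int_lattice"
    using insert.prems by (intro int_lattice_sum int_lattice_scale) auto
  ultimately show ?case
    using insert character_scale[OF _ assms(3), of "W j" "e j"] by (simp add: character_add[OF _ _ assms(3)])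
qed

lemma character_nonzero: "t \<in> torus \<Longrightarrow> character x t \<noteq> 0"
  unfolding character_def torus_def by simp

text \<open>Because the edge vectors form a lattice basis, the equations are linear in the
  logarithms and are solved by the dual basis.\<close>

lemma characters_surjective:
  fixes W :: "'n::finite \<Rightarrow> real ^ 'n"
  assumes corner: "corner P v W" and \<tau>: "\<And>j. \<tau> j \<noteq> 0"
  obtains t where "t \<in> torus" "\<forall>j. character (W j) t = \<tau> j"
proof -
  obtain l where l: "\<forall>j. linear (l j)" "\<forall>j k. l j (W k) = (if j = k then 1 else 0)"
    "\<forall>x. x = (\<Sum>j\<in>UNIV. l j x *\<^sub>R W j)" "\<forall>j. \<forall>x\<in>int_lattice. l j x \<in> \<int>"
    by (rule corner_dual[OF corner])
  define T where "T k = (\<Sum>i\<in>UNIV. of_real (l i (\<e> k)) * Ln (\<tau> i))" for k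
  define t :: "complex ^ 'n" where "t = (\<chi> k. exp (T k))"
  have "character (W j) t = \<tau> j" for j
  proof -
    have fl: "of_int \<lfloor>W j $ k\<rfloor> = W j $ k" for k
      using corner_lattice(1)[OF corner, of j] unfolding int_lattice_def by (auto simp: Ints_def elim!: allE[of _ k])
    have lW: "l i (W j) = (\<Sum>k\<in>UNIV. W j $ k * l i (\<e> k))" for i
    proof -
      have "l i (W j) = l i (\<Sum>k\<in>UNIV. W j $ k *\<^sub>R \<e> k)" using vec_sum_units[of "W j"] by simp
      also have "\<dots> = (\<Sum>k\<in>UNIV. W j $ k * l i (\<e> k))" using l(1) by (simp add: linear_sum linear_scale)
      finally show ?thesis .
    qed
    have "character (W j) t = exp (\<Sum>k\<in>UNIV. of_int \<lfloor>W j $ k\<rfloor> * T k)"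
      unfolding character_def t_def by (simp add: exp_sum exp_power_int)
    also have "(\<Sum>k\<in>UNIV. of_int \<lfloor>W j $ k\<rfloor> * T k) =
        (\<Sum>k\<in>UNIV. \<Sum>i\<in>UNIV. of_real (W j $ k * l i (\<e> k)) * Ln (\<tau> i))"
    proof (rule sum.cong[OF refl])
      fix k
      have "(of_int \<lfloor>W j $ k\<rfloor> :: complex) = of_real (W j $ k)" using fl[of k] by (metis of_real_of_int_eq)
      then show "of_int \<lfloor>W j $ k\<rfloor> * T k = (\<Sum>i\<in>UNIV. of_real (W j $ k * l i (\<e> k)) * Ln (\<tau> i))"
        unfolding T_def by (simp add: sum_distrib_left mult.assoc)
    qed
    also have "\<dots> = (\<Sum>i\<in>UNIV. of_real (l i (W j)) * Ln (\<tau> i))"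
      unfolding lW of_real_sum sum_distrib_right by (rule sum.swap)
    also have "\<dots> = (\<Sum>i\<in>UNIV. if i = j then Ln (\<tau> i) else 0)"
      using l(2) by (intro sum.cong) auto
    also have "\<dots> = Ln (\<tau> j)" by simp
    finally show ?thesis using \<tau> by simp
  qed
  moreover have "t \<in> torus" unfolding torus_def t_def by simp
  ultimately show ?thesis using that by blast
qed

subsection \<open>Charts are AGL-equivalent to the polytope\<close>

lemma chart_coordinates:
  fixes P :: "(real ^ 'n) set"
  assumes corner: "corner P v W" and v: "v \<in> int_lattice"
  obtains A b where "(\<lambda>x. A *v x + b) \<in> AGL" "\<forall>x. v + (\<Sum>j\<in>UNIV. (A *v x + b) $ j *\<^sub>R W j) = x"
    "\<forall>y. A *v (v + (\<Sum>j\<in>UNIV. y $ j *\<^sub>R W j)) + b = y" "\<forall>x\<in>int_lattice. A *v x + b \<in> int_lattice"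
proof -
  obtain l where l: "\<forall>j. linear (l j)" "\<forall>j k. l j (W k) = (if j = k then 1 else 0)"
    "\<forall>x. x = (\<Sum>j\<in>UNIV. l j x *\<^sub>R W j)" "\<forall>j. \<forall>x\<in>int_lattice. l j x \<in> \<int>"
    by (rule corner_dual[OF corner])
  define g where "g x = (\<chi> j. l j x)" for x
  have lin: "linear g"
    unfolding g_def using l(1) by (intro linearI) (simp_all add: vec_eq_iff linear_add linear_scale)
  define A where "A = matrix g"
  define b where "b = - g v"
  have \<phi>: "A *v x + b = g (x - v)" for x
    unfolding A_def b_def using lin by (simp add: linear_diff)
  have fwd: "v + (\<Sum>j\<in>UNIV. (A *v x + b) $ j *\<^sub>R W j) = x" for x
  proof -
    have "(\<Sum>j\<in>UNIV. g (x - v) $ j *\<^sub>R W j) = x - v" unfolding g_def using l(3) by simp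
    then show ?thesis unfolding \<phi> by simp
  qed
  have bwd: "A *v (v + (\<Sum>j\<in>UNIV. y $ j *\<^sub>R W j)) + b = y" for y
  proof -
    have "(\<Sum>j\<in>UNIV. (A *v (v + (\<Sum>j\<in>UNIV. y $ j *\<^sub>R W j)) + b) $ j *\<^sub>R W j) = (\<Sum>j\<in>UNIV. y $ j *\<^sub>R W j)"
      using fwd[of "v + (\<Sum>j\<in>UNIV. y $ j *\<^sub>R W j)"] by simp
    from corner_coeff_unique[OF corner this] show ?thesis by (metis vec_eq_iff)
  qed
  have lat: "A *v x + b \<in> int_lattice" if "x \<in> int_lattice" for x
    unfolding \<phi> g_def int_lattice_def using l(4) int_lattice_diff[OF that v] by simp
  have lat': "v + (\<Sum>j\<in>UNIV. y $ j *\<^sub>R W j) \<in> int_lattice" if "y \<in> int_lattice" for y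
    using that corner_lattice(1)[OF corner]
    by (intro int_lattice_add v int_lattice_sum int_lattice_scale) (auto simp: int_lattice_def)
  have "bij_betw (\<lambda>x. A *v x + b) int_lattice int_lattice"
    by (rule bij_betwI[where g = "\<lambda>y. v + (\<Sum>j\<in>UNIV. y $ j *\<^sub>R W j)"])
      (use lat lat' fwd bwd in auto)
  then have "(\<lambda>x. A *v x + b) \<in> AGL" unfolding AGL_def by blast
  with fwd bwd lat show ?thesis using that[of A b] by simp
qed

section \<open>From the polytope to the dimension of its secant variety\<close>

theorem corollary1p5:
  fixes P :: "(real ^ 'n) set" and u :: "nat \<Rightarrow> real ^ 'n" and r :: nat
  assumes "smooth_polytope P"
    and "aff_dim P = int CARD('n)"
    and "bij_betw u {0..r} (P \<inter> int_lattice)"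
    and "\<not> (2 \<le> CARD('n) \<and> AGL_equivalent P two_simplex)"
    and "\<not> (\<exists>k Q. k + 3 \<le> CARD('n) \<and> is_truncated_two_simplex k Q \<and> AGL_equivalent P Q)"
    and "\<not> (\<exists>l I. 2 \<le> l \<and> l + 2 \<le> CARD('n) \<and> card I = l \<and>
              AGL_equivalent P (simplex_product I))"
  shows "krull_dim (subtopology (zariski r) (secant_variety r (toric_variety r u)))
           = enat (min r (2 * CARD('n) + 1))"
proof -
  have fin: "finite (P \<inter> int_lattice)" using assms(3) bij_betw_finite by blast
  interpret smooth_full_polytope P by unfold_locales (fact assms(1) assms(2) fin)+
  obtain v W where corner: "corner P v W"
    and cls: "full_rank (chart P v W) \<or> thin (chart P v W) \<or> exceptional (chart P v W)"
    by (rule corner_classification)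
  define X where "X = chart P v W"
  have latP: "lattice_polytope P" using assms(1) unfolding smooth_polytope_def by blast
  have vlat: "v \<in> int_lattice"
    using corner lattice_polytope_extreme[OF latP] unfolding corner_def by blast
  obtain A b where Ab: "(\<lambda>x. A *v x + b) \<in> AGL"
    and fwd: "\<forall>x. v + (\<Sum>j\<in>UNIV. (A *v x + b) $ j *\<^sub>R W j) = x"
    and bwd: "\<forall>y. A *v (v + (\<Sum>j\<in>UNIV. y $ j *\<^sub>R W j)) + b = y"
    and lat: "\<forall>x\<in>int_lattice. A *v x + b \<in> int_lattice"
    by (rule chart_coordinates[OF corner vlat])
  define \<phi> where "\<phi> x = A *v x + b" for x
  have \<phi>X: "\<phi> x \<in> X \<longleftrightarrow> x \<in> P" for x unfolding X_def chart_def \<phi>_def using fwd by simp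
  have "\<phi> ` P = X"
  proof
    show "\<phi> ` P \<subseteq> X" using \<phi>X by blast
    show "X \<subseteq> \<phi> ` P"
    proof
      fix y assume y: "y \<in> X"
      have "y = \<phi> (v + (\<Sum>j\<in>UNIV. y $ j *\<^sub>R W j))" unfolding \<phi>_def by (rule bwd[rule_format, symmetric])
      moreover have "v + (\<Sum>j\<in>UNIV. y $ j *\<^sub>R W j) \<in> P" using y unfolding X_def chart_def by (rule CollectD)
      ultimately show "y \<in> \<phi> ` P" by (rule image_eqI)
    qed
  qed
  moreover have "\<phi> \<in> AGL" using Ab unfolding \<phi>_def .
  ultimately have "AGL_equivalent P X" unfolding AGL_equivalent_def by blast
  \<comment> \<open>The chart is itself an AGL-image of \<open>P\<close>, so the excluded shapes are
    excluded for it.\<close>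
  then have "\<not> exceptional X" unfolding exceptional_def using assms(4-6) by metis
  then have cls': "full_rank X \<or> thin X" using cls unfolding X_def by blast
  obtain a c where "polytope_corner P v W a c" using polytope_corner_exists[OF corner] by blast
  then interpret C: polytope_corner P v W a c .
  define y where "y i = \<phi> (u i)" for i
  have uP: "u i \<in> P \<inter> int_lattice" if "i \<le> r" for i using assms(3) that by (auto simp: bij_betw_def)
  have yX: "y i \<in> X \<inter> int_lattice" if "i \<le> r" for i
    using uP[OF that] \<phi>X lat unfolding y_def \<phi>_def by auto
  have uy: "u i = v + (\<Sum>j\<in>UNIV. y i $ j *\<^sub>R W j)" for i unfolding y_def \<phi>_def using fwd by simp
  have y_surj: "\<exists>i\<le>r. y i = z" if z: "z \<in> X \<inter> int_lattice" for z
  proof -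
    define x where "x = v + (\<Sum>j\<in>UNIV. z $ j *\<^sub>R W j)"
    have "x \<in> P" using z unfolding x_def X_def chart_def by blast
    moreover have "x \<in> int_lattice"
      unfolding x_def using z corner_lattice(1)[OF corner]
      by (intro int_lattice_add vlat int_lattice_sum int_lattice_scale) (auto simp: int_lattice_def)
    ultimately have "x \<in> u ` {0..r}" using assms(3) unfolding bij_betw_def by blast
    then obtain i where "i \<le> r" "u i = x" by auto
    moreover have "\<phi> x = z" unfolding x_def \<phi>_def using bwd by blast
    ultimately show ?thesis unfolding y_def by blast
  qed
  have y_inj: "i = i'" if "i \<le> r" "i' \<le> r" "y i = y i'" for i i'
  proof -
    have "u i = u i'" using uy[of i] uy[of i'] that(3) by simp
    then show ?thesis using assms(3) that unfolding bij_betw_def by (auto dest: inj_onD)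
  qed
  define m where "m i j = nat \<lfloor>y i $ j\<rfloor>" for i j
  have my: "real (m i j) = y i $ j" if "i \<le> r" for i j
  proof -
    have "y i $ j \<in> \<int>" "0 \<le> y i $ j"
      using yX[OF that] C.nonneg[of "y i" j] unfolding int_lattice_def X_def by auto
    then show ?thesis unfolding m_def by (auto simp: Ints_def)
  qed
  have mvec: "(\<chi> j. real (m i j)) = y i" if "i \<le> r" for i using my[OF that] by (simp add: vec_eq_iff)
  have mdeg: "real (\<Sum>j\<in>UNIV. m i j) = deg (y i)" if "i \<le> r" for i
    unfolding deg_def using my[OF that] by simp
  obtain i0 where i0: "i0 \<le> r" "y i0 = 0"
    using y_surj[of 0] C.zero_in unfolding X_def by (auto simp: int_lattice_def)
  have "\<forall>j. \<exists>i. i \<le> r \<and> y i = \<e> j"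
    using y_surj C.unit_in axis_in_lattice unfolding X_def by blast
  from choice[OF this] obtain \<epsilon> where \<epsilon>: "\<And>j. \<epsilon> j \<le> r" "\<And>j. y (\<epsilon> j) = \<e> j" by blast
  interpret M: monomial_secant m r i0 \<epsilon>
  proof
    show "i0 \<le> r" "\<epsilon> j \<le> r" for j using i0 \<epsilon> by auto
    show "m i0 = (\<lambda>_. 0)" using i0(2) by (auto simp: m_def)
    show "m (\<epsilon> j) = (\<lambda>k. if k = j then 1 else 0)" for j
      using \<epsilon>(2)[of j] by (auto simp: m_def unit_nth)
  qed
  have toric: "toric_variety r u = zariski r closure_of M.tor_points"
  proof -
    \<comment> \<open>Since \<open>u i\<close> is \<open>v\<close> plus a combination of the
      \<open>W j\<close> with coefficients \<open>m i\<close>, its character is a monomial in the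
      characters of the \<open>W j\<close>, up to the factor \<open>character v t\<close>, which
      disappears projectively.\<close>
    define pu where "pu t i = (if i \<le> r then character (u i) t else 0)" for t i
    have pu: "pu t = (\<lambda>i. character v t * M.pt 1 0 (\<lambda>j. character (W j) t) (\<lambda>j. character (W j) t) i)"
      if t: "t \<in> torus" for t
    proof
      fix i
      show "pu t i = character v t * M.pt 1 0 (\<lambda>j. character (W j) t) (\<lambda>j. character (W j) t) i"
      proof (cases "i \<le> r")
        case True
        have "u i = v + (\<Sum>j\<in>UNIV. real (m i j) *\<^sub>R W j)" using uy[of i] my[OF True] by simp
        moreover have "(\<Sum>j\<in>UNIV. real (m i j) *\<^sub>R W j) \<in> int_lattice"
          using corner_lattice(1)[OF corner] by (intro int_lattice_sum int_lattice_scale) auto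
        ultimately have "character (u i) t = character v t * (\<Prod>j\<in>UNIV. character (W j) t ^ m i j)"
          using character_add[OF vlat _ t] character_sum[of UNIV W t "m i"] corner_lattice(1)[OF corner] t by simp
        then show ?thesis using True unfolding pu_def M.pt_def mono_val_def by simp
      next
        case False
        then show ?thesis unfolding pu_def M.pt_def by simp
      qed
    qed
    have same: "proj_pt (pu t) = proj_pt (M.pt 1 0 (\<lambda>j. character (W j) t) (\<lambda>j. character (W j) t))"
      and mem: "(\<lambda>j. character (W j) t) \<in> subtorus UNIV" if t: "t \<in> torus" for t
    proof -
      show s: "(\<lambda>j. character (W j) t) \<in> subtorus UNIV"
        unfolding subtorus_def using character_nonzero[OF t] by simp
      have "M.pt 1 0 (\<lambda>j. character (W j) t) (\<lambda>j. character (W j) t) \<in> hom_coords r"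
        by (rule M.Tor_hom[OF M.pt_in_Tor[OF _ s]]) simp
      then show "proj_pt (pu t) = proj_pt (M.pt 1 0 (\<lambda>j. character (W j) t) (\<lambda>j. character (W j) t))"
        using proj_pt_eq_iff pu[OF t] character_nonzero[OF t] by blast
    qed
    have "(\<lambda>t. proj_pt (pu t)) ` torus = M.tor_points"
    proof
      show "(\<lambda>t. proj_pt (pu t)) ` torus \<subseteq> M.tor_points"
        unfolding M.tor_points_def using same mem by auto
      show "M.tor_points \<subseteq> (\<lambda>t. proj_pt (pu t)) ` torus"
      proof
        fix x assume "x \<in> M.tor_points"
        then obtain \<tau> where \<tau>: "\<tau> \<in> subtorus UNIV" "x = proj_pt (M.pt 1 0 \<tau> \<tau>)"
          unfolding M.tor_points_def by blast
        obtain t where t: "t \<in> torus" "\<forall>j. character (W j) t = \<tau> j"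
          by (rule characters_surjective[OF corner, of \<tau>]) (use \<tau>(1) in \<open>auto simp: subtorus_def\<close>)
        then have "(\<lambda>j. character (W j) t) = \<tau>" by blast
        then have "x = proj_pt (pu t)" using same[OF t(1)] \<tau>(2) by simp
        then show "x \<in> (\<lambda>t. proj_pt (pu t)) ` torus" using t(1) by blast
      qed
    qed
    then show ?thesis unfolding toric_variety_def pu_def by simp
  qed
  have Sec: "secant_variety r (toric_variety r u) = proj_closure r (M.Sec UNIV)"
    unfolding toric by (rule M.secant_variety_eq)
  define H where "H = {i. i \<le> r \<and> (\<Sum>j\<in>UNIV. m i j) \<ge> 2}"
  have finH: "finite H" unfolding H_def by simp
  have H_iff: "i \<in> H \<longleftrightarrow> 2 \<le> deg (y i)" if "i \<le> r" for i
  proof -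
    have "2 \<le> deg (y i) \<longleftrightarrow> real 2 \<le> real (\<Sum>j\<in>UNIV. m i j)" using mdeg[OF that] by simp
    also have "\<dots> \<longleftrightarrow> 2 \<le> (\<Sum>j\<in>UNIV. m i j)" by (rule of_nat_le_iff)
    finally show ?thesis unfolding H_def using that by simp
  qed
  have cases: "i = i0 \<or> i \<in> range \<epsilon> \<or> (\<Sum>j\<in>UNIV. m i j) \<ge> 2" if i: "i \<le> r" for i
  proof (cases "i \<in> H")
    case True
    then show ?thesis unfolding H_def by simp
  next
    case False
    then have "deg (y i) < 2" using H_iff[OF i] by simp
    then have "y i = 0 \<or> (\<exists>j. y i = \<e> j)"
      using lattice_deg_le_1[of "y i"] yX[OF i] C.nonneg unfolding X_def by blast
    then show ?thesis using y_inj[OF i i0(1)] y_inj[OF i \<epsilon>(1)] i0(2) \<epsilon>(2) by (metis rangeI)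
  qed
  have lead: "M.leading_coords H = {..r}"
    unfolding M.leading_coords_def H_def using cases i0(1) \<epsilon>(1) by auto
  \<comment> \<open>Thus \<open>r = CARD('n) + card H\<close>, and the minimum is decided by whether
    \<open>card H\<close> exceeds \<open>CARD('n)\<close>: it does in the full-rank case and does
    not in the thin one.\<close>
  have card_lead: "CARD('n) + 1 + card H = r + 1"
    using M.card_leading_coords[OF finH] lead unfolding H_def by simp
  from cls' show ?thesis
  proof
    assume full: "full_rank X"
    have sep: "\<exists>A'\<subseteq>H. card A' = card J + 1 \<and> torus_separating m J A'" for J
    proof (rule full_rank_separating)
      fix \<alpha> \<beta> assume *: "\<And>i. i \<in> H \<Longrightarrow> \<alpha> \<bullet> (\<chi> j. real (m i j)) = \<beta>"
      have "\<alpha> \<bullet> z = \<beta>" if z: "z \<in> X \<inter> int_lattice" "2 \<le> deg z" for z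
      proof -
        obtain i where i: "i \<le> r" "y i = z" using y_surj[OF z(1)] by blast
        then have "i \<in> H" using H_iff z(2) by simp
        from *[OF this] show ?thesis using mvec[OF i(1)] i(2) by simp
      qed
      then show "\<alpha> = 0" using full unfolding full_rank_def by blast
    qed
    have "krull_dim (subtopology (zariski r) (proj_closure r (M.Sec UNIV))) = enat (2 * CARD('n) + 1)"
    proof (rule M.krull_dim_nondefective)
      fix J
      obtain A' where "A' \<subseteq> H" "card A' = card J + 1" "torus_separating m J A'" using sep[of J] by blast
      then show "\<exists>A. (\<forall>i\<in>A. i \<le> r \<and> (\<Sum>j\<in>UNIV. m i j) \<ge> 2) \<and> card A = card J + 1 \<and> torus_separating m J A"
        unfolding H_def by blast
    qed
    moreover have "2 * CARD('n) + 1 \<le> r"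
    proof -
      obtain A' where A': "A' \<subseteq> H" "card A' = CARD('n) + 1" using sep[of UNIV] by blast
      then have "CARD('n) + 1 \<le> card H" using card_mono[OF finH, of A'] by simp
      then show ?thesis using card_lead by simp
    qed
    ultimately show ?thesis unfolding Sec by (simp add: min_def)
  next
    assume "thin X"
    then obtain p where p: "\<And>z. z \<in> X \<inter> int_lattice \<Longrightarrow> 2 \<le> deg z \<Longrightarrow> \<exists>j. z = \<e> p + \<e> j"
      unfolding thin_def by blast
    have "\<forall>i\<in>H. \<exists>j. y i = \<e> p + \<e> j"
    proof
      fix i assume i: "i \<in> H"
      then have "i \<le> r" unfolding H_def by simp
      then show "\<exists>j. y i = \<e> p + \<e> j" using p[OF yX] H_iff i by blast
    qed
    from bchoice[OF this] obtain \<kappa> where \<kappa>: "\<And>i. i \<in> H \<Longrightarrow> y i = \<e> p + \<e> (\<kappa> i)" by blast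
    have inj: "inj_on \<kappa> H"
    proof (rule inj_onI)
      fix i i' assume "i \<in> H" "i' \<in> H" "\<kappa> i = \<kappa> i'"
      then show "i = i'" using \<kappa> y_inj unfolding H_def by simp
    qed
    have "torus_separating m UNIV H"
    proof (rule thin_separating[OF inj])
      fix i k assume i: "i \<in> H"
      show "m i k = (if k = p then 1 else 0) + (if k = \<kappa> i then 1 else 0)"
        unfolding m_def \<kappa>[OF i] by (simp add: unit_nth)
    qed
    then have "krull_dim (subtopology (zariski r) (proj_closure r (M.Sec UNIV))) = enat r"
      unfolding H_def by (intro M.krull_dim_fill cases)
    moreover have "r \<le> 2 * CARD('n) + 1"
    proof -
      have "card H \<le> CARD('n)" using card_inj_on_le[OF inj, of UNIV] by simp
      then show ?thesis using card_lead by simp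
    qed
    ultimately show ?thesis unfolding Sec by simp
  qed
qed

end
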